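(* Consider smooth complex vector fields $\vec{c}$ (with three components in $\mathbb{C}$) on connected open subsets of $\mathbb{R}^3$ which satisfy $$\vec{\nabla}\times\vec{c}=\vec{c}$$ and may be expressed in the form $$\vec{c}=e^{ig}\,\vec{\nabla}F,$$ with $g$ a real-valued function and $F$ a complex-valued function. There are precisely two classes of such fields. That is, $\vec{c}$ is such a field if and only if, for a suitable choice of right-handed Cartesian coordinate system $(x,y,z)$ with associated spherical coordinates $(r,\theta,\phi)$, it can be expressed (locally) in one of the following two forms. (A) (Cartesian case) $g=z$ and $F$ is a complex analytic function of $x+iy$, so that $$\vec{c}=e^{iz}\,\vec{\nabla}\bigl(F(x+iy)\bigr)=e^{iz}F'(x+iy)\,(1,i,0).$$ (B) (Spherical case) $g=r$ and $F$ is a complex analytic function of the variable $-\operatorname{arctanh}(\cos\theta)+i\phi$, with the additional requirement that the resulting vector field be single valued, so that $$\vec{c}=\frac{e^{ir}}{r\sin\theta}\,\bigl[\hat{\theta}+i\hat{\phi}\bigr]\,F'\bigl(-\operatorname{arctanh}(\cos\theta)+i\phi\bigr).$$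
   Context: The gradient and curl of complex-valued functions and fields are taken componentwise, extending the real operations on $\mathbb{R}^3$ complex-linearly. The cross product is extended complex-bilinearly. A suitable choice of Cartesian coordinate system means a choice of origin and of right-handed orthonormal axes in $\mathbb{R}^3$. The associated spherical coordinates are $x=r\sin\theta\cos\phi$, $y=r\sin\theta\sin\phi$, $z=r\cos\theta$, and $\hat{r},\hat{\theta},\hat{\phi}$ is the corresponding orthonormal frame. Form (B) is understood away from the polar axis $\sin\theta=0$. $F'$ denotes the complex derivative of the analytic function $F$ with respect to its single complex argument. In (B), single-valuedness refers to $\phi\mapsto\phi+2\pi$; it is ensured by requiring that $F$ be either $2\pi$-periodic in $\phi$ or a complex scalar multiple of the identity function. Adding a real constant to $g$ does not change the form of $\vec{c}$, since the constant phase can be absorbed into $F$.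
   Formalization: In (B) r may be plus or minus the distance to the origin: complex conjugates of form-(B) fields also satisfy the conditions but have g = −distance. The expression e^{ig}∇F is required locally, with g and F smooth, since F may be multivalued globally. *)

theory Defs
  imports "HOL-Complex_Analysis.Complex_Analysis"
begin

section \<open>Smooth maps on open sets\<close>

text \<open>Intended for open S: all iterated directional derivatives up to order k exist and the
  last ones are continuous.\<close>

primrec Ck_on ::
  "nat \<Rightarrow> 'a::real_normed_vector set \<Rightarrow> ('a \<Rightarrow> 'b::real_normed_vector) \<Rightarrow> bool" where
  "Ck_on 0 S f \<longleftrightarrow> continuous_on S f"
| "Ck_on (Suc k) S f \<longleftrightarrow>
     (\<forall>x\<in>S. f differentiable (at x)) \<and>
     (\<forall>v. Ck_on k S (\<lambda>x. frechet_derivative f (at x) v))"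

definition smooth_on ::
  "'a::real_normed_vector set \<Rightarrow> ('a \<Rightarrow> 'b::real_normed_vector) \<Rightarrow> bool" where
  "smooth_on S f \<longleftrightarrow> (\<forall>k. Ck_on k S f)"

section \<open>Gradient and curl of complex-valued functions and fields on three-space\<close>

definition partial_deriv :: "3 \<Rightarrow> (real^3 \<Rightarrow> complex) \<Rightarrow> real^3 \<Rightarrow> complex" where
  "partial_deriv k f P = frechet_derivative f (at P) (axis k 1)"

definition grad :: "(real^3 \<Rightarrow> complex) \<Rightarrow> real^3 \<Rightarrow> complex^3" where
  "grad f P = (\<chi> k. partial_deriv k f P)"

definition curl :: "(real^3 \<Rightarrow> complex^3) \<Rightarrow> real^3 \<Rightarrow> complex^3" where
  "curl c P = vector
     [partial_deriv 2 (\<lambda>Q. c Q $ 3) P - partial_deriv 3 (\<lambda>Q. c Q $ 2) P,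
      partial_deriv 3 (\<lambda>Q. c Q $ 1) P - partial_deriv 1 (\<lambda>Q. c Q $ 3) P,
      partial_deriv 1 (\<lambda>Q. c Q $ 2) P - partial_deriv 2 (\<lambda>Q. c Q $ 1) P]"

definition cvec :: "real^3 \<Rightarrow> complex^3" where
  "cvec v = (\<chi> k. complex_of_real (v $ k))"

definition phase_gradient_on ::
  "(real^3) set \<Rightarrow> (real^3 \<Rightarrow> complex^3) \<Rightarrow> (real^3 \<Rightarrow> real) \<Rightarrow> (real^3 \<Rightarrow> complex) \<Rightarrow> bool" where
  "phase_gradient_on V c g F \<longleftrightarrow>
     smooth_on V g \<and> smooth_on V F \<and>
     (\<forall>P\<in>V. c P = exp (\<i> * complex_of_real (g P)) *s grad F P)"

section \<open>Coordinate systems\<close>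

definition right_handed_axes :: "real^3 \<Rightarrow> real^3 \<Rightarrow> real^3 \<Rightarrow> bool" where
  "right_handed_axes e1 e2 e3 \<longleftrightarrow>
     norm e1 = 1 \<and> norm e2 = 1 \<and> norm e3 = 1 \<and>
     e1 \<bullet> e2 = 0 \<and> e2 \<bullet> e3 = 0 \<and> e1 \<bullet> e3 = 0 \<and> e3 = cross3 e1 e2"

text \<open>The coordinate of P along the axis e, for the origin q.\<close>

definition coord :: "real^3 \<Rightarrow> real^3 \<Rightarrow> real^3 \<Rightarrow> real" where
  "coord q e P = (P - q) \<bullet> e"

definition polar_axis :: "real^3 \<Rightarrow> real^3 \<Rightarrow> real^3 \<Rightarrow> (real^3) set" where
  "polar_axis q e1 e2 = {P. coord q e1 P = 0 \<and> coord q e2 P = 0}"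

text \<open>A smooth local determination of the spherical coordinates, away from the polar axis.
  Only the three defining equations are imposed; in particular r may be negative, i.e. minus the
  distance to q.  The classification needs both signs: since curl c = c is a real equation, the
  complex conjugate of a field with g equal to the distance is again a solution, with g equal to
  minus the distance.\<close>

definition spherical_chart ::
  "real^3 \<Rightarrow> real^3 \<Rightarrow> real^3 \<Rightarrow> real^3 \<Rightarrow> (real^3) set \<Rightarrow>
   (real^3 \<Rightarrow> real) \<Rightarrow> (real^3 \<Rightarrow> real) \<Rightarrow> (real^3 \<Rightarrow> real) \<Rightarrow> bool" where
  "spherical_chart q e1 e2 e3 V r \<theta> \<phi> \<longleftrightarrow>
     smooth_on V r \<and> smooth_on V \<theta> \<and> smooth_on V \<phi> \<and>
     (\<forall>P\<in>V. r P \<noteq> 0 \<and> sin (\<theta> P) \<noteq> 0 \<and>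
        coord q e1 P = r P * sin (\<theta> P) * cos (\<phi> P) \<and>
        coord q e2 P = r P * sin (\<theta> P) * sin (\<phi> P) \<and>
        coord q e3 P = r P * cos (\<theta> P))"

definition theta_hat :: "real^3 \<Rightarrow> real^3 \<Rightarrow> real^3 \<Rightarrow> real \<Rightarrow> real \<Rightarrow> real^3" where
  "theta_hat e1 e2 e3 t p =
     (cos t * cos p) *\<^sub>R e1 + (cos t * sin p) *\<^sub>R e2 - sin t *\<^sub>R e3"

definition phi_hat :: "real^3 \<Rightarrow> real^3 \<Rightarrow> real \<Rightarrow> real^3" where
  "phi_hat e1 e2 p = - sin p *\<^sub>R e1 + cos p *\<^sub>R e2"

section \<open>The two forms\<close>

text \<open>The vector (1, i, 0) of the coordinate system with axes e1, e2, e3 is e1 + i e2.\<close>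

definition cartesian_form_on ::
  "(real^3) set \<Rightarrow> real^3 \<Rightarrow> real^3 \<Rightarrow> real^3 \<Rightarrow> real^3 \<Rightarrow> (real^3 \<Rightarrow> complex^3) \<Rightarrow> bool" where
  "cartesian_form_on V q e1 e2 e3 c \<longleftrightarrow>
     (\<exists>D F. open D \<and> F holomorphic_on D \<and>
        (let z = coord q e3;
             w = (\<lambda>P. Complex (coord q e1 P) (coord q e2 P))
         in \<forall>P\<in>V. w P \<in> D \<and>
              c P = exp (\<i> * complex_of_real (z P)) *s grad (\<lambda>Q. F (w Q)) P \<and>
              c P = (exp (\<i> * complex_of_real (z P)) * deriv F (w P)) *s
                      (cvec e1 + \<i> *s cvec e2)))"

text \<open>Increasing the azimuth by a full turn adds 2 pi i to the argument of F.\<close>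

definition admissible_spherical :: "complex set \<Rightarrow> (complex \<Rightarrow> complex) \<Rightarrow> bool" where
  "admissible_spherical D F \<longleftrightarrow>
     (\<forall>w. w + 2 * of_real pi * \<i> \<in> D \<longleftrightarrow> w \<in> D) \<and>
     ((\<forall>w\<in>D. F (w + 2 * of_real pi * \<i>) = F w) \<or> (\<exists>a. \<forall>w\<in>D. F w = a * w))"

definition spherical_form_on ::
  "(real^3) set \<Rightarrow> real^3 \<Rightarrow> real^3 \<Rightarrow> real^3 \<Rightarrow> real^3 \<Rightarrow> (real^3 \<Rightarrow> complex^3) \<Rightarrow> bool" where
  "spherical_form_on V q e1 e2 e3 c \<longleftrightarrow>
     (\<exists>r \<theta> \<phi> D F. spherical_chart q e1 e2 e3 V r \<theta> \<phi> \<and>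
        open D \<and> F holomorphic_on D \<and> admissible_spherical D F \<and>
        (let w = (\<lambda>P. Complex (- artanh (cos (\<theta> P))) (\<phi> P))
         in \<forall>P\<in>V. w P \<in> D \<and>
              c P = exp (\<i> * complex_of_real (r P)) *s grad (\<lambda>Q. F (w Q)) P \<and>
              c P = (exp (\<i> * complex_of_real (r P)) / complex_of_real (r P * sin (\<theta> P))
                       * deriv F (w P)) *s
                      (cvec (theta_hat e1 e2 e3 (\<theta> P) (\<phi> P)) +
                       \<i> *s cvec (phi_hat e1 e2 (\<phi> P)))))"

definition locally_at ::
  "(real^3) set \<Rightarrow> (real^3) set \<Rightarrow> ((real^3) set \<Rightarrow> bool) \<Rightarrow> bool" where
  "locally_at U S P \<longleftrightarrow> (\<forall>p\<in>S. \<exists>V. open V \<and> p \<in> V \<and> V \<subseteq> U \<and> P V)"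

end

theory Submission
  imports Defs
begin

text \<open>For \<open>c = e\<^sup>i\<^sup>g \<nabla>F\<close> the equation \<open>\<nabla> \<times> c = c\<close> says \<open>c = i n \<times> c\<close> with
  \<open>n = \<nabla>g\<close>.  Where \<open>c \<noteq> 0\<close>, this forces \<open>|n| = 1\<close>, \<open>n \<cdot> \<nabla>F = 0\<close> and \<open>(\<nabla>F)\<^sup>2 = 0\<close>;
  differentiating the last two relations shows that the Hessian of \<open>g\<close> is isotropic on the planes
  orthogonal to \<open>n\<close>, i.e. the level surfaces of \<open>g\<close> are umbilic.  The Codazzi equation then leaves
  only planes (\<open>n\<close> constant) and concentric spheres (\<open>n = \<plusminus>(x - q)/|x - q|\<close>), and \<open>F\<close>, which is
  constant along \<open>n\<close> and satisfies the Cauchy-Riemann equations across it, is a holomorphic function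
  of \<open>x + iy\<close>, respectively of \<open>- artanh (cos \<theta>) + i \<phi>\<close>.

  The zeros of \<open>c\<close> are harmless because \<open>F\<close> is harmonic with \<open>(\<nabla>F)\<^sup>2 = 0\<close>, so that
  \<open>ln (|F|\<^sup>2 + \<epsilon>)\<close> is subharmonic and a three-spheres argument gives unique continuation: \<open>c\<close>
  vanishes identically or on a set without interior.  In the first case there is nothing to prove;
  in the second \<open>n\<close> is determined by \<open>c\<close> on a dense set, hence globally.

  For the converse, the curl equation crosses the polar axis by continuity.  A potential near a
  point of the axis other than \<open>q\<close> comes from the Poincare lemma, once the sign of
  \<open>r\<close> is known to be the same all around the axis.  Near \<open>q\<close> itself a smooth field of
  spherical form has to vanish.\<close>

(* The infix $ would be ambiguous with the component of a vector. *)
no_notation fps_nth (infixl "$" 75)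

section \<open>Calculus of smooth maps\<close>

text \<open>Since curl grad F = 0, the curl of e^(ig) grad F is i n x c with n = grad g, so the
  differential equation is linear algebra in c at each point. Read backwards, the same identity says
  that e^(-ig) c is curl-free whenever curl c = c = i n x c, which is how a potential is found near
  the polar axis.

  The obstacle is that g and F are given only locally and that c does not determine n at its zeros.
  The local gradients can be glued only after the zeros are known to have empty interior; as g and F
  are merely smooth, this is done with the maximum principle.

  The glued field satisfies Dn = \<kappa> times the projection orthogonal to n, and the Codazzi
  equation d\<kappa> = -\<kappa>^2 n is a Riccati equation along n. Hence \<kappa> vanishes
  everywhere or nowhere, and in the second case P - n/\<kappa> is a fixed centre.

  The variable - artanh (cos \<theta>) + i \<phi> is the Mercator coordinate. It is conformal on
  spheres about q, so the Cauchy-Riemann equations across n become the usual ones.\<close>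

lemma Ck_on_cong:
  assumes "open S" "Ck_on k S f" "\<And>x. x \<in> S \<Longrightarrow> f x = g x"
  shows "Ck_on k S g"
  using assms(2,3)
proof (induction k arbitrary: f g)
  case 0
  then show ?case by (simp cong: continuous_on_cong)
next
  case (Suc k)
  have d: "(g has_derivative frechet_derivative f (at x)) (at x)" if "x \<in> S" for x
  proof -
    have "(f has_derivative frechet_derivative f (at x)) (at x)"
      using Suc.prems that frechet_derivative_works by auto
    then show ?thesis
      by (rule has_derivative_transform_within_open[OF _ \<open>open S\<close> that]) (rule Suc.prems(2))
  qed
  have e: "frechet_derivative g (at x) = frechet_derivative f (at x)" if "x \<in> S" for x
    using frechet_derivative_at[OF d[OF that]] by simp
  have "Ck_on k S (\<lambda>x. frechet_derivative g (at x) v)" for v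
    by (rule Suc.IH[of "\<lambda>x. frechet_derivative f (at x) v"]) (use Suc.prems(1) e in auto)
  then show ?case
    using d by (auto simp: differentiable_def)
qed

lemma smooth_on_cong:
  assumes "open S" "smooth_on S f" "\<And>x. x \<in> S \<Longrightarrow> f x = g x"
  shows "smooth_on S g"
  using Ck_on_cong[OF assms(1) _ assms(3)] assms(2) by (simp add: smooth_on_def)

lemma Ck_on_subset: "Ck_on k S f \<Longrightarrow> T \<subseteq> S \<Longrightarrow> Ck_on k T f"
  by (induction k arbitrary: f) (auto intro: continuous_on_subset)

lemma smooth_on_subset: "smooth_on S f \<Longrightarrow> T \<subseteq> S \<Longrightarrow> smooth_on T f"
  using Ck_on_subset[of _ S f T] by (simp add: smooth_on_def)

lemma Ck_on_SucD: "Ck_on (Suc k) S f \<Longrightarrow> Ck_on k S f"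
proof (induction k arbitrary: f)
  case 0
  then show ?case
    by (simp add: continuous_at_imp_continuous_on differentiable_imp_continuous_within)
next
  case (Suc k)
  show ?case
    using Suc.prems Suc.IH unfolding Ck_on.simps(2)[of "Suc k"] Ck_on.simps(2)[of k S f] by blast
qed

lemma smooth_on_differentiable:
  "smooth_on S f \<Longrightarrow> x \<in> S \<Longrightarrow> f differentiable (at x)"
  unfolding smooth_on_def using Ck_on.simps(2)[of 0 S f] by blast

lemma smooth_on_has_derivative:
  "smooth_on S f \<Longrightarrow> x \<in> S \<Longrightarrow> (f has_derivative frechet_derivative f (at x)) (at x)"
  using smooth_on_differentiable frechet_derivative_works by blast

lemma smooth_on_frechet_derivative:
  "smooth_on S f \<Longrightarrow> smooth_on S (\<lambda>x. frechet_derivative f (at x) v)"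
  unfolding smooth_on_def using Ck_on.simps(2)[of _ S f] by blast

lemma smooth_on_imp_continuous_on: "smooth_on S f \<Longrightarrow> continuous_on S f"
  unfolding smooth_on_def using Ck_on.simps(1)[of S f] by blast

lemma Ck_on_SucI:
  assumes "open S" "\<And>x. x \<in> S \<Longrightarrow> (f has_derivative f' x) (at x)"
    and "\<And>v. Ck_on k S (\<lambda>x. f' x v)"
  shows "Ck_on (Suc k) S f"
proof -
  have e: "f' x = frechet_derivative f (at x)" if "x \<in> S" for x
    by (rule frechet_derivative_at[OF assms(2)[OF that]])
  have "Ck_on k S (\<lambda>x. frechet_derivative f (at x) v)" for v
    by (rule Ck_on_cong[OF assms(1) assms(3)[of v]]) (simp add: e)
  then show ?thesis
    using assms(2) by (auto simp: differentiable_def)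
qed

lemma Ck_on_SucE:
  assumes "Ck_on (Suc k) S f" "x \<in> S"
  shows "(f has_derivative frechet_derivative f (at x)) (at x)"
  using assms frechet_derivative_works by auto

lemma smooth_onI_derivative:
  assumes "open S" "\<And>x. x \<in> S \<Longrightarrow> (f has_derivative f' x) (at x)"
    and "\<And>v. smooth_on S (\<lambda>x. f' x v)"
  shows "smooth_on S f"
proof -
  have "Ck_on (Suc k) S f" for k
    using assms(3) by (intro Ck_on_SucI[OF assms(1,2)]) (auto simp: smooth_on_def)
  then show ?thesis
    using Ck_on_SucD[of _ S f] by (simp only: smooth_on_def) blast
qed

lemma Ck_on_const: "Ck_on k S (\<lambda>x. a)"
  by (induction k arbitrary: a) (auto simp: frechet_derivative_const)

lemma smooth_on_const [simp]: "smooth_on S (\<lambda>x. a)"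
  by (simp add: smooth_on_def Ck_on_const)

lemma Ck_on_bounded_linear_comp:
  assumes "open S" "bounded_linear L" "Ck_on k S f"
  shows "Ck_on k S (\<lambda>x. L (f x))"
  using assms(3)
proof (induction k arbitrary: f)
  case 0
  then show ?case using assms(2) by (simp add: bounded_linear.continuous_on)
next
  case (Suc k)
  show ?case
  proof (rule Ck_on_SucI[OF assms(1)])
    show "((\<lambda>x. L (f x)) has_derivative (\<lambda>v. L (frechet_derivative f (at x) v))) (at x)"
      if "x \<in> S" for x
      using bounded_linear.has_derivative[OF assms(2) Ck_on_SucE[OF Suc.prems that]] .
  qed (use Suc in auto)
qed

lemma smooth_on_bounded_linear_comp:
  assumes "open S" "bounded_linear L" "smooth_on S f"
  shows "smooth_on S (\<lambda>x. L (f x))"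
  using Ck_on_bounded_linear_comp[OF assms(1,2)] assms(3) by (simp add: smooth_on_def)

lemma Ck_on_add:
  assumes "open S" "Ck_on k S f" "Ck_on k S g"
  shows "Ck_on k S (\<lambda>x. f x + g x)"
  using assms(2,3)
proof (induction k arbitrary: f g)
  case 0
  then show ?case by (simp add: continuous_on_add)
next
  case (Suc k)
  show ?case
  proof (rule Ck_on_SucI[OF assms(1)])
    show "((\<lambda>x. f x + g x) has_derivative
        (\<lambda>v. frechet_derivative f (at x) v + frechet_derivative g (at x) v)) (at x)"
      if "x \<in> S" for x
      by (rule has_derivative_add[OF Ck_on_SucE[OF Suc.prems(1) that] Ck_on_SucE[OF Suc.prems(2)
          that]])
  qed (use Suc in auto)
qed

lemma smooth_on_add:
  "open S \<Longrightarrow> smooth_on S f \<Longrightarrow> smooth_on S g \<Longrightarrow> smooth_on S (\<lambda>x. f x + g x)"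
  by (simp add: smooth_on_def Ck_on_add)

lemma smooth_on_sum:
  assumes "open S" "\<And>i. i \<in> I \<Longrightarrow> smooth_on S (f i)"
  shows "smooth_on S (\<lambda>x. \<Sum>i\<in>I. f i x)"
  using assms(2)
  by (induction I rule: infinite_finite_induct) (auto intro: smooth_on_add[OF assms(1)])

lemma smooth_on_minus:
  "open S \<Longrightarrow> smooth_on S f \<Longrightarrow> smooth_on S (\<lambda>x. - f x)"
  by (rule smooth_on_bounded_linear_comp[OF _ bounded_linear_minus[OF bounded_linear_ident]])

lemma smooth_on_diff:
  "open S \<Longrightarrow> smooth_on S f \<Longrightarrow> smooth_on S g \<Longrightarrow> smooth_on S (\<lambda>x. f x - g x)"
  using smooth_on_add[of S f "\<lambda>x. - g x"] smooth_on_minus[of S g] by simp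

lemma Ck_on_bilinear:
  assumes "open S" "bounded_bilinear B" "Ck_on k S f" "Ck_on k S g"
  shows "Ck_on k S (\<lambda>x. B (f x) (g x))"
  using assms(3,4)
proof (induction k arbitrary: f g)
  case 0
  then show ?case using bounded_bilinear.continuous_on[OF assms(2)] by simp
next
  case (Suc k)
  show ?case
  proof (rule Ck_on_SucI[OF assms(1)])
    show "((\<lambda>x. B (f x) (g x)) has_derivative
        (\<lambda>v. B (f x) (frechet_derivative g (at x) v) + B (frechet_derivative f (at x) v) (g x)))
        (at x)"
      if "x \<in> S" for x
      by (rule bounded_bilinear.FDERIV[OF assms(2) Ck_on_SucE[OF Suc.prems(1) that]
            Ck_on_SucE[OF Suc.prems(2) that]])
  next
    fix v
    have "Ck_on k S f" "Ck_on k S g"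
      using Suc.prems Ck_on_SucD by blast+
    then show "Ck_on k S (\<lambda>x. B (f x) (frechet_derivative g (at x) v)
        + B (frechet_derivative f (at x) v) (g x))"
      using Suc.prems by (intro Ck_on_add[OF assms(1)] Suc.IH) auto
  qed
qed

lemma smooth_on_bilinear:
  "open S \<Longrightarrow> bounded_bilinear B \<Longrightarrow> smooth_on S f \<Longrightarrow> smooth_on S g
    \<Longrightarrow> smooth_on S (\<lambda>x. B (f x) (g x))"
  by (simp add: smooth_on_def Ck_on_bilinear)

lemma smooth_on_mult:
  fixes f g :: "_ \<Rightarrow> 'b::real_normed_algebra"
  shows "open S \<Longrightarrow> smooth_on S f \<Longrightarrow> smooth_on S g \<Longrightarrow> smooth_on S (\<lambda>x. f x * g x)"
  by (rule smooth_on_bilinear[OF _ bounded_bilinear_mult])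

lemmas smooth_on_scaleR = smooth_on_bilinear[OF _ bounded_bilinear_scaleR]

lemma smooth_on_power:
  fixes f :: "_ \<Rightarrow> 'b::real_normed_algebra_1"
  assumes "open S" "smooth_on S f"
  shows "smooth_on S (\<lambda>x. f x ^ n)"
  by (induction n) (auto intro: smooth_on_mult assms)

lemma smooth_on_id: "open S \<Longrightarrow> smooth_on S (\<lambda>x. x)"
  by (rule smooth_onI_derivative[where f' = "\<lambda>x v. v"]) (auto intro: derivative_eq_intros)

text \<open>When the derivative of \<open>f\<close> is built from \<open>f\<close> itself and smooth data, \<open>f\<close> gains one
  order of differentiability at a time.\<close>

lemma smooth_on_bootstrap:
  assumes "open S" "\<And>x. x \<in> S \<Longrightarrow> (f has_derivative f' x) (at x)"
    and "\<And>k v. Ck_on k S f \<Longrightarrow> Ck_on k S (\<lambda>x. f' x v)"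
  shows "smooth_on S f"
proof -
  have "Ck_on k S f" for k
  proof (induction k)
    case 0
    have "continuous_on S f"
      by (rule has_derivative_continuous_on[OF has_derivative_at_withinI[OF assms(2)]])
    then show ?case by simp
  next
    case (Suc k)
    then show ?case by (intro Ck_on_SucI[OF assms(1,2)] assms(3)) auto
  qed
  then show ?thesis by (simp add: smooth_on_def)
qed

text \<open>The derivative -(1/f) df (1/f) involves only 1/f and the smooth df, so the bootstrap
  applies. The sign is kept as a factor \<open>- 1\<close> to make the expression a nested
  product.\<close>

lemma smooth_on_inverse:
  fixes f :: "'a::real_normed_vector \<Rightarrow> 'b::real_normed_field"
  assumes "open S" "smooth_on S f" "\<And>x. x \<in> S \<Longrightarrow> f x \<noteq> 0"
  shows "smooth_on S (\<lambda>x. inverse (f x))"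
proof (rule smooth_on_bootstrap[OF assms(1)])
  show "((\<lambda>x. inverse (f x)) has_derivative
      (\<lambda>v. (- 1) * (inverse (f x) * (frechet_derivative f (at x) v * inverse (f x))))) (at x)"
    if "x \<in> S" for x
    using Deriv.has_derivative_inverse[OF assms(3)[OF that] smooth_on_has_derivative[OF assms(2)
        that]]
    by (simp add: mult.assoc)
next
  fix k v
  assume *: "Ck_on k S (\<lambda>x. inverse (f x))"
  have "Ck_on k S (\<lambda>x. frechet_derivative f (at x) v)"
    using smooth_on_frechet_derivative[OF assms(2)] by (simp add: smooth_on_def)
  then show "Ck_on k S (\<lambda>x. (- 1) * (inverse (f x) * (frechet_derivative f (at x) v * inverse
      (f x))))"
    using * by (intro Ck_on_bilinear[OF assms(1) bounded_bilinear_mult] Ck_on_const)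
qed

lemma smooth_on_sqrt:
  fixes f :: "'a::real_normed_vector \<Rightarrow> real"
  assumes "open S" "smooth_on S f" "\<And>x. x \<in> S \<Longrightarrow> f x > 0"
  shows "smooth_on S (\<lambda>x. sqrt (f x))"
proof (rule smooth_on_bootstrap[OF assms(1)])
  \<comment> \<open>df / (2 sqrt f) is rewritten by 1 / sqrt f = (1/f) sqrt f, so that besides sqrt
    f itself only df and 1/f occur, which are known to be smooth.\<close>
  show "((\<lambda>x. sqrt (f x)) has_derivative
      (\<lambda>v. (1 / 2) * (frechet_derivative f (at x) v * (inverse (f x) * sqrt (f x))))) (at x)"
    if "x \<in> S" for x
  proof -
    have "inverse (sqrt (f x)) = inverse (f x) * sqrt (f x)"
      using assms(3)[OF that] by (simp add: field_simps)
    then show ?thesis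
      using DERIV_compose_FDERIV[OF DERIV_real_sqrt[OF assms(3)[OF that]]
          smooth_on_has_derivative[OF assms(2) that]] by (simp add: mult_ac)
  qed
next
  fix k v
  assume *: "Ck_on k S (\<lambda>x. sqrt (f x))"
  have "Ck_on k S (\<lambda>x. frechet_derivative f (at x) v)"
    using smooth_on_frechet_derivative[OF assms(2)] by (simp add: smooth_on_def)
  moreover have "Ck_on k S (\<lambda>x. inverse (f x))"
    using smooth_on_inverse[OF assms(1,2)] assms(3)
        by (simp add: smooth_on_def order.strict_implies_not_eq[THEN not_sym])
  ultimately show "Ck_on k S (\<lambda>x. (1 / 2) * (frechet_derivative f (at x) v * (inverse (f x) * sqrt
      (f x))))"
    using * by (intro Ck_on_bilinear[OF assms(1) bounded_bilinear_mult] Ck_on_const)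
qed

lemma has_field_derivative_comp_has_derivative:
  assumes "(f has_field_derivative f') (at (g x))" "(g has_derivative g') (at x within s)"
  shows "((\<lambda>x. f (g x)) has_derivative (\<lambda>v. f' * g' v)) (at x within s)"
  using has_derivative_compose[OF assms(2) assms(1)[unfolded has_field_derivative_def]] .

lemma smooth_on_exp_ii:
  fixes g :: "'a::real_normed_vector \<Rightarrow> real"
  assumes "open S" "smooth_on S g"
  shows "smooth_on S (\<lambda>x. exp (\<i> * complex_of_real (g x)))"
proof (rule smooth_on_bootstrap[OF assms(1)])
  show "((\<lambda>x. exp (\<i> * complex_of_real (g x))) has_derivative
      (\<lambda>v. (\<i> * complex_of_real (frechet_derivative g (at x) v)) * exp (\<i> * complex_of_real
          (g x)))) (at x)"
    if "x \<in> S" for x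
  proof -
    have "((\<lambda>x. \<i> * complex_of_real (g x)) has_derivative
        (\<lambda>v. \<i> * complex_of_real (frechet_derivative g (at x) v))) (at x)"
      by (intro has_derivative_mult_right has_derivative_of_real
          smooth_on_has_derivative[OF assms(2) that])
    from has_field_derivative_comp_has_derivative[OF DERIV_exp this] show ?thesis
      by (simp add: mult_ac)
  qed
next
  fix k v
  assume *: "Ck_on k S (\<lambda>x. exp (\<i> * complex_of_real (g x)))"
  have "Ck_on k S (\<lambda>x. complex_of_real (frechet_derivative g (at x) v))"
    using smooth_on_bounded_linear_comp[OF assms(1) bounded_linear_of_real[where 'a=complex]
        smooth_on_frechet_derivative[OF assms(2)]] by (simp add: smooth_on_def)
  then show "Ck_on k S (\<lambda>x. (\<i> * complex_of_real (frechet_derivative g (at x) v)) * exp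
      (\<i> * complex_of_real (g x)))"
    using * by (intro Ck_on_bilinear[OF assms(1) bounded_bilinear_mult] Ck_on_const)
qed

section \<open>Symmetry of second derivatives\<close>

lemma has_derivative_along_line:
  assumes "(f has_derivative f') (at (a + t *\<^sub>R v))"
  shows "((\<lambda>t. f (a + t *\<^sub>R v)) has_vector_derivative f' v) (at t)"
proof -
  have "((\<lambda>t. a + t *\<^sub>R v) has_derivative (\<lambda>s. s *\<^sub>R v)) (at t)"
    by (auto intro!: derivative_eq_intros)
  from has_derivative_compose[OF this assms]
  show ?thesis
    using linear_scale[OF has_derivative_linear[OF assms]]
    by (simp add: has_vector_derivative_def)
qed

text \<open>The mean value theorem is used twice: on the increment of f along \<open>w\<close> as a
  function of the step along \<open>v\<close>, then on the derivative along \<open>v\<close> as a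
  function of the step along \<open>w\<close>. The point is that the second difference is symmetric
  in \<open>v\<close> and \<open>w\<close>.\<close>

lemma second_difference_mvt:
  fixes f :: "'a::real_normed_vector \<Rightarrow> real"
  assumes "open S" "smooth_on S f" "0 < h" "cball x (h * (norm v + norm w)) \<subseteq> S"
  obtains y where "dist x y \<le> h * (norm v + norm w)"
    "f (x + h *\<^sub>R v + h *\<^sub>R w) - f (x + h *\<^sub>R v) - f (x + h *\<^sub>R w) + f x
      = h^2 * frechet_derivative (\<lambda>y. frechet_derivative f (at y) v) (at y) w"
proof -
  define D where "D = (\<lambda>y. frechet_derivative f (at y) v)"
  define E where "E = (\<lambda>y. frechet_derivative D (at y) w)"
  have near: "dist x (x + s *\<^sub>R v + t *\<^sub>R w) \<le> h * (norm v + norm w)"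
    if "0 \<le> s" "s \<le> h" "0 \<le> t" "t \<le> h" for s t
  proof -
    have "dist x (x + s *\<^sub>R v + t *\<^sub>R w) \<le> norm (s *\<^sub>R v) + norm (t *\<^sub>R w)"
    proof -
      have "x - (x + s *\<^sub>R v + t *\<^sub>R w) = - (s *\<^sub>R v + t *\<^sub>R w)" by simp
      then show ?thesis
        using norm_triangle_ineq[of "s *\<^sub>R v" "t *\<^sub>R w"] by (metis dist_norm norm_minus_cancel)
    qed
    also have "\<dots> \<le> h * norm v + h * norm w"
      using that by (intro add_mono) (auto intro!: mult_right_mono)
    finally show ?thesis by (simp add: distrib_left)
  qed
  then have inS: "x + s *\<^sub>R v + t *\<^sub>R w \<in> S"
    if "0 \<le> s" "s \<le> h" "0 \<le> t" "t \<le> h" for s t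
    using that assms(4) by auto
  define G where "G = (\<lambda>s. f (x + h *\<^sub>R w + s *\<^sub>R v) - f (x + s *\<^sub>R v))"
  have dG: "DERIV G s :> D (x + h *\<^sub>R w + s *\<^sub>R v) - D (x + s *\<^sub>R v)" if "0 \<le> s" "s \<le> h" for s
  proof -
    have "((\<lambda>s. f (x + h *\<^sub>R w + s *\<^sub>R v)) has_vector_derivative D (x + h *\<^sub>R w + s *\<^sub>R v)) (at s)"
      unfolding D_def using inS[of s h] that assms(3)
      by (intro has_derivative_along_line smooth_on_has_derivative[OF assms(2)])
          (simp add: algebra_simps)
    moreover have "((\<lambda>s. f (x + s *\<^sub>R v)) has_vector_derivative D (x + s *\<^sub>R v)) (at s)"
      unfolding D_def using inS[of s 0] that assms(3)
      by (intro has_derivative_along_line smooth_on_has_derivative[OF assms(2)]) simp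
    ultimately show ?thesis
      unfolding G_def has_real_derivative_iff_has_vector_derivative
      by (rule has_vector_derivative_diff)
  qed
  obtain s where s: "0 < s" "s < h"
    and Gs: "G h - G 0 = (h - 0) * (D (x + h *\<^sub>R w + s *\<^sub>R v) - D (x + s *\<^sub>R v))"
    using MVT2[OF assms(3) dG] by blast
  have dD: "DERIV (\<lambda>t. D (x + s *\<^sub>R v + t *\<^sub>R w)) t :> E (x + s *\<^sub>R v + t *\<^sub>R w)" if "0 \<le> t" "t
      \<le> h" for t
    unfolding has_real_derivative_iff_has_vector_derivative E_def
    unfolding D_def
    by (rule has_derivative_along_line[OF smooth_on_has_derivative[OF
            smooth_on_frechet_derivative[OF assms(2)] inS]]) (use s that in auto)
  obtain t where t: "0 < t" "t < h"
    and Dt: "D (x + s *\<^sub>R v + h *\<^sub>R w) - D (x + s *\<^sub>R v + 0 *\<^sub>R w) = (h - 0) * E (x + s *\<^sub>R v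
        + t *\<^sub>R w)"
    using MVT2[OF assms(3) dD] by blast
  have "G h - G 0 = h^2 * E (x + s *\<^sub>R v + t *\<^sub>R w)"
    using Gs Dt by (simp add: algebra_simps power2_eq_square)
  then have "f (x + h *\<^sub>R v + h *\<^sub>R w) - f (x + h *\<^sub>R v) - f (x + h *\<^sub>R w) + f x
      = h^2 * E (x + s *\<^sub>R v + t *\<^sub>R w)"
    by (simp add: G_def algebra_simps)
  moreover have "dist x (x + s *\<^sub>R v + t *\<^sub>R w) \<le> h * (norm v + norm w)"
    by (rule near) (use s t in auto)
  ultimately show ?thesis
    unfolding E_def D_def by (intro that)
qed

text \<open>One symmetric second difference equals h^2 times either mixed derivative, each taken at
  an unknown point close to x. As h shrinks, continuity of the second derivatives identifies their
  values at x.\<close>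

lemma symmetric_second_derivative_real:
  fixes f :: "'a::real_normed_vector \<Rightarrow> real"
  assumes "open S" "smooth_on S f" "x \<in> S"
  shows "frechet_derivative (\<lambda>y. frechet_derivative f (at y) v) (at x) w
    = frechet_derivative (\<lambda>y. frechet_derivative f (at y) w) (at x) v"
proof -
  define A where "A = (\<lambda>v w y. frechet_derivative (\<lambda>y. frechet_derivative f (at y) v) (at y) w)"
  have contA: "isCont (A v w) x" for v w
  proof -
    have "smooth_on S (A v w)"
      unfolding A_def by (intro smooth_on_frechet_derivative assms(2))
    from smooth_on_imp_continuous_on[OF this] show ?thesis
      using assms by (simp add: continuous_on_eq_continuous_at)
  qed
  define m where "m = norm v + norm w"
  have m: "0 \<le> m" by (simp add: m_def)
  obtain r where r: "0 < r" "cball x r \<subseteq> S"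
    using assms open_contains_cball by blast
  have "\<exists>y z. dist x y < e \<and> dist x z < e \<and> A v w y = A w v z" if "0 < e" for e
  proof -
    \<comment> \<open>The \<open>+ 1\<close> covers \<open>v = w = 0\<close>; the 2 makes
      \<open>h * m\<close> strictly smaller than \<open>e\<close>.\<close>
    define h where "h = min e r / (2 * (m + 1))"
    have h: "0 < h" using that r m by (simp add: h_def)
    have "h * m \<le> min e r / 2"
    proof -
      have "h * m \<le> h * (m + 1)" using h by simp
      also have "h * (m + 1) = min e r / 2" using m by (simp add: h_def field_simps)
      finally show ?thesis .
    qed
    then have hm: "h * m < e" "h * m \<le> r" using that r by auto
    have sub: "cball x (h * (norm v + norm w)) \<subseteq> S" "cball x (h * (norm w + norm v)) \<subseteq> S"
      using hm(2) r by (auto simp: m_def add.commute)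
    have "\<exists>y. dist x y \<le> h * (norm v + norm w) \<and>
        f (x + h *\<^sub>R v + h *\<^sub>R w) - f (x + h *\<^sub>R v) - f (x + h *\<^sub>R w) + f x = h^2 * A v w y"
      unfolding A_def by (rule second_difference_mvt[OF assms(1,2) h sub(1)]) (intro exI conjI)
    then obtain y where y: "dist x y \<le> h * (norm v + norm w)"
        "f (x + h *\<^sub>R v + h *\<^sub>R w) - f (x + h *\<^sub>R v) - f (x + h *\<^sub>R w) + f x = h^2 * A v w y"
      by (elim exE conjE)
    have "\<exists>z. dist x z \<le> h * (norm w + norm v) \<and>
        f (x + h *\<^sub>R w + h *\<^sub>R v) - f (x + h *\<^sub>R w) - f (x + h *\<^sub>R v) + f x = h^2 * A w v z"
      unfolding A_def by (rule second_difference_mvt[OF assms(1,2) h sub(2)]) (intro exI conjI)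
    then obtain z where z: "dist x z \<le> h * (norm w + norm v)"
        "f (x + h *\<^sub>R w + h *\<^sub>R v) - f (x + h *\<^sub>R w) - f (x + h *\<^sub>R v) + f x = h^2 * A w v z"
      by (elim exE conjE)
    have "h^2 * A v w y = h^2 * A w v z"
      using y(2) z(2) by (simp add: algebra_simps)
    then have "A v w y = A w v z" using h by simp
    then show ?thesis using y(1) z(1) hm
      by (intro exI[of _ y] exI[of _ z]) (auto simp: m_def add.commute)
  qed
  note close = this
  have "\<bar>A v w x - A w v x\<bar> \<le> e" if "0 < e" for e
  proof -
    have e2: "0 < e / 2" using that by simp
    obtain d1 where d1: "0 < d1" "\<And>y. dist y x < d1 \<Longrightarrow> dist (A v w y) (A v w x) < e / 2"
      using contA[of v w, unfolded continuous_at_eps_delta, rule_format, OF e2] by blast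
    obtain d2 where d2: "0 < d2" "\<And>y. dist y x < d2 \<Longrightarrow> dist (A w v y) (A w v x) < e / 2"
      using contA[of w v, unfolded continuous_at_eps_delta, rule_format, OF e2] by blast
    obtain y z where yz: "dist x y < min d1 d2" "dist x z < min d1 d2" "A v w y = A w v z"
      using close[of "min d1 d2"] d1(1) d2(1) by auto
    then have "dist (A v w y) (A v w x) < e / 2" "dist (A w v z) (A w v x) < e / 2"
      using d1(2)[of y] d2(2)[of z] by (auto simp: dist_commute)
    then show ?thesis using yz(3) unfolding dist_real_def by linarith
  qed
  then have "A v w x = A w v x"
    using field_le_epsilon[of "\<bar>A v w x - A w v x\<bar>" 0] by auto
  then show ?thesis by (simp add: A_def)
qed

lemma frechet_derivative_bounded_linear_comp:
  assumes "bounded_linear L" "f differentiable (at x)"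
  shows "frechet_derivative (\<lambda>x. L (f x)) (at x) v = L (frechet_derivative f (at x) v)"
  using frechet_derivative_at[OF bounded_linear.has_derivative[OF assms(1)
        frechet_derivative_works[THEN iffD1, OF assms(2)]]] by (simp add: fun_eq_iff)

lemma symmetric_second_derivative:
  fixes f :: "'a::real_normed_vector \<Rightarrow> complex"
  assumes "open S" "smooth_on S f" "x \<in> S"
  shows "frechet_derivative (\<lambda>y. frechet_derivative f (at y) v) (at x) w
    = frechet_derivative (\<lambda>y. frechet_derivative f (at y) w) (at x) v"
proof -
  have *: "L (frechet_derivative (\<lambda>y. frechet_derivative f (at y) v) (at x) w)
    = frechet_derivative (\<lambda>y. frechet_derivative (\<lambda>y. L (f y)) (at y) v) (at x) w"
    if L: "bounded_linear L" for L :: "complex \<Rightarrow> real" and v w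
  proof -
    let ?D = "\<lambda>y. frechet_derivative f (at y) v"
    have d: "?D differentiable (at x)"
      using smooth_on_differentiable[OF smooth_on_frechet_derivative[OF assms(2)] assms(3)] .
    have "L (frechet_derivative ?D (at x) w) = frechet_derivative (\<lambda>y. L (?D y)) (at x) w"
      by (rule frechet_derivative_bounded_linear_comp[OF L d, symmetric])
    also have "frechet_derivative (\<lambda>y. L (?D y)) (at x)
      = frechet_derivative (\<lambda>y. frechet_derivative (\<lambda>y. L (f y)) (at y) v) (at x)"
    proof (rule frechet_derivative_transform_within_open[OF _ assms(1,3)])
      show "(\<lambda>y. L (?D y)) differentiable at x"
        using differentiable_chain_at[OF d bounded_linear_imp_differentiable[OF L]]
            by (simp add: o_def)
      show "L (?D y) = frechet_derivative (\<lambda>y. L (f y)) (at y) v" if "y \<in> S" for y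
        using frechet_derivative_bounded_linear_comp[OF L smooth_on_differentiable[OF assms(2)
            that]]
        by simp
    qed
    finally show ?thesis .
  qed
  have sL: "smooth_on S (\<lambda>y. L (f y))" if "bounded_linear L" for L :: "complex \<Rightarrow> real"
    by (rule smooth_on_bounded_linear_comp[OF assms(1) that assms(2)])
  show ?thesis
    using *[OF bounded_linear_Re] *[OF bounded_linear_Im]
      symmetric_second_derivative_real[OF assms(1) sL[OF bounded_linear_Re] assms(3)]
      symmetric_second_derivative_real[OF assms(1) sL[OF bounded_linear_Im] assms(3)]
    by (simp add: complex_eq_iff)
qed

section \<open>Fields of the form \<open>e\<^sup>i\<^sup>g \<nabla>F\<close>\<close>

definition rgrad :: "(real^3 \<Rightarrow> real) \<Rightarrow> real^3 \<Rightarrow> real^3" where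
  "rgrad g P = (\<chi> k. frechet_derivative g (at P) (axis k 1))"

lemma linear_eq_sum_axes:
  fixes L :: "real^3 \<Rightarrow> 'b::real_normed_vector"
  assumes "linear L"
  shows "L v = v $ 1 *\<^sub>R L (axis 1 1) + v $ 2 *\<^sub>R L (axis 2 1) + v $ 3 *\<^sub>R L (axis 3 1)"
proof -
  have "v = v $ 1 *\<^sub>R axis 1 1 + v $ 2 *\<^sub>R axis 2 1 + v $ 3 *\<^sub>R axis 3 (1::real)"
    by (simp add: vec_eq_iff forall_3 axis_def)
  then have "L v = L (v $ 1 *\<^sub>R axis 1 1 + v $ 2 *\<^sub>R axis 2 1 + v $ 3 *\<^sub>R axis 3 1)"
    by (rule arg_cong)
  then show ?thesis
    by (simp only: linear_add[OF assms] linear_scale[OF assms])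
qed

lemma has_derivative_rgrad:
  assumes "smooth_on V g" "P \<in> V"
  shows "(g has_derivative (\<lambda>v. rgrad g P \<bullet> v)) (at P)"
proof -
  note d = smooth_on_has_derivative[OF assms]
  have "frechet_derivative g (at P) v = rgrad g P \<bullet> v" for v
    using linear_eq_sum_axes[OF has_derivative_linear[OF d], of v]
    by (simp add: rgrad_def inner_vec_def sum_3)
  then have "frechet_derivative g (at P) = (\<lambda>v. rgrad g P \<bullet> v)" by (rule ext)
  then show ?thesis using d by simp
qed

lemma partial_deriv_eqI: "(f has_derivative f') (at P) \<Longrightarrow> partial_deriv k f P = f' (axis k 1)"
  unfolding partial_deriv_def using frechet_derivative_at[of f f' P] by simp

lemma has_derivative_partial:
  assumes "f differentiable (at P)"
  shows "(f has_derivative (\<lambda>v. v $ 1 * partial_deriv 1 f P + v $ 2 * partial_deriv 2 f P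
    + v $ 3 * partial_deriv 3 f P)) (at P)"
proof -
  have d: "(f has_derivative frechet_derivative f (at P)) (at P)"
    using assms frechet_derivative_works by blast
  have "frechet_derivative f (at P) = (\<lambda>v. v $ 1 * partial_deriv 1 f P + v $ 2 * partial_deriv 2 f P
    + v $ 3 * partial_deriv 3 f P)"
  proof
    fix v
    show "frechet_derivative f (at P) v = v $ 1 * partial_deriv 1 f P + v $ 2 * partial_deriv 2 f P
      + v $ 3 * partial_deriv 3 f P"
      using linear_eq_sum_axes[OF has_derivative_linear[OF d], of v]
      by (simp only: partial_deriv_def scaleR_conv_of_real)
  qed
  then show ?thesis using d by simp
qed

lemma smooth_on_partial_deriv: "smooth_on V f \<Longrightarrow> smooth_on V (partial_deriv k f)"
  unfolding partial_deriv_def[abs_def] by (rule smooth_on_frechet_derivative)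

lemma smooth_on_rgrad_component:
  "smooth_on V g \<Longrightarrow> smooth_on V (\<lambda>x. rgrad g x $ k)"
  unfolding rgrad_def by (simp add: smooth_on_frechet_derivative)

lemma partial_deriv_cong:
  assumes "open V" "P \<in> V" "f differentiable (at P)" "\<And>Q. Q \<in> V \<Longrightarrow> f Q = h Q"
  shows "partial_deriv k f P = partial_deriv k h P"
  unfolding partial_deriv_def
  using frechet_derivative_transform_within_open[OF assms(3,1,2,4)] by simp

lemma partial_deriv_commute:
  assumes "open V" "smooth_on V f" "P \<in> V"
  shows "partial_deriv j (partial_deriv k f) P = partial_deriv k (partial_deriv j f) P"
  using symmetric_second_derivative[OF assms] unfolding partial_deriv_def[abs_def] .

lemma rgrad_symmetric:
  assumes "open V" "smooth_on V g" "P \<in> V"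
  shows "frechet_derivative (\<lambda>Q. rgrad g Q $ k) (at P) (axis j 1)
    = frechet_derivative (\<lambda>Q. rgrad g Q $ j) (at P) (axis k 1)"
  using symmetric_second_derivative_real[OF assms] unfolding rgrad_def by simp

lemma partial_deriv_phase:
  assumes "smooth_on V g" "P \<in> V" "h differentiable (at P)"
  shows "partial_deriv j (\<lambda>Q. exp (\<i> * complex_of_real (g Q)) * h Q) P
    = exp (\<i> * complex_of_real (g P)) * (\<i> * rgrad g P $ j * h P + partial_deriv j h P)"
proof -
  have "((\<lambda>Q. \<i> * complex_of_real (g Q)) has_derivative (\<lambda>v. \<i> * complex_of_real (rgrad g P \<bullet> v)))
      (at P)"
    by (intro has_derivative_mult_right has_derivative_of_real has_derivative_rgrad[OF assms(1,2)])
  from has_derivative_mult[OF has_field_derivative_comp_has_derivative[OF DERIV_exp this]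
      assms(3)[unfolded frechet_derivative_works]]
  have "partial_deriv j (\<lambda>Q. exp (\<i> * complex_of_real (g Q)) * h Q) P =
    exp (\<i> * complex_of_real (g P)) * frechet_derivative h (at P) (axis j 1) +
    exp (\<i> * complex_of_real (g P)) * (\<i> * complex_of_real (rgrad g P \<bullet> axis j 1)) * h P"
    by (rule partial_deriv_eqI)
  then show ?thesis by (simp add: partial_deriv_def algebra_simps inner_axis)
qed

lemma curl_phase:
  assumes "open V" "smooth_on V g" "\<And>k. h k differentiable (at P)" "P \<in> V"
    and "\<And>Q k. Q \<in> V \<Longrightarrow> c Q $ k = exp (\<i> * complex_of_real (g Q)) * h k Q"
  shows "partial_deriv j (\<lambda>Q. c Q $ k) P
    = exp (\<i> * complex_of_real (g P)) * (\<i> * rgrad g P $ j * h k P + partial_deriv j (h k) P)"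
proof -
  have d: "(\<lambda>Q. exp (\<i> * complex_of_real (g Q)) * h k Q) differentiable (at P)"
    by (intro differentiable_mult assms(3)
        smooth_on_differentiable[OF smooth_on_exp_ii[OF assms(1,2)] assms(4)])
  have "partial_deriv j (\<lambda>Q. c Q $ k) P = partial_deriv j (\<lambda>Q. exp (\<i> * complex_of_real
      (g Q)) * h k Q) P"
    by (rule partial_deriv_cong[OF assms(1,4) d, symmetric]) (simp add: assms(5))
  then show ?thesis
    using partial_deriv_phase[OF assms(2,4) assms(3)] by simp
qed

text \<open>The equation \<open>z = i n \<times> z\<close>.\<close>

definition isotropic_for :: "real^3 \<Rightarrow> complex^3 \<Rightarrow> bool" where
  "isotropic_for n z \<longleftrightarrow> z $ 1 = \<i> * (n $ 2 * z $ 3 - n $ 3 * z $ 2)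
     \<and> z $ 2 = \<i> * (n $ 3 * z $ 1 - n $ 1 * z $ 3) \<and> z $ 3 = \<i> * (n $ 1 * z $ 2 - n $ 2 * z $ 1)"

lemma isotropic_forD:
  assumes "isotropic_for n z"
  shows "z $ 1 = \<i> * (n $ 2 * z $ 3 - n $ 3 * z $ 2)" "z $ 2 = \<i> * (n $ 3 * z $ 1 - n $ 1 * z $ 3)"
    "z $ 3 = \<i> * (n $ 1 * z $ 2 - n $ 2 * z $ 1)"
  using assms unfolding isotropic_for_def by blast+

lemma isotropic_for_smult:
  assumes "s \<noteq> 0"
  shows "isotropic_for n (s *s z) \<longleftrightarrow> isotropic_for n z"
proof -
  have "\<i> * (a * (s * u) - b * (s * v)) = s * (\<i> * (a * u - b * v))" for a b u v
    by (simp add: algebra_simps)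
  then show ?thesis
    unfolding isotropic_for_def vector_smult_component by (simp only: mult_left_cancel[OF assms])
qed

text \<open>curl (e^(ig) grad F) = e^(ig) (i n x grad F + curl grad F), and the last curl vanishes
  because the second derivatives of F commute. What remains is i n x c.\<close>

lemma curl_eq_iff_isotropic:
  assumes V: "open V" and ph: "phase_gradient_on V c g F" and P: "P \<in> V"
  shows "curl c P = c P \<longleftrightarrow> isotropic_for (rgrad g P) (c P)"
proof -
  have g: "smooth_on V g" and F: "smooth_on V F" using ph by (auto simp: phase_gradient_on_def)
  have c: "c Q $ k = exp (\<i> * complex_of_real (g Q)) * partial_deriv k F Q" if "Q \<in> V" for Q k
    using ph that by (simp add: phase_gradient_on_def grad_def)
  have d: "partial_deriv j (\<lambda>Q. c Q $ k) P = exp (\<i> * complex_of_real (g P))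
      * (\<i> * rgrad g P $ j * partial_deriv k F P + partial_deriv j (partial_deriv k F) P)" for j k
    by (rule curl_phase[OF V g _ P])
      (use smooth_on_differentiable[OF smooth_on_partial_deriv[OF F] P] c in auto)
  note s = partial_deriv_commute[OF V F P]
  have c1: "curl c P $ 1 = \<i> * (rgrad g P $ 2 * c P $ 3 - rgrad g P $ 3 * c P $ 2)"
    unfolding curl_def vector_3 d c[OF P] s[of 2 3] by (simp add: algebra_simps)
  have c2: "curl c P $ 2 = \<i> * (rgrad g P $ 3 * c P $ 1 - rgrad g P $ 1 * c P $ 3)"
    unfolding curl_def vector_3 d c[OF P] s[of 3 1] by (simp add: algebra_simps)
  have c3: "curl c P $ 3 = \<i> * (rgrad g P $ 1 * c P $ 2 - rgrad g P $ 2 * c P $ 1)"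
    unfolding curl_def vector_3 d c[OF P] s[of 1 2] by (simp add: algebra_simps)
  show ?thesis
    unfolding vec_eq_iff forall_3 isotropic_for_def c1 c2 c3
    by (rule iffI; elim conjE; intro conjI; rule sym; assumption)
qed

locale phase_field =
  fixes V c g F
  assumes open_V: "open V" and phase: "phase_gradient_on V c g F"
    and curl_eq: "\<And>P. P \<in> V \<Longrightarrow> curl c P = c P"
begin

lemma smooth_g: "smooth_on V g" and smooth_F: "smooth_on V F"
  using phase by (auto simp: phase_gradient_on_def)

lemma c_eq: "P \<in> V \<Longrightarrow> c P $ k = exp (\<i> * complex_of_real (g P)) * partial_deriv k F P"
  using phase by (simp add: phase_gradient_on_def grad_def)

lemma isotropic_c: "P \<in> V \<Longrightarrow> isotropic_for (rgrad g P) (c P)"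
  using curl_eq_iff_isotropic[OF open_V phase] curl_eq by blast

lemma isotropic_grad: "P \<in> V \<Longrightarrow> isotropic_for (rgrad g P) (grad F P)"
  using isotropic_c[of P] phase by (simp add: phase_gradient_on_def isotropic_for_smult)

lemmas beltrami = isotropic_forD[OF isotropic_grad, unfolded grad_def vec_lambda_beta]

text \<open>Pair grad F = i n x grad F with grad F: a triple product with a repeated factor is
  zero.\<close>

lemma null:
  assumes "P \<in> V"
  shows "(partial_deriv 1 F P)^2 + (partial_deriv 2 F P)^2 + (partial_deriv 3 F P)^2 = 0"
proof -
  have "a^2 + b^2 + d^2 = 0"
    if "a = \<i> * (p * d - q * b)" "b = \<i> * (q * a - m * d)" "d = \<i> * (m * b - p * a)"
    for a b d m p q :: complex
  proof -
    have "a * a + b * b + d * d = a * (\<i> * (p * d - q * b)) + b * (\<i> * (q * a - m * d))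
        + d * (\<i> * (m * b - p * a))"
      \<comment> \<open>Each equation is applied to one product only; as a rewrite rule it would
        loop, because the unknowns recur on the right-hand sides.\<close>
      by (simp only: arg_cong[OF that(1), of "\<lambda>x. a * x"] arg_cong[OF that(2), of "\<lambda>x. b * x"]
          arg_cong[OF that(3), of "\<lambda>x. d * x"])
    then show ?thesis by (simp add: power2_eq_square algebra_simps)
  qed
  from this[OF beltrami[OF assms]] show ?thesis .
qed

text \<open>Pair the same equation with n instead of grad F.\<close>

lemma orthogonal:
  assumes "P \<in> V"
  shows "rgrad g P $ 1 * partial_deriv 1 F P + rgrad g P $ 2 * partial_deriv 2 F P
    + rgrad g P $ 3 * partial_deriv 3 F P = 0"
proof -
  have "m * a + p * b + q * d = 0"
    if "a = \<i> * (p * d - q * b)" "b = \<i> * (q * a - m * d)" "d = \<i> * (m * b - p * a)"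
    for a b d m p q :: complex
  proof -
    have "m * a + p * b + q * d = m * (\<i> * (p * d - q * b)) + p * (\<i> * (q * a - m * d))
        + q * (\<i> * (m * b - p * a))"
      by (simp only: arg_cong[OF that(1), of "\<lambda>x. m * x"] arg_cong[OF that(2), of "\<lambda>x. p * x"]
          arg_cong[OF that(3), of "\<lambda>x. q * x"])
    then show ?thesis by (simp add: algebra_simps)
  qed
  from this[OF beltrami[OF assms]] show ?thesis .
qed

text \<open>Take the divergence of grad F = i n x grad F: div (n x h) = h . curl n - n . curl h, and
  both n = grad g and h = grad F are gradients.\<close>

lemma harmonic:
  assumes "P \<in> V"
  shows "partial_deriv 1 (partial_deriv 1 F) P + partial_deriv 2 (partial_deriv 2 F) P
    + partial_deriv 3 (partial_deriv 3 F) P = 0"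
proof -
  define n where "n = (\<lambda>k Q. complex_of_real (rgrad g Q $ k))"
  define N where "N = (\<lambda>j k. complex_of_real (frechet_derivative (\<lambda>Q. rgrad g Q $ k) (at P)
      (axis j 1)))"
  let ?h = "\<lambda>k. partial_deriv k F" let ?H = "\<lambda>j k. partial_deriv j (partial_deriv k F) P"
  have dn: "(n k has_derivative (\<lambda>v. of_real (frechet_derivative (\<lambda>Q. rgrad g Q $ k) (at P) v)))
      (at P)" for k
    unfolding n_def using has_derivative_of_real[OF smooth_on_has_derivative[OF
          smooth_on_rgrad_component[OF smooth_g] assms(1)]] .
  have dh: "(?h k has_derivative frechet_derivative (?h k) (at P)) (at P)" for k
    using smooth_on_has_derivative[OF smooth_on_partial_deriv[OF smooth_F] assms] .
  have prod: "partial_deriv i (\<lambda>Q. \<i> * (n j Q * ?h k Q - n l Q * ?h m Q)) P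
    = \<i> * (n j P * ?H i k + N i j * ?h k P - (n l P * ?H i m + N i l * ?h m P))" for i j k l m
    unfolding N_def partial_deriv_def[of i "partial_deriv _ F"]
    by (rule partial_deriv_eqI has_derivative_mult_right has_derivative_diff
        has_derivative_mult dn dh)+
  have eq: "?H i l = partial_deriv i h' P" if "\<And>Q. Q \<in> V \<Longrightarrow> ?h l Q = h' Q" for i l h'
    by (rule partial_deriv_cong[OF open_V assms])
      (use that smooth_on_differentiable[OF smooth_on_partial_deriv[OF smooth_F] assms] in auto)
  have "?H 1 1 = \<i> * (n 2 P * ?H 1 3 + N 1 2 * ?h 3 P - (n 3 P * ?H 1 2 + N 1 3 * ?h 2 P))"
    "?H 2 2 = \<i> * (n 3 P * ?H 2 1 + N 2 3 * ?h 1 P - (n 1 P * ?H 2 3 + N 2 1 * ?h 3 P))"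
    "?H 3 3 = \<i> * (n 1 P * ?H 3 2 + N 3 1 * ?h 2 P - (n 2 P * ?H 3 1 + N 3 2 * ?h 1 P))"
    unfolding prod[symmetric] unfolding n_def by (rule eq, erule beltrami)+
  moreover have "?H 1 2 = ?H 2 1" "?H 1 3 = ?H 3 1" "?H 2 3 = ?H 3 2"
    by (rule partial_deriv_commute[OF open_V smooth_F assms])+
  moreover have "N 1 2 = N 2 1" "N 1 3 = N 3 1" "N 2 3 = N 3 2"
    unfolding N_def using rgrad_symmetric[OF open_V smooth_g assms] by simp_all
  ultimately show ?thesis by (simp only:) (simp add: algebra_simps)
qed

end

section \<open>Unique continuation\<close>

lemma second_derivative_nonpos_at_max:
  fixes f :: "real \<Rightarrow> real"
  assumes "0 < d" "\<And>t. \<bar>t\<bar> < d \<Longrightarrow> (f has_real_derivative f' t) (at t)"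
    and "(f' has_real_derivative l) (at 0)"
    and "\<And>t. \<bar>t\<bar> < d \<Longrightarrow> f t \<le> f 0"
  shows "l \<le> 0"
proof (rule ccontr)
  assume "\<not> l \<le> 0"
  then obtain e where e: "0 < e" "\<And>h. 0 < h \<Longrightarrow> h < e \<Longrightarrow> f' 0 < f' (0 + h)"
    using DERIV_pos_inc_right[OF assms(3)] by (auto simp: not_le)
  have "f' 0 = 0"
    using DERIV_local_max[OF assms(2)[of 0] assms(1)] assms(1,4) by simp
  define h where "h = min d e / 2"
  have h: "0 < h" "h < d" "h < e" using assms(1) e(1) by (auto simp: h_def)
  have der: "(f has_real_derivative f' t) (at t)" if "0 \<le> t" "t \<le> h" for t
    using assms(2) that h by simp
  obtain z where z: "0 < z" "z < h" "f h - f 0 = (h - 0) * f' z"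
    using MVT2[OF h(1) der] by blast
  have "0 < f' z" using e(2)[of z] z h \<open>f' 0 = 0\<close> by simp
  then have "f h > f 0" using z h by (smt (verit) mult_pos_pos)
  then show False using assms(4)[of h] h by simp
qed

lemma directional_second_derivative_nonpos_at_max:
  fixes f :: "'a::real_normed_vector \<Rightarrow> real"
  assumes "open A" "x \<in> A" "\<And>y. y \<in> A \<Longrightarrow> (f has_derivative f' y) (at y)"
    and "((\<lambda>y. f' y v) has_derivative H) (at x)"
    and "\<And>y. y \<in> A \<Longrightarrow> f y \<le> f x"
  shows "H v \<le> 0"
proof -
  obtain r where r: "0 < r" "ball x r \<subseteq> A"
    using assms(1,2) open_contains_ball by blast
  define d where "d = r / (norm v + 1)"
  have nv: "0 < norm v + 1" by (simp add: add_nonneg_pos)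
  have d: "0 < d" "\<And>t::real. \<bar>t\<bar> < d \<Longrightarrow> x + t *\<^sub>R v \<in> A"
  proof -
    show "0 < d" using r nv by (simp add: d_def)
    fix t :: real assume t: "\<bar>t\<bar> < d"
    have "\<bar>t\<bar> * norm v \<le> \<bar>t\<bar> * (norm v + 1)" by (simp add: distrib_left)
    also have "\<dots> < r" using t nv by (simp add: d_def pos_less_divide_eq)
    finally show "x + t *\<^sub>R v \<in> A" using r(2) by (auto simp: dist_norm)
  qed
  show ?thesis
  proof (rule second_derivative_nonpos_at_max[OF d(1), of "\<lambda>t. f (x + t *\<^sub>R v)" "\<lambda>t. f' (x
      + t *\<^sub>R v) v"])
    show "((\<lambda>t. f (x + t *\<^sub>R v)) has_real_derivative f' (x + t *\<^sub>R v) v) (at t)" if "\<bar>t\<bar> < d" for t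
      unfolding has_real_derivative_iff_has_vector_derivative
      by (rule has_derivative_along_line[OF assms(3)[OF d(2)[OF that]]])
    show "((\<lambda>t. f' (x + t *\<^sub>R v) v) has_real_derivative H v) (at 0)"
      unfolding has_real_derivative_iff_has_vector_derivative
      by (rule has_derivative_along_line[of "\<lambda>y. f' y v"]) (use assms(4) in simp)
    show "f (x + t *\<^sub>R v) \<le> f (x + 0 *\<^sub>R v)" if "\<bar>t\<bar> < d" for t
      using assms(5)[OF d(2)[OF that]] by simp
  qed
qed

text \<open>Where \<open>f\<close> is harmonic with \<open>(\<nabla>f)\<^sup>2 = 0\<close>, the Laplacian of \<open>ln (|f|\<^sup>2 + \<epsilon>)\<close> is
  \<open>\<epsilon> \<Sum>|\<partial>\<^sub>k f|\<^sup>2 / (|f|\<^sup>2 + \<epsilon>)\<^sup>2 \<ge> 0\<close> up to a factor 2, and that of \<open>|x - x\<^sub>0|\<^sup>-\<^sup>2\<close> is \<open>2 |x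
      - x\<^sub>0|\<^sup>-\<^sup>4 > 0\<close>.\<close>

lemma null_harmonic_no_interior_max:
  fixes f :: "real^3 \<Rightarrow> complex"
  assumes "open A" "smooth_on A f" "x \<in> A" "x0 \<notin> A" "0 < \<epsilon>" "0 < K"
    and null: "(partial_deriv 1 f x)^2 + (partial_deriv 2 f x)^2 + (partial_deriv 3 f x)^2 = 0"
    and harm: "partial_deriv 1 (partial_deriv 1 f) x + partial_deriv 2 (partial_deriv 2 f) x
      + partial_deriv 3 (partial_deriv 3 f) x = 0"
  defines "G \<equiv> \<lambda>y. ln ((Re (f y))^2 + (Im (f y))^2 + \<epsilon>) + K / ((y - x0) \<bullet> (y - x0))"
  shows "\<exists>y\<in>A. G x < G y"
proof (rule ccontr)
  assume "\<not> (\<exists>y\<in>A. G x < G y)"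
  then have max: "G y \<le> G x" if "y \<in> A" for y using that by auto
  define N where "N = (\<lambda>y. (Re (f y))^2 + (Im (f y))^2 + \<epsilon>)"
  define s where "s = (\<lambda>y. (y - x0) \<bullet> (y - x0))"
  have N: "0 < N y" for y
    using assms(5) by (simp add: N_def add_nonneg_pos)
  have s: "0 < s y" if "y \<in> A" for y
    using that assms(4) by (auto simp: s_def)
  define D where "D = (\<lambda>y. frechet_derivative f (at y))"
  have df: "(f has_derivative D y) (at y)" if "y \<in> A" for y
    unfolding D_def by (rule smooth_on_has_derivative[OF assms(2) that])
  note dRe = bounded_linear.has_derivative[OF bounded_linear_Re]
  note dIm = bounded_linear.has_derivative[OF bounded_linear_Im]
  define N' where "N' = (\<lambda>y v. 2 * (Re (f y) * Re (D y v) + Im (f y) * Im (D y v)))"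
  define s' where "s' = (\<lambda>y v. 2 * ((y - x0) \<bullet> v))"
  have dN: "(N has_derivative N' y) (at y)" if "y \<in> A" for y
  proof -
    have "(N has_derivative (\<lambda>v. of_nat 2 * Re (D y v) * Re (f y) ^ (2 - 1) + of_nat 2 * Im
        (D y v) * Im (f y) ^ (2 - 1) + 0)) (at y)"
      unfolding N_def
      by (intro has_derivative_add has_derivative_power dRe dIm df[OF that] has_derivative_const)
    moreover have "(\<lambda>v. of_nat 2 * Re (D y v) * Re (f y) ^ (2 - 1) + of_nat 2 * Im (D y v) * Im
        (f y) ^ (2 - 1) + 0) = N' y"
      by (simp add: N'_def fun_eq_iff algebra_simps)
    ultimately show ?thesis by simp
  qed
  have dx: "((\<lambda>y. y - x0) has_derivative (\<lambda>v. v)) (at y)" for y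
    using has_derivative_diff[OF has_derivative_ident has_derivative_const] by fastforce
  have ds: "(s has_derivative s' y) (at y)" for y
  proof -
    have "(s has_derivative (\<lambda>v. (y - x0) \<bullet> v + v \<bullet> (y - x0))) (at y)"
      unfolding s_def by (rule has_derivative_inner[OF dx dx])
    moreover have "(\<lambda>v. (y - x0) \<bullet> v + v \<bullet> (y - x0)) = s' y"
      by (simp add: s'_def fun_eq_iff inner_commute)
    ultimately show ?thesis by simp
  qed
  define G' where "G' = (\<lambda>y v. N' y v * inverse (N y) - K * (s' y v * (inverse (s y) * inverse
      (s y))))"
  have dG: "(G has_derivative G' y) (at y)" if "y \<in> A" for y
  proof -
    have "((\<lambda>y. ln (N y) + K * inverse (s y)) has_derivative
        (\<lambda>v. N' y v * inverse (N y) + K * - (inverse (s y) * s' y v * inverse (s y)))) (at y)"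
      using has_derivative_ln[OF N dN[OF that]] s[OF that]
      by (intro has_derivative_add has_derivative_mult_right Deriv.has_derivative_inverse ds) auto
    moreover have "(\<lambda>y. ln (N y) + K * inverse (s y)) = G"
      by (simp add: G_def N_def s_def divide_inverse)
    moreover have "(\<lambda>v. N' y v * inverse (N y) + K * - (inverse (s y) * s' y v * inverse (s y)))
        = G' y"
      by (simp add: G'_def fun_eq_iff algebra_simps)
    ultimately show ?thesis by simp
  qed
  define h where "h = (\<lambda>k. partial_deriv k f x)"
  define H where "H = (\<lambda>k. partial_deriv k (partial_deriv k f) x)"
  have N'x: "N' x (axis k 1) = 2 * (Re (f x) * Re (h k) + Im (f x) * Im (h k))" for k
    by (simp add: N'_def D_def h_def partial_deriv_def)
  have s'x: "s' x (axis k 1) = 2 * (x - x0) $ k" for k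
    by (simp add: s'_def inner_axis)
  \<comment> \<open>The pure second derivative of \<open>G\<close> along the k-th axis, nonpositive
    at a maximum. Summing over k gives the Laplacian.\<close>
  have second: "(2 * (Re (h k)^2 + Im (h k)^2 + Re (f x) * Re (H k) + Im (f x) * Im
      (H k))) * inverse (N x)
     - (N' x (axis k 1))^2 * (inverse (N x))^2
     - K * (2 * (inverse (s x))^2 - 2 * (s' x (axis k 1))^2 * (inverse (s x))^3) \<le> 0" for k
  proof -
    let ?e = "axis k 1 :: real^3"
    define E where "E = frechet_derivative (\<lambda>y. D y ?e) (at x)"
    have dD: "((\<lambda>y. D y ?e) has_derivative E) (at x)"
      unfolding E_def D_def
      by (rule smooth_on_has_derivative[OF smooth_on_frechet_derivative[OF assms(2)] assms(3)])
    have Ee: "E ?e = H k" by (simp add: E_def D_def H_def partial_deriv_def[abs_def])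
    have De: "D x ?e = h k" by (simp add: D_def h_def partial_deriv_def)
    note dfx = df[OF assms(3)]
    have dN': "((\<lambda>y. N' y ?e) has_derivative (\<lambda>v. 2 * (Re (f x) * Re (E v) + Re (D x v) * Re
        (D x ?e)
        + (Im (f x) * Im (E v) + Im (D x v) * Im (D x ?e))))) (at x)"
      unfolding N'_def
      by (intro has_derivative_mult_right has_derivative_add has_derivative_mult dRe dIm dD dfx)
    have ds': "((\<lambda>y. s' y ?e) has_derivative (\<lambda>v. 2 * (v \<bullet> ?e))) (at x)"
      unfolding s'_def by (intro has_derivative_mult_right has_derivative_inner_left dx)
    have inv: "((\<lambda>y. inverse (N y)) has_derivative (\<lambda>v. - (inverse (N x) * N' x v * inverse
        (N x)))) (at x)"
      "((\<lambda>y. inverse (s y)) has_derivative (\<lambda>v. - (inverse (s x) * s' x v * inverse (s x)))) (at x)"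
      using N[of x] s[OF assms(3)] by (auto intro!: Deriv.has_derivative_inverse dN[OF assms(3)] ds)
    have "((\<lambda>y. G' y ?e) has_derivative (\<lambda>v.
       (N' x ?e * - (inverse (N x) * N' x v * inverse (N x)) + (2 * (Re (f x) * Re (E v) + Re
           (D x v) * Re (D x ?e)
        + (Im (f x) * Im (E v) + Im (D x v) * Im (D x ?e)))) * inverse (N x))
       - K * (s' x ?e * (inverse (s x) * - (inverse (s x) * s' x v * inverse (s x)) + - (inverse
           (s x) * s' x v * inverse (s x)) * inverse (s x))
         + (2 * (v \<bullet> ?e)) * (inverse (s x) * inverse (s x))))) (at x)"
      unfolding G'_def
      by (intro has_derivative_mult_right has_derivative_diff has_derivative_mult dN' ds' inv)
    from directional_second_derivative_nonpos_at_max[OF assms(1,3) dG this max]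
    show ?thesis
      unfolding Ee De by (simp add: inner_axis_axis power2_eq_square power3_eq_cube algebra_simps)
  qed
  define u w where "u = Re (f x)" and "w = Im (f x)"
  define iN iS where "iN = inverse (N x)" and "iS = inverse (s x)"
  define B where "B = (\<Sum>k\<in>UNIV. (Re (h k))^2)"
  \<comment> \<open>Real and imaginary part of the null condition: Re h and Im h have equal length
    and are orthogonal. This makes |grad N|^2 exactly 4 |f|^2 B, so that only a multiple of
    \<epsilon> survives in the Laplacian of ln N.\<close>
  have "Re ((h 1)^2 + (h 2)^2 + (h 3)^2) = 0" "Im ((h 1)^2 + (h 2)^2 + (h 3)^2) = 0"
    using null by (simp_all add: h_def)
  then have B2: "(\<Sum>k\<in>UNIV. (Im (h k))^2) = B" and B3: "(\<Sum>k\<in>UNIV. Re (h k) * Im (h k)) = 0"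
    by (simp_all add: B_def sum_3 power2_eq_square algebra_simps)
  have HR: "(\<Sum>k\<in>UNIV. Re (H k)) = 0" and HI: "(\<Sum>k\<in>UNIV. Im (H k)) = 0"
    using arg_cong[OF harm, of Re] arg_cong[OF harm, of Im] by (simp_all add: H_def sum_3)
  have S1: "(\<Sum>k\<in>UNIV. Re (h k)^2 + Im (h k)^2 + u * Re (H k) + w * Im (H k)) = 2 * B"
    using B2 HR HI by (simp add: sum.distrib B_def flip: sum_distrib_left)
  have S2: "(\<Sum>k\<in>UNIV. (N' x (axis k 1))^2) = 4 * (u^2 + w^2) * B"
  proof -
    have "(N' x (axis k 1))^2 = 4 * (u^2 * (Re (h k))^2 + w^2 * (Im (h k))^2 + 2 * (u * w) * (Re
        (h k) * Im (h k)))" for k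
      unfolding N'x u_def w_def by (simp add: power2_eq_square algebra_simps)
    then have "(\<Sum>k\<in>UNIV. (N' x (axis k 1))^2) = 4 * (u^2 * B + w^2 * B + 2 * (u * w) * 0)"
      using B2 B3 by (simp add: sum.distrib B_def flip: sum_distrib_left)
    then show ?thesis by (simp add: algebra_simps)
  qed
  have S3: "(\<Sum>k\<in>UNIV. (s' x (axis k 1))^2) = 4 * s x"
    unfolding s'x s_def by (simp add: inner_vec_def sum_3 power2_eq_square algebra_simps)
  have "0 \<ge> (\<Sum>k\<in>UNIV. (2 * (Re (h k)^2 + Im (h k)^2 + u * Re (H k) + w * Im (H k))) * iN
     - (N' x (axis k 1))^2 * iN^2 - K * (2 * iS^2 - 2 * (s' x (axis k 1))^2 * iS^3))"
    using second unfolding u_def w_def iN_def iS_def by (intro sum_nonpos) auto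
  also have "(\<Sum>k\<in>UNIV. (2 * (Re (h k)^2 + Im (h k)^2 + u * Re (H k) + w * Im (H k))) * iN
     - (N' x (axis k 1))^2 * iN^2 - K * (2 * iS^2 - 2 * (s' x (axis k 1))^2 * iS^3))
    = 2 * (2 * B) * iN - (4 * (u^2 + w^2) * B) * iN^2 - K * (6 * iS^2 - 2 * (4 * s x) * iS^3)"
    unfolding S1[symmetric] S2[symmetric] S3[symmetric]
    by (simp add: sum_3 algebra_simps)
  \<comment> \<open>The term with \<open>K\<close> keeps the sum strictly positive even where the
    gradient of f vanishes.\<close>
  also have "\<dots> = 4 * B * iN^2 * \<epsilon> + K * (2 * iS^2)"
  proof -
    have "iN = iN^2 * N x" "iS^2 = s x * iS^3"
      using N[of x] s[OF assms(3)] by (simp_all add: iN_def iS_def power2_eq_square power3_eq_cube)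
    moreover have "N x = u^2 + w^2 + \<epsilon>" by (simp add: N_def u_def w_def)
    ultimately have "2 * (2 * B) * iN = 4 * B * (iN^2 * (u^2 + w^2 + \<epsilon>))" "K * (2 *
        (4 * s x) * iS^3) = K * (8 * iS^2)"
      by simp_all
    then show ?thesis by (simp add: algebra_simps)
  qed
  finally have "4 * B * iN^2 * \<epsilon> + K * (2 * iS^2) \<le> 0" .
  moreover have "0 \<le> B" by (simp add: B_def sum_nonneg)
  moreover have "0 < iS" using s[OF assms(3)] by (simp add: iS_def)
  moreover have "0 \<le> 4 * B * iN^2 * \<epsilon>" using \<open>0 \<le> B\<close> assms(5) by simp
  moreover have "0 < K * (2 * iS^2)" using \<open>0 < iS\<close> assms(6) by simp
  ultimately show False by linarith
qed

text \<open>The three spheres have radii \<open>\<rho>\<close>, \<open>d\<close> and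
  \<open>R\<close>, the middle one passing through a supposed point x with f x \<noteq> 0. The
  function \<open>G\<close> is larger at x than on both boundary spheres of the shell, so it has an
  interior maximum, which is impossible. \<open>K\<close> is chosen first, for the outer sphere, and
  then \<epsilon>, depending on \<open>K\<close>, for the inner one.\<close>

lemma null_harmonic_vanishes_on_ball:
  fixes f :: "real^3 \<Rightarrow> complex"
  assumes "open V" "smooth_on V f" "cball x0 R \<subseteq> V" "0 < \<rho>"
    and null: "\<And>x. x \<in> V \<Longrightarrow> (partial_deriv 1 f x)^2 + (partial_deriv 2 f x)^2 +
        (partial_deriv 3 f x)^2 = 0"
    and harm: "\<And>x. x \<in> V \<Longrightarrow> partial_deriv 1 (partial_deriv 1 f) x + partial_deriv 2
        (partial_deriv 2 f) x
      + partial_deriv 3 (partial_deriv 3 f) x = 0"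
    and zero: "\<And>x. x \<in> cball x0 \<rho> \<Longrightarrow> f x = 0"
    and x: "x \<in> ball x0 R"
  shows "f x = 0"
proof (rule ccontr)
  assume fx: "f x \<noteq> 0"
  define d where "d = norm (x - x0)"
  have d: "\<rho> < d" "d < R"
    using fx zero[of x] x not_le by (auto simp: d_def dist_norm norm_minus_commute)
  define q where "q = (\<lambda>y. (Re (f y))^2 + (Im (f y))^2)"
  have contf: "continuous_on (cball x0 R) f"
    using smooth_on_imp_continuous_on[OF assms(2)] assms(3) continuous_on_subset by blast
  have contq: "continuous_on (cball x0 R) q"
    unfolding q_def by (intro continuous_intros contf)
  have q0: "0 \<le> q y" for y by (simp add: q_def)
  have qx: "0 < q x" using fx by (auto simp: q_def complex_eq_iff sum_power2_gt_zero_iff)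
  have xR: "x \<in> cball x0 R" using x by simp
  then have "cball x0 R \<noteq> {}" by blast
  from continuous_attains_sup[OF compact_cball this contq]
  obtain y0 where M0: "\<And>y. y \<in> cball x0 R \<Longrightarrow> q y \<le> q y0" by blast
  \<comment> \<open>The 1 makes room for \<epsilon> \<le> 1, so that ln (|f|^2 + \<epsilon>) \<le>
    ln M on the whole ball.\<close>
  define M where "M = q y0 + 1"
  have M: "0 < M" using M0[OF xR] q0[of x] by (simp add: M_def)
  \<comment> \<open>The gain of the weight 1 / |y - x0|^2 at x over the outer sphere;
    \<open>K * a\<close> has to outweigh ln M - ln |f x|^2.\<close>
  define a where "a = 1 / d^2 - 1 / R^2"
  have "d^2 < R^2" using d assms(4) by (intro power_strict_mono) auto
  then have a: "0 < a"
    using d assms(4) by (simp add: a_def frac_less2)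
  define K where "K = (\<bar>ln M - ln (q x)\<bar> + 1) / a"
  have K: "0 < K" "ln M - ln (q x) < K * a"
    using a by (auto simp: K_def)
  \<comment> \<open>On the inner sphere f = 0, so \<open>G\<close> is ln \<epsilon> + K / \<rho>^2
    there; this \<epsilon> pushes that value below ln |f x|^2.\<close>
  define \<epsilon> where "\<epsilon> = min 1 (exp (ln (q x) - K / \<rho>^2 - 1))"
  have \<epsilon>: "0 < \<epsilon>" "\<epsilon> \<le> 1" by (auto simp: \<epsilon>_def)
  have "ln \<epsilon> \<le> ln (exp (ln (q x) - K / \<rho>^2 - 1))"
    using \<epsilon>(1) by (intro ln_mono) (auto simp: \<epsilon>_def)
  then have ln\<epsilon>: "ln \<epsilon> + K / \<rho>^2 < ln (q x)" by simp
  define G where "G = (\<lambda>y. ln ((Re (f y))^2 + (Im (f y))^2 + \<epsilon>) + K / ((y - x0) \<bullet> (y - x0)))"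
  define C where "C = cball x0 R - ball x0 \<rho>"
  have Cne: "y \<noteq> x0" if "y \<in> C" for y using that assms(4) by (auto simp: C_def)
  have "compact C" by (simp add: C_def compact_diff)
  moreover have "x \<in> C" using x d by (auto simp: C_def d_def dist_norm norm_minus_commute)
  moreover have "continuous_on C G"
  proof -
    have "continuous_on C f" using contf by (rule continuous_on_subset) (auto simp: C_def)
    then show ?thesis
      unfolding G_def using Cne \<epsilon>(1) q0
      by (intro continuous_intros) (auto simp: q_def add_nonneg_eq_0_iff)
  qed
  ultimately obtain y where y: "y \<in> C" "\<And>z. z \<in> C \<Longrightarrow> G z \<le> G y"
    using continuous_attains_sup[of C G] by blast
  have Geq: "G z = ln (q z + \<epsilon>) + K / (norm (z - x0))^2" for z
    by (simp add: G_def q_def power2_norm_eq_inner)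
  have "ln (q x) + K / d^2 \<le> G x"
    unfolding Geq d_def[symmetric] using \<epsilon>(1) qx by simp
  then have Gy: "ln (q x) + K / d^2 \<le> G y"
    using y(2)[OF \<open>x \<in> C\<close>] by simp
  have "norm (y - x0) \<noteq> R"
  proof
    assume r: "norm (y - x0) = R"
    have "q y + \<epsilon> \<le> M" using M0[of y] y(1) \<epsilon>(2) by (simp add: M_def C_def)
    then have "ln (q y + \<epsilon>) \<le> ln M"
      using q0[of y] \<epsilon>(1) by (intro ln_mono) auto
    then have "G y \<le> ln M + K / R^2" unfolding Geq r by simp
    then show False using Gy K(2) by (simp add: a_def algebra_simps)
  qed
  moreover have "norm (y - x0) \<noteq> \<rho>"
  proof
    assume r: "norm (y - x0) = \<rho>"
    then have "q y = 0"
      using zero[of y] by (simp add: q_def dist_norm norm_minus_commute)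
    then have "G y = ln \<epsilon> + K / \<rho>^2" unfolding Geq r by simp
    moreover have "0 \<le> K / d^2" using K by simp
    ultimately show False using Gy ln\<epsilon> by simp
  qed
  moreover have "\<rho> \<le> norm (y - x0)" "norm (y - x0) \<le> R"
    using y(1) by (auto simp: C_def dist_norm norm_minus_commute)
  ultimately have yA: "\<rho> < norm (y - x0)" "norm (y - x0) < R" by auto
  define A where "A = ball x0 R - cball x0 \<rho>"
  have A: "open A" "y \<in> A" "A \<subseteq> C" "A \<subseteq> V" "x0 \<notin> A"
    using yA assms(3,4) by (auto simp: A_def C_def dist_norm norm_minus_commute)
  have "y \<in> V" using A by blast
  then have "\<exists>z\<in>A. G y < G z"
    unfolding G_def
    by (intro null_harmonic_no_interior_max[OF A(1) smooth_on_subset[OF assms(2) A(4)] A(2,5) \<epsilon>(1)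
        K(1)]
        null harm)
  then show False using y(2) A(3) by (meson in_mono not_le)
qed

text \<open>Near a boundary point of the zero set of \<open>c\<close>, the potential \<open>F\<close> is constant on a small ball
  inside that set, and hence, by the maximum principle, on a larger one.\<close>

lemma phase_field_unique_continuation:
  assumes "open U" "connected U" "\<And>P. P \<in> U \<Longrightarrow> curl c P = c P"
    and loc: "\<And>p. p \<in> U \<Longrightarrow> \<exists>V g F. open V \<and> p \<in> V \<and> V \<subseteq> U \<and> phase_gradient_on V c g F"
    and Z: "open Z" "Z \<noteq> {}" "Z \<subseteq> U" "\<And>P. P \<in> Z \<Longrightarrow> c P = 0"
    and "P \<in> U"
  shows "c P = 0"
proof -
  \<comment> \<open>It is shown to be relatively closed in \<open>U\<close>; being open and
    nonempty, it is then all of the connected \<open>U\<close>.\<close>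
  define I where "I = interior {P \<in> U. c P = 0}"
  have I: "open I" "I \<subseteq> U" and cI: "\<And>P. P \<in> I \<Longrightarrow> c P = 0"
    unfolding I_def using interior_subset[of "{P \<in> U. c P = 0}"] by auto
  have "Z \<subseteq> I" unfolding I_def using Z by (intro interior_maximal) auto
  have closed: "p \<in> I" if p: "p \<in> U" "p \<in> closure I" for p
  proof -
    obtain V g F where V: "open V" "p \<in> V" "V \<subseteq> U" "phase_gradient_on V c g F"
      using loc[OF p(1)] by blast
    interpret phase_field V c g F
      by unfold_locales (use V assms(3) in auto)
    obtain s0 where s0: "0 < s0" "ball p s0 \<subseteq> V" using V open_contains_ball by blast
    \<comment> \<open>With x0 closer than s to p, the ball of radius 2 s about x0 contains p and
      lies within distance 3 s of p, hence inside \<open>V\<close>.\<close>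
    define s where "s = s0 / 4"
    have s: "0 < s" using s0 by (simp add: s_def)
    obtain x0 where x0: "x0 \<in> I" "dist x0 p < s"
      using p(2) s unfolding closure_approachable by blast
    have sub: "cball x0 (2 * s) \<subseteq> V"
    proof
      fix z assume "z \<in> cball x0 (2 * s)"
      then have "dist p z < s0"
        using x0(2) s dist_triangle[of p z x0] by (simp add: s_def dist_commute)
      then show "z \<in> V" using s0 by auto
    qed
    have "x0 \<in> V" using sub s by auto
    obtain \<rho> where \<rho>: "0 < \<rho>" "cball x0 \<rho> \<subseteq> I \<inter> V"
      using I(1) V(1) x0(1) \<open>x0 \<in> V\<close> open_contains_cball[of "I \<inter> V"] by blast
    \<comment> \<open>Near x0 the potential is constant; subtracting its value turns this into the
      vanishing required by \<open>null_harmonic_vanishes_on_ball\<close>, without changing any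
      derivative.\<close>
    define f where "f = (\<lambda>x. F x - F x0)"
    have sf: "smooth_on V f"
      unfolding f_def by (intro smooth_on_diff open_V smooth_F smooth_on_const)
    have pf: "partial_deriv k f x = partial_deriv k F x" if "x \<in> V" for k x
      using partial_deriv_eqI[OF has_derivative_diff[OF smooth_on_has_derivative[OF smooth_F that]
            has_derivative_const[of "F x0"]]]
      by (simp add: f_def partial_deriv_def)
    have ppf: "partial_deriv k (partial_deriv k f) x = partial_deriv k (partial_deriv k F) x"
        if "x \<in> V" for k x
      by (rule partial_deriv_cong[OF open_V that smooth_on_differentiable[OF
          smooth_on_partial_deriv[OF sf] that]])
        (rule pf)
    have gradF: "partial_deriv k F x = 0" if "x \<in> I \<inter> V" for k x
      using c_eq[of x k] cI[of x] that by simp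
    have zero: "f x = 0" if "x \<in> cball x0 \<rho>" for x
    proof -
      have "f x = f x0"
      proof (rule has_derivative_zero_unique[of "cball x0 \<rho>" f])
        fix z assume "z \<in> cball x0 \<rho>"
        then have z: "z \<in> I \<inter> V" using \<rho> by blast
        show "(f has_derivative (\<lambda>h. 0)) (at z within cball x0 \<rho>)"
          using has_derivative_partial[OF smooth_on_differentiable[OF sf, of z]] z
          by (simp add: pf gradF has_derivative_at_withinI)
      qed (use that \<rho> in auto)
      then show ?thesis by (simp add: f_def)
    qed
    have f0: "f x = 0" if "x \<in> ball x0 (2 * s)" for x
      by (rule null_harmonic_vanishes_on_ball[OF open_V sf sub \<rho>(1) _ _ zero that])
        (simp_all add: pf ppf null harmonic)
    have "c x = 0" if x: "x \<in> ball x0 (2 * s)" for x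
    proof -
      have xV: "x \<in> V" using x sub by auto
      have "partial_deriv k F x = 0" for k
      proof -
        have "partial_deriv k f x = partial_deriv k (\<lambda>_. 0) x"
          by (rule partial_deriv_cong[OF open_ball x smooth_on_differentiable[OF sf xV] f0])
        then show ?thesis using pf[OF xV] by (simp add: partial_deriv_def frechet_derivative_const)
      qed
      then show ?thesis using c_eq[OF xV] by (simp add: vec_eq_iff)
    qed
    moreover have "ball x0 (2 * s) \<subseteq> U" using ball_subset_cball sub V(3) by blast
    ultimately have "ball x0 (2 * s) \<subseteq> I"
      unfolding I_def by (intro interior_maximal) auto
    then show "p \<in> I" using x0(2) s by auto
  qed
  have "U - closure I = U - I"
    using closed closure_subset by blast
  then have "open (U - I)" using assms(1) by (metis open_Diff closed_closure)
  then have "I \<inter> U = {} \<or> (U - I) \<inter> U = {}"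
    using connectedD[OF assms(2) I(1)] by blast
  then have "U \<subseteq> I" using \<open>Z \<subseteq> I\<close> Z(2,3) by blast
  then show ?thesis using cI assms(9) by blast
qed

section \<open>The unit normal field\<close>

definition Re_vec :: "complex^3 \<Rightarrow> real^3" where "Re_vec z = (\<chi> k. Re (z $ k))"
definition Im_vec :: "complex^3 \<Rightarrow> real^3" where "Im_vec z = (\<chi> k. Im (z $ k))"

lemma complex_vec_eq_0_iff: "z = 0 \<longleftrightarrow> Re_vec z = 0 \<and> Im_vec z = 0"
  by (auto simp: Re_vec_def Im_vec_def vec_eq_iff complex_eq_iff)

text \<open>The vector \<open>n\<close> is recovered from \<open>z = a + i b = i n \<times> z\<close> as \<open>a \<times> b / |a|\<^sup>2\<close>.\<close>

lemma beltrami_vector: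
  fixes z :: "complex^3" and n :: "real^3"
  assumes iso: "isotropic_for n z" and nz: "z \<noteq> 0"
  defines "a \<equiv> Re_vec z" and "b \<equiv> Im_vec z"
  shows "a \<bullet> n = 0" "b \<bullet> n = 0" "a \<bullet> b = 0" "n \<bullet> n = 1" "a \<bullet> a \<noteq> 0" "b \<bullet> b = a \<bullet> a"
    "cross3 a b = (a \<bullet> a) *\<^sub>R n"
proof -
  have re_im: "Im (z $ 1) = n $ 2 * Re (z $ 3) - n $ 3 * Re (z $ 2)"
    "Im (z $ 2) = n $ 3 * Re (z $ 1) - n $ 1 * Re (z $ 3)"
    "Im (z $ 3) = n $ 1 * Re (z $ 2) - n $ 2 * Re (z $ 1)"
    "Re (z $ 1) = - (n $ 2 * Im (z $ 3) - n $ 3 * Im (z $ 2))"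
    "Re (z $ 2) = - (n $ 3 * Im (z $ 1) - n $ 1 * Im (z $ 3))"
    "Re (z $ 3) = - (n $ 1 * Im (z $ 2) - n $ 2 * Im (z $ 1))"
    by (rule trans[OF arg_cong[OF isotropic_forD(1)[OF iso]]] trans[OF arg_cong[OF
        isotropic_forD(2)[OF iso]]]
        trans[OF arg_cong[OF isotropic_forD(3)[OF iso]]], simp)+
  have b: "b = cross3 n a"
    unfolding vec_eq_iff forall_3 cross3_def vector_3 a_def b_def Re_vec_def Im_vec_def
        vec_lambda_beta
    by (intro conjI re_im(1-3))
  have a: "a = - cross3 n b"
    unfolding vec_eq_iff forall_3 cross3_def vector_3 a_def b_def Re_vec_def Im_vec_def
        vec_lambda_beta
      vector_uminus_component
    by (intro conjI re_im(4-6))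
  show bn: "b \<bullet> n = 0" unfolding b by (metis dot_cross_self(1) inner_commute)
  show an: "a \<bullet> n = 0" by (subst a) (metis dot_cross_self(1) inner_commute inner_minus_left
      neg_equal_0_iff_equal)
  show "a \<bullet> b = 0" unfolding b by (simp add: dot_cross_self)
  \<comment> \<open>The rotations b = n x a and a = - n x b are composed. Because a . n = 0, the
    result reads a = |n|^2 a, and a \<noteq> 0 then gives |n| = 1.\<close>
  have "a = - cross3 n (cross3 n a)" using a b by simp
  also have "\<dots> = (n \<bullet> n) *\<^sub>R a - (n \<bullet> a) *\<^sub>R n"
    by (simp add: Lagrange)
  finally have e: "a = (n \<bullet> n) *\<^sub>R a" using an by (simp add: inner_commute)
  have "a \<noteq> 0"
    using nz b unfolding complex_vec_eq_0_iff a_def[symmetric] b_def[symmetric] by auto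
  then show "n \<bullet> n = 1" using e by (metis scaleR_cancel_right scaleR_one)
  show "a \<bullet> a \<noteq> 0" using \<open>a \<noteq> 0\<close> by simp
  have "b \<bullet> b = (n \<bullet> n) * (a \<bullet> a) - (n \<bullet> a)^2"
    unfolding b by (simp add: cross3_simps power2_eq_square)
  then show "b \<bullet> b = a \<bullet> a" using \<open>n \<bullet> n = 1\<close> an by (simp add: inner_commute)
  show "cross3 a b = (a \<bullet> a) *\<^sub>R n"
    unfolding b using an by (simp add: Lagrange)
qed

text \<open>The residual w is orthogonal to a, b and n. The triple product formula gives w x (a x b)
  = 0, so w is both parallel and orthogonal to n.\<close>

lemma orthogonal_expansion:
  fixes a b n v :: "real^3"
  assumes "a \<bullet> n = 0" "b \<bullet> n = 0" "a \<bullet> b = 0" "n \<bullet> n = 1" "a \<bullet> a \<noteq> 0" "b \<bullet> b = a \<bullet> a"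
    "cross3 a b = (a \<bullet> a) *\<^sub>R n"
  shows "v = ((v \<bullet> a) / (a \<bullet> a)) *\<^sub>R a + ((v \<bullet> b) / (a \<bullet> a)) *\<^sub>R b + (v \<bullet> n) *\<^sub>R n"
proof -
  define w where "w = v - (((v \<bullet> a) / (a \<bullet> a)) *\<^sub>R a + ((v \<bullet> b) / (a \<bullet> a)) *\<^sub>R b + (v \<bullet> n) *\<^sub>R n)"
  have "b \<bullet> a = 0" "n \<bullet> a = 0" "n \<bullet> b = 0" using assms by (simp_all add: inner_commute)
  then have w: "w \<bullet> a = 0" "w \<bullet> b = 0" "w \<bullet> n = 0"
    using assms by (simp_all add: w_def inner_diff_left inner_add_left)
  have "(a \<bullet> a) *\<^sub>R cross3 w n = cross3 w (cross3 a b)"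
    by (simp add: assms(7) cross_mult_right)
  also have "\<dots> = 0" using w by (simp add: Lagrange)
  finally have "cross3 w n = 0" using assms(5) by simp
  then have "w = 0 \<or> n = 0" using w(3) norm_and_cross_eq_0 by blast
  then have "w = 0" using assms(4) by auto
  then show ?thesis by (simp add: w_def)
qed

text \<open>A symmetric bilinear form on the plane orthogonal to \<open>n\<close> which vanishes on the isotropic
  vector \<open>a + i b\<close> is a multiple of the inner product.\<close>

lemma umbilic_operator:
  fixes L :: "real^3 \<Rightarrow> real^3"
  assumes "a \<bullet> n = 0" "b \<bullet> n = 0" "a \<bullet> b = 0" "n \<bullet> n = 1" "a \<bullet> a \<noteq> 0" "b \<bullet> b = a \<bullet> a"
    "cross3 a b = (a \<bullet> a) *\<^sub>R n"
    and "linear L" "\<And>v w. L v \<bullet> w = v \<bullet> L w" "L n = 0" "L a \<bullet> a = L b \<bullet> b" "L a \<bullet> b = 0"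
  shows "L v = ((L (axis 1 1) $ 1 + L (axis 2 1) $ 2 + L (axis 3 1) $ 3) / 2) *\<^sub>R (v -
      (v \<bullet> n) *\<^sub>R n)"
proof -
  note ex = orthogonal_expansion[OF assms(1-7)]
  define l where "l = (L a \<bullet> a) / (a \<bullet> a)"
  have Ln: "L v \<bullet> n = 0" for v using assms(9,10) by simp
  have ba: "L b \<bullet> a = 0" using assms(9)[of b a] assms(12) by (simp add: inner_commute)
  have La: "L a = l *\<^sub>R a" using ex[of "L a"] Ln assms(12) by (simp add: l_def)
  have Lb: "L b = l *\<^sub>R b" using ex[of "L b"] Ln ba assms(11) by (simp add: l_def)
  have *: "L v = l *\<^sub>R (v - (v \<bullet> n) *\<^sub>R n)" for v
  proof -
    have "L v = L (((v \<bullet> a) / (a \<bullet> a)) *\<^sub>R a + ((v \<bullet> b) / (a \<bullet> a)) *\<^sub>R b + (v \<bullet> n) *\<^sub>R n)"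
      using ex[of v] by simp
    also have "\<dots> = l *\<^sub>R (((v \<bullet> a) / (a \<bullet> a)) *\<^sub>R a + ((v \<bullet> b) / (a \<bullet> a)) *\<^sub>R b)"
      by (simp add: linear_add[OF assms(8)] linear_scale[OF assms(8)] La Lb assms(10)
          scaleR_add_right mult.commute)
    also have "((v \<bullet> a) / (a \<bullet> a)) *\<^sub>R a + ((v \<bullet> b) / (a \<bullet> a)) *\<^sub>R b = v - (v \<bullet> n) *\<^sub>R n"
      using ex[of v] by (simp add: algebra_simps)
    finally show ?thesis .
  qed
  have "(n $ 1)^2 + (n $ 2)^2 + (n $ 3)^2 = 1"
    using assms(4) by (simp add: inner_vec_def sum_3 power2_eq_square)
  then have n3: "(n $ 3)^2 = 1 - (n $ 1)^2 - (n $ 2)^2" by simp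
  \<comment> \<open>The projection orthogonal to n has trace 2, so l is half the trace of L. In this
    form the eigenvalue no longer mentions a and b, and still makes sense where c vanishes.\<close>
  have "L (axis 1 1) $ 1 + L (axis 2 1) $ 2 + L (axis 3 1) $ 3 = l * (3 - ((n $ 1)^2 + (n $ 2)^2 +
      (n $ 3)^2))"
    unfolding * by (simp add: inner_axis' power2_eq_square algebra_simps)
  also have "\<dots> = 2 * l" unfolding n3 by simp
  finally show ?thesis using *[of v] by simp
qed

lemma smooth_on_vecI:
  fixes f :: "'a::real_normed_vector \<Rightarrow> real^3"
  assumes "open S" "\<And>k. smooth_on S (\<lambda>x. f x $ k)"
  shows "smooth_on S f"
proof (rule smooth_on_cong[OF assms(1)])
  show "smooth_on S (\<lambda>x. \<Sum>k\<in>UNIV. f x $ k *\<^sub>R (axis k 1 :: real^3))"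
    by (intro smooth_on_sum smooth_on_scaleR assms smooth_on_const)
  show "(\<Sum>k\<in>UNIV. f x $ k *\<^sub>R (axis k 1 :: real^3)) = f x" for x
    by (simp add: vec_eq_iff forall_3 sum_3 axis_def)
qed

lemma smooth_on_rgrad: "open V \<Longrightarrow> smooth_on V g \<Longrightarrow> smooth_on V (rgrad g)"
  by (intro smooth_on_vecI smooth_on_rgrad_component)

lemma frechet_derivative_component:
  fixes f :: "real^3 \<Rightarrow> real^3"
  assumes "f differentiable (at P)"
  shows "frechet_derivative (\<lambda>Q. f Q $ k) (at P) v = frechet_derivative f (at P) v $ k"
  by (rule frechet_derivative_bounded_linear_comp[OF bounded_linear_vec_nth assms])

text \<open>The open set where f is nonzero would have to contain a point with c \<noteq> 0. The
  type of c is left general: besides the vector field itself, c is later the pair of coordinates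
  whose zero set is the polar axis.\<close>

lemma continuous_eq_zero_of_dense:
  assumes "open V" "continuous_on V f"
    and "\<And>W. open W \<Longrightarrow> W \<noteq> {} \<Longrightarrow> W \<subseteq> V \<Longrightarrow> \<exists>P\<in>W. c P \<noteq> (0::'c::zero)"
    and "\<And>P. P \<in> V \<Longrightarrow> c P \<noteq> 0 \<Longrightarrow> f P = (0::'b::real_normed_vector)" and "P \<in> V"
  shows "f P = 0"
proof (rule ccontr)
  assume "f P \<noteq> 0"
  have "open (V \<inter> f -` (- {0}))"
    by (rule continuous_open_preimage[OF assms(2,1)]) auto
  then obtain Q where "Q \<in> V \<inter> f -` (- {0})" "c Q \<noteq> 0"
    using assms(3)[of "V \<inter> f -` (- {0})"] assms(5) \<open>f P \<noteq> 0\<close> by auto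
  then show False using assms(4) by auto
qed

context phase_field
begin

lemma grad_eq_0_iff: "P \<in> V \<Longrightarrow> grad F P = 0 \<longleftrightarrow> c P = 0"
  using c_eq by (simp add: vec_eq_iff grad_def)

lemma smooth_c_component: "smooth_on V (\<lambda>P. c P $ k)"
  by (rule smooth_on_cong[OF open_V smooth_on_mult[OF open_V smooth_on_exp_ii[OF open_V smooth_g]
          smooth_on_partial_deriv[OF smooth_F]]]) (simp add: c_eq)

lemma open_nonzero: "open {P \<in> V. c P \<noteq> 0}"
proof -
  have "{P \<in> V. c P \<noteq> 0} = (\<Union>k. V \<inter> (\<lambda>P. c P $ k) -` (- {0}))"
    by (auto simp: vec_eq_iff)
  also have "open \<dots>"
  proof (intro open_UN ballI)
    fix k
    show "open (V \<inter> (\<lambda>P. c P $ k) -` (- {0}))"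
      by (rule continuous_open_preimage[OF smooth_on_imp_continuous_on[OF smooth_c_component]
          open_V]) auto
  qed
  finally show ?thesis .
qed

lemmas normal_facts = beltrami_vector[OF isotropic_c]

text \<open>The Hessian of g as a linear map. Where |n| = 1, its restriction to the plane orthogonal
  to n is, up to sign, the Weingarten map of the level surface.\<close>

abbreviation shape :: "real^3 \<Rightarrow> real^3 \<Rightarrow> real^3" where
  "shape P \<equiv> frechet_derivative (rgrad g) (at P)"

lemma has_derivative_normal: "P \<in> V \<Longrightarrow> (rgrad g has_derivative shape P) (at P)"
  by (rule smooth_on_has_derivative[OF smooth_on_rgrad[OF open_V smooth_g]])

lemma shape_symmetric:
  assumes "P \<in> V"
  shows "shape P v \<bullet> w = v \<bullet> shape P w"
proof -
  have L: "linear (shape P)" using has_derivative_linear[OF has_derivative_normal[OF assms]] .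
  have s: "shape P (axis j 1) $ k = shape P (axis k 1) $ j" for j k
    using rgrad_symmetric[OF open_V smooth_g assms, of k j]
      frechet_derivative_component[OF smooth_on_differentiable[OF smooth_on_rgrad[OF open_V
          smooth_g] assms]]
    by simp
  show ?thesis
    unfolding linear_eq_sum_axes[OF L, of v] linear_eq_sum_axes[OF L, of w]
    using s[of 1 2] s[of 1 3] s[of 2 3] by (simp add: inner_vec_def sum_3 algebra_simps)
qed

text \<open>With h = grad F, L the Hessian of g and H that of F, differentiating n . n = 1, h . h =
  0 and n . h = 0 gives L n = 0, h . H v = 0 and L v . h = - n . H v. Inserting v = h in the last
  relation and using the symmetry of H yields L h . h = 0, which is what
  \<open>umbilic_operator\<close> needs.\<close>

lemma shape_umbilic:
  assumes P: "P \<in> V" and nz: "c P \<noteq> 0"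
  shows "shape P v = ((shape P (axis 1 1) $ 1 + shape P (axis 2 1) $ 2 + shape P
      (axis 3 1) $ 3) / 2)
    *\<^sub>R (v - (v \<bullet> rgrad g P) *\<^sub>R rgrad g P)"
proof -
  define n where "n = rgrad g P"
  define h where "h = grad F P"
  define a b where "a = Re_vec h" and "b = Im_vec h"
  let ?L = "shape P"
  have L: "linear ?L" using has_derivative_linear[OF has_derivative_normal[OF P]] .
  have hnz: "h \<noteq> 0" unfolding h_def using grad_eq_0_iff[OF P] nz by simp
  have iso: "isotropic_for n h" unfolding n_def h_def by (rule isotropic_grad[OF P])
  have hk: "h $ k = partial_deriv k F P" for k by (simp add: h_def grad_def)
  have facts: "a \<bullet> n = 0" "b \<bullet> n = 0" "a \<bullet> b = 0" "n \<bullet> n = 1" "a \<bullet> a \<noteq> 0" "b \<bullet> b = a \<bullet> a"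
    "cross3 a b = (a \<bullet> a) *\<^sub>R n"
    unfolding a_def b_def
    by (rule beltrami_vector[OF iso hnz])+
  have dn: "(rgrad g has_derivative ?L) (at P)" by (rule has_derivative_normal[OF P])
  \<comment> \<open>Differentiating n . n = 1, valid near P because c is nonzero there, gives n . L
    v = 0 for all v; symmetry moves L onto n.\<close>
  have Ln: "?L n = 0"
  proof -
    have "((\<lambda>Q. rgrad g Q \<bullet> rgrad g Q) has_derivative (\<lambda>v. n \<bullet> ?L v + ?L v \<bullet> n)) (at P)"
      unfolding n_def by (rule has_derivative_inner[OF dn dn])
    moreover have "((\<lambda>Q. rgrad g Q \<bullet> rgrad g Q) has_derivative (\<lambda>v. 0)) (at P)"
      by (rule has_derivative_transform_within_open[OF has_derivative_const[of
          "1::real"] open_nonzero])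
        (use P nz normal_facts(4) in auto)
    ultimately have "(\<lambda>v. n \<bullet> ?L v + ?L v \<bullet> n) = (\<lambda>v. 0)"
      by (rule has_derivative_unique)
    from fun_cong[OF this] have "n \<bullet> ?L v = 0" for v
      using inner_commute[of "?L v" n] by (metis double_zero)
    then have "?L n \<bullet> v = 0" for v using shape_symmetric[OF P] by simp
    then show ?thesis by (metis inner_eq_zero_iff)
  qed
  define H where "H = (\<lambda>k v. frechet_derivative (partial_deriv k F) (at P) v)"
  have dh: "(partial_deriv k F has_derivative H k) (at P)" for k
    unfolding H_def by (rule smooth_on_has_derivative[OF smooth_on_partial_deriv[OF smooth_F] P])
  have Hsym: "H k (axis j 1) = H j (axis k 1)" for j k
    using partial_deriv_commute[OF open_V smooth_F P, of j k]
        by (simp add: H_def partial_deriv_def[abs_def])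
  have dnk: "((\<lambda>Q. complex_of_real (rgrad g Q $ k)) has_derivative (\<lambda>v. complex_of_real
      (?L v $ k))) (at P)" for k
    by (intro has_derivative_of_real bounded_linear.has_derivative[OF bounded_linear_vec_nth] dn)
  have Hh: "h $ 1 * H 1 v + h $ 2 * H 2 v + h $ 3 * H 3 v = 0" for v
  proof -
    have "((\<lambda>Q. partial_deriv 1 F Q * partial_deriv 1 F Q
        + partial_deriv 2 F Q * partial_deriv 2 F Q
        + partial_deriv 3 F Q * partial_deriv 3 F Q) has_derivative
      (\<lambda>v. h $ 1 * H 1 v + H 1 v * h $ 1 + (h $ 2 * H 2 v + H 2 v * h $ 2) + (h $ 3 * H 3 v
          + H 3 v * h $ 3))) (at P)"
      unfolding hk by (intro has_derivative_add has_derivative_mult dh)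
    moreover have "((\<lambda>Q. partial_deriv 1 F Q * partial_deriv 1 F Q
        + partial_deriv 2 F Q * partial_deriv 2 F Q
        + partial_deriv 3 F Q * partial_deriv 3 F Q) has_derivative (\<lambda>v. 0)) (at P)"
      by (rule has_derivative_transform_within_open[OF has_derivative_const[of
          "0::complex"] open_V P])
        (use null in \<open>simp add: power2_eq_square\<close>)
    ultimately have "(\<lambda>v. h $ 1 * H 1 v + H 1 v * h $ 1 + (h $ 2 * H 2 v + H 2 v * h $ 2) +
        (h $ 3 * H 3 v + H 3 v * h $ 3)) = (\<lambda>v. 0)"
      by (rule has_derivative_unique)
    from fun_cong[OF this, of v] have "2 * (h $ 1 * H 1 v + h $ 2 * H 2 v + h $ 3 * H 3 v) = 0"
      by (simp add: algebra_simps)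
    then show ?thesis by (metis mult_eq_0_iff zero_neq_numeral)
  qed
  have Nh: "?L v $ 1 * h $ 1 + ?L v $ 2 * h $ 2 + ?L v $ 3 * h $ 3 = - (n $ 1 * H 1 v
      + n $ 2 * H 2 v + n $ 3 * H 3 v)" for v
  proof -
    have "((\<lambda>Q. rgrad g Q $ 1 * partial_deriv 1 F Q + rgrad g Q $ 2 * partial_deriv 2 F Q
        + rgrad g Q $ 3 * partial_deriv 3 F Q) has_derivative
      (\<lambda>v. n $ 1 * H 1 v + ?L v $ 1 * h $ 1 + (n $ 2 * H 2 v + ?L v $ 2 * h $ 2) + (n $ 3 * H 3 v
          + ?L v $ 3 * h $ 3))) (at P)"
      unfolding hk n_def by (intro has_derivative_add has_derivative_mult dh dnk)
    moreover have "((\<lambda>Q. rgrad g Q $ 1 * partial_deriv 1 F Q + rgrad g Q $ 2 * partial_deriv 2 F Q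
        + rgrad g Q $ 3 * partial_deriv 3 F Q) has_derivative (\<lambda>v. 0)) (at P)"
      by (rule has_derivative_transform_within_open[OF has_derivative_const[of
          "0::complex"] open_V P])
        (use orthogonal in simp)
    ultimately have "(\<lambda>v. n $ 1 * H 1 v + ?L v $ 1 * h $ 1 + (n $ 2 * H 2 v + ?L v $ 2 * h $ 2) +
        (n $ 3 * H 3 v + ?L v $ 3 * h $ 3)) = (\<lambda>v. 0)"
      by (rule has_derivative_unique)
    from fun_cong[OF this, of v] show ?thesis by (simp add: algebra_simps eq_neg_iff_add_eq_0)
  qed
  define N where "N = (\<lambda>j k. complex_of_real (?L (axis j 1) $ k))"
  \<comment> \<open>This is L h . h for the complex-bilinear extension of L. By \<open>Nh\<close>
    and \<open>Hsym\<close> it is a combination of the sums that vanish by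
    \<open>Hh\<close>.\<close>
  have quad: "h $ 1 * (N 1 1 * h $ 1 + N 1 2 * h $ 2 + N 1 3 * h $ 3)
     + h $ 2 * (N 2 1 * h $ 1 + N 2 2 * h $ 2 + N 2 3 * h $ 3)
     + h $ 3 * (N 3 1 * h $ 1 + N 3 2 * h $ 2 + N 3 3 * h $ 3) = 0" (is "?Q = 0")
  proof -
    have "?Q = - (n $ 1 * (h $ 1 * H 1 (axis 1 1) + h $ 2 * H 2 (axis 1 1) + h $ 3 * H 3 (axis 1 1))
       + n $ 2 * (h $ 1 * H 1 (axis 2 1) + h $ 2 * H 2 (axis 2 1) + h $ 3 * H 3 (axis 2 1))
       + n $ 3 * (h $ 1 * H 1 (axis 3 1) + h $ 2 * H 2 (axis 3 1) + h $ 3 * H 3 (axis 3 1)))"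
      unfolding N_def Nh using Hsym[of 1 2] Hsym[of 1 3] Hsym[of 2 3] by (simp add: algebra_simps)
    also have "\<dots> = 0" unfolding Hh by simp
    finally show ?thesis .
  qed
  have hab: "h $ k = Complex (a $ k) (b $ k)" for k by (simp add: a_def b_def Re_vec_def Im_vec_def)
  have sym: "?L (axis 1 1) $ 2 = ?L (axis 2 1) $ 1" "?L (axis 1 1) $ 3 = ?L (axis 3 1) $ 1"
    "?L (axis 2 1) $ 3 = ?L (axis 3 1) $ 2"
    using shape_symmetric[OF P, of "axis 1 1" "axis 2 1"] shape_symmetric[OF P, of "axis 1 1"
        "axis 3 1"]
      shape_symmetric[OF P, of "axis 2 1" "axis 3 1"] by (simp_all add: inner_axis inner_axis')
  have ip: "?L v \<bullet> w = v $ 1 * (?L (axis 1 1) $ 1 * w $ 1 + ?L (axis 1 1) $ 2 * w $ 2 + ?L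
      (axis 1 1) $ 3 * w $ 3)
     + v $ 2 * (?L (axis 2 1) $ 1 * w $ 1 + ?L (axis 2 1) $ 2 * w $ 2 + ?L (axis 2 1) $ 3 * w $ 3)
     + v $ 3 * (?L (axis 3 1) $ 1 * w $ 1 + ?L (axis 3 1) $ 2 * w $ 2 + ?L
         (axis 3 1) $ 3 * w $ 3)" for v w
    unfolding linear_eq_sum_axes[OF L, of v] by (simp add: inner_vec_def sum_3 algebra_simps)
  \<comment> \<open>For h = a + i b, the value L h . h is (L a . a - L b . b) + 2 i (L a .
    b).\<close>
  have "?L a \<bullet> a - ?L b \<bullet> b = Re ?Q"
    unfolding ip N_def hab by (simp add: algebra_simps)
  then have q1: "?L a \<bullet> a = ?L b \<bullet> b" using quad by simp
  have "2 * (?L a \<bullet> b) = Im ?Q"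
    unfolding ip N_def hab using sym by (simp add: algebra_simps)
  then have q2: "?L a \<bullet> b = 0" using quad by simp
  show ?thesis
    using umbilic_operator[OF facts L shape_symmetric[OF P] Ln q1 q2, of v] unfolding n_def .
qed

context
  assumes dense: "\<And>W. open W \<Longrightarrow> W \<noteq> {} \<Longrightarrow> W \<subseteq> V \<Longrightarrow> \<exists>P\<in>W. c P \<noteq> 0"
begin

text \<open>The identity holds where c is nonzero, and both sides are continuous on
  \<open>V\<close>. This is how the zeros of c are bridged, here and in
  \<open>shape_eq\<close>.\<close>

lemma eikonal:
  assumes "P \<in> V"
  shows "rgrad g P \<bullet> rgrad g P = 1"
proof -
  have "rgrad g P \<bullet> rgrad g P - 1 = 0"
  proof (rule continuous_eq_zero_of_dense[OF open_V _ dense _ assms])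
    show "continuous_on V (\<lambda>P. rgrad g P \<bullet> rgrad g P - 1)"
      by (intro continuous_intros smooth_on_imp_continuous_on[OF smooth_on_rgrad[OF open_V
          smooth_g]])
  qed (use normal_facts(4) in auto)
  then show ?thesis by simp
qed

lemma shape_eq:
  assumes "P \<in> V"
  shows "shape P v = ((shape P (axis 1 1) $ 1 + shape P (axis 2 1) $ 2 + shape P
      (axis 3 1) $ 3) / 2)
    *\<^sub>R (v - (v \<bullet> rgrad g P) *\<^sub>R rgrad g P)"
proof -
  have c: "continuous_on V (\<lambda>P. shape P v)" for v
    by (rule smooth_on_imp_continuous_on[OF smooth_on_frechet_derivative[OF smooth_on_rgrad[OF
        open_V smooth_g]]])
  have "shape P v - ((shape P (axis 1 1) $ 1 + shape P (axis 2 1) $ 2 + shape P (axis 3 1) $ 3) / 2)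
    *\<^sub>R (v - (v \<bullet> rgrad g P) *\<^sub>R rgrad g P) = 0"
  proof (rule continuous_eq_zero_of_dense[OF open_V _ dense _ assms])
    show "continuous_on V (\<lambda>P. shape P v - ((shape P (axis 1 1) $ 1 + shape P (axis 2 1) $ 2
        + shape P (axis 3 1) $ 3) / 2)
        *\<^sub>R (v - (v \<bullet> rgrad g P) *\<^sub>R rgrad g P))"
      by (intro continuous_intros c smooth_on_imp_continuous_on[OF smooth_on_rgrad[OF open_V
          smooth_g]]) auto
  qed (use shape_umbilic[of _ v] in auto)
  then show ?thesis by simp
qed

end

end

section \<open>Gluing the local normals into a field on U\<close>

lemma Ck_on_local:
  assumes "open S" "\<And>x. x \<in> S \<Longrightarrow> \<exists>V. open V \<and> x \<in> V \<and> Ck_on k V f"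
  shows "Ck_on k S f"
  using assms(2)
proof (induction k arbitrary: f)
  case 0
  then show ?case
    using assms(1) by (auto simp: continuous_on_eq_continuous_at)
      (metis continuous_on_eq_continuous_at)
next
  case (Suc k)
  have "Ck_on k S (\<lambda>x. frechet_derivative f (at x) v)" for v
  proof (rule Suc.IH)
    fix x assume "x \<in> S"
    from Suc.prems[OF this] obtain V where "open V" "x \<in> V" "Ck_on (Suc k) V f" by auto
    then show "\<exists>V. open V \<and> x \<in> V \<and> Ck_on k V (\<lambda>x. frechet_derivative f (at x) v)" by auto
  qed
  moreover have "f differentiable (at x)" if "x \<in> S" for x
    using Suc.prems[OF that] by auto
  ultimately show ?case by simp
qed

lemma smooth_on_local:
  assumes "open S" "\<And>x. x \<in> S \<Longrightarrow> \<exists>V. open V \<and> x \<in> V \<and> smooth_on V f"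
  shows "smooth_on S f"
  unfolding smooth_on_def
proof (intro allI Ck_on_local[OF assms(1)])
  fix k x assume "x \<in> S"
  from assms(2)[OF this] obtain V where "open V" "x \<in> V" "smooth_on V f" by auto
  then show "\<exists>V. open V \<and> x \<in> V \<and> Ck_on k V f" by (auto simp: smooth_on_def)
qed

text \<open>The local phases need not fit together, but their gradients do: where c \<noteq> 0 the
  gradient is a function of c, and unique continuation makes this set dense. The last conclusion
  retains local potentials, now with the common normal.\<close>

lemma global_normal_field:
  assumes "open U" "connected U" "\<And>P. P \<in> U \<Longrightarrow> curl c P = c P"
    and loc: "\<And>p. p \<in> U \<Longrightarrow> \<exists>V g F. open V \<and> p \<in> V \<and> V \<subseteq> U \<and> phase_gradient_on V c g F"
    and "P0 \<in> U" "c P0 \<noteq> 0"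
  obtains n \<kappa> where "smooth_on U n" "smooth_on U \<kappa>" "\<And>P. P \<in> U \<Longrightarrow> n P \<bullet> n P = 1"
    "\<And>P. P \<in> U \<Longrightarrow> (n has_derivative (\<lambda>v. \<kappa> P *\<^sub>R (v - (v \<bullet> n P) *\<^sub>R n P))) (at P)"
    "\<And>p. p \<in> U \<Longrightarrow> \<exists>V g F. open V \<and> p \<in> V \<and> V \<subseteq> U \<and> phase_gradient_on V c g F \<and> (\<forall>P\<in>V. rgrad g P
        = n P)"
proof -
  have dense: "\<exists>P\<in>W. c P \<noteq> 0" if W: "open W" "W \<noteq> {}" "W \<subseteq> U" for W
  proof (rule ccontr)
    assume "\<not> (\<exists>P\<in>W. c P \<noteq> 0)"
    then have "c P0 = 0"
      by (intro phase_field_unique_continuation[OF assms(1-3) loc W _ assms(5)]) auto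
    then show False using assms(6) by simp
  qed
  have "\<forall>p\<in>U. \<exists>VgF. open (fst VgF) \<and> p \<in> fst VgF \<and> fst VgF \<subseteq> U \<and> phase_gradient_on (fst VgF) c
      (fst (snd VgF)) (snd (snd VgF))"
    using loc by fastforce
  then obtain T where T: "\<And>p. p \<in> U \<Longrightarrow> open (fst (T p)) \<and> p \<in> fst (T p) \<and> fst (T p) \<subseteq> U
      \<and> phase_gradient_on (fst (T p)) c (fst (snd (T p))) (snd (snd (T p)))"
    using bchoice by (metis (no_types, lifting))
  define V where "V p = fst (T p)" for p
  define g where "g p = fst (snd (T p))" for p
  define F where "F p = snd (snd (T p))" for p
  have V: "open (V p)" "p \<in> V p" "V p \<subseteq> U" "phase_gradient_on (V p) c (g p) (F p)" if "p \<in> U" for p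
    using T[OF that] by (auto simp: V_def g_def F_def)
  have pf: "phase_field (V p) c (g p) (F p)" if "p \<in> U" for p
    by unfold_locales (use V[OF that] assms(3) in auto)
  have denseV: "\<exists>P\<in>W. c P \<noteq> 0" if "open W" "W \<noteq> {}" "W \<subseteq> V p" "p \<in> U" for W p
    using dense[OF that(1,2)] that(3) V(3)[OF that(4)] by blast
  \<comment> \<open>A diagonal choice: each point uses the phase attached to itself.
    \<open>agree\<close> shows that the phase of any other point whose neighbourhood covers it has
    the same gradient there.\<close>
  define n where "n p = rgrad (g p) p" for p
  have agree: "rgrad (g p) Q = n Q" if pQ: "p \<in> U" "Q \<in> V p" for p Q
  proof -
    have Q: "Q \<in> U" using V(3) pQ by blast
    define W where "W = V p \<inter> V Q"
    have W: "open W" "Q \<in> W" "W \<subseteq> V p" "W \<subseteq> V Q"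
      using V(1,2) pQ Q by (auto simp: W_def)
    have "rgrad (g p) Q - rgrad (g Q) Q = 0"
    proof (rule continuous_eq_zero_of_dense[where c = c and f = "\<lambda>x. rgrad (g p) x - rgrad
        (g Q) x", OF W(1) _ _ _ W(2)])
      show "continuous_on W (\<lambda>x. rgrad (g p) x - rgrad (g Q) x)"
        using smooth_on_imp_continuous_on[OF smooth_on_rgrad[OF W(1) smooth_on_subset[OF
              phase_field.smooth_g[OF pf[OF pQ(1)]] W(3)]]]
          smooth_on_imp_continuous_on[OF smooth_on_rgrad[OF W(1) smooth_on_subset[OF
              phase_field.smooth_g[OF pf[OF Q]] W(4)]]]
        by (rule continuous_on_diff)
      show "\<exists>P\<in>X. c P \<noteq> 0" if "open X" "X \<noteq> {}" "X \<subseteq> W" for X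
        using denseV[OF that(1,2) _ pQ(1)] that(3) W(3) by blast
      fix P assume P: "P \<in> W" "c P \<noteq> 0"
      then have PV: "P \<in> V p" "P \<in> V Q" using W by auto
      \<comment> \<open>Both gradients satisfy Re c x Im c = |Re c|^2 n, which determines n from
        c.\<close>
      have "(Re_vec (c P) \<bullet> Re_vec (c P)) *\<^sub>R rgrad (g p) P = (Re_vec (c P) \<bullet> Re_vec
          (c P)) *\<^sub>R rgrad (g Q) P"
        by (rule trans[OF sym[OF phase_field.normal_facts(7)[OF pf[OF pQ(1)] PV(1) P(2)]]
              phase_field.normal_facts(7)[OF pf[OF Q] PV(2) P(2)]])
      moreover have "Re_vec (c P) \<bullet> Re_vec (c P) \<noteq> 0"
        by (rule phase_field.normal_facts(5)[OF pf[OF pQ(1)] PV(1) P(2)])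
      ultimately show "rgrad (g p) P - rgrad (g Q) P = 0"
        by (metis scaleR_left_imp_eq right_minus_eq)
    qed
    then show ?thesis by (simp add: n_def)
  qed
  have sV: "smooth_on (V p) n" if "p \<in> U" for p
    by (rule smooth_on_cong[OF V(1)[OF that] smooth_on_rgrad[OF V(1)[OF that]
        phase_field.smooth_g[OF pf[OF that]]]])
      (rule agree[OF that])
  have sn: "smooth_on U n"
    using smooth_on_local[OF assms(1), of n] sV V(1,2) by metis
  \<comment> \<open>Half the trace of Dn, which is smooth because n is.\<close>
  define l where "l P = (frechet_derivative n (at P) (axis 1 1) $ 1 + frechet_derivative n (at P)
      (axis 2 1) $ 2
     + frechet_derivative n (at P) (axis 3 1) $ 3) * (1 / 2)" for P
  have sl: "smooth_on U l"
    unfolding l_def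
    by (intro smooth_on_mult smooth_on_add smooth_on_const assms(1)
        smooth_on_bounded_linear_comp[OF assms(1) bounded_linear_vec_nth]
            smooth_on_frechet_derivative sn)
  show ?thesis
  proof (rule that[OF sn sl])
    fix P assume P: "P \<in> U"
    have dV: "\<And>W. open W \<Longrightarrow> W \<noteq> {} \<Longrightarrow> W \<subseteq> V P \<Longrightarrow> \<exists>Q\<in>W. c Q \<noteq> 0"
      using denseV P by blast
    show "n P \<bullet> n P = 1"
      using phase_field.eikonal[OF pf[OF P] dV V(2)[OF P]] by (simp add: n_def)
    have fr: "frechet_derivative (rgrad (g P)) (at P) = frechet_derivative n (at P)"
      by (rule frechet_derivative_transform_within_open[OF _ V(1,2)[OF P] agree[OF P]])
        (rule smooth_on_differentiable[OF smooth_on_rgrad[OF V(1)[OF P] phase_field.smooth_g[OF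
            pf[OF P]]] V(2)[OF P]])
    have "frechet_derivative n (at P) v = l P *\<^sub>R (v - (v \<bullet> n P) *\<^sub>R n P)" for v
      using phase_field.shape_eq[OF pf[OF P] dV V(2)[OF P], of v]
          unfolding fr l_def n_def[symmetric] by simp
    then have "frechet_derivative n (at P) = (\<lambda>v. l P *\<^sub>R (v - (v \<bullet> n P) *\<^sub>R n P))" by (rule ext)
    then show "(n has_derivative (\<lambda>v. l P *\<^sub>R (v - (v \<bullet> n P) *\<^sub>R n P))) (at P)"
      using smooth_on_has_derivative[OF sn P] by simp
    show "\<exists>V g F. open V \<and> P \<in> V \<and> V \<subseteq> U \<and> phase_gradient_on V c g F \<and> (\<forall>Q\<in>V. rgrad g Q = n Q)"
      by (intro exI[of _ "V P"] exI[of _ "g P"] exI[of _ "F P"]) (use V[OF P] agree[OF P] in simp)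
  qed
qed

section \<open>Umbilic unit fields are constant or central\<close>

text \<open>The derivative of f^2 e^(-2Kt) is 2 (f f' - K f^2) e^(-2Kt) \<le> 0, so this nonnegative
  function can only decrease from its initial value 0.\<close>

lemma gronwall_zero:
  fixes f :: "real \<Rightarrow> real"
  assumes "\<And>t. 0 \<le> t \<Longrightarrow> t \<le> 1 \<Longrightarrow> (f has_real_derivative f' t) (at t)"
    and "\<And>t. 0 \<le> t \<Longrightarrow> t \<le> 1 \<Longrightarrow> \<bar>f' t\<bar> \<le> K * \<bar>f t\<bar>" and "f 0 = 0"
  shows "f 1 = 0"
proof -
  define u where "u t = (f t)^2 * exp (- 2 * K * t)" for t
  have "\<exists>y. (u has_real_derivative y) (at t) \<and> y \<le> 0" if "0 \<le> t" "t \<le> 1" for t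
  proof (intro exI conjI)
    show "(u has_real_derivative (2 * f t * f' t) * exp (- 2 * K * t) + (f t)^2 * (- 2 * K * exp
        (- 2 * K * t))) (at t)"
      unfolding u_def using assms(1)[OF that] by (auto intro!: derivative_eq_intros)
    have "f t * f' t \<le> \<bar>f t\<bar> * \<bar>f' t\<bar>" by (simp flip: abs_mult)
    also have "\<dots> \<le> \<bar>f t\<bar> * (K * \<bar>f t\<bar>)" by (intro mult_left_mono assms(2)[OF that]) simp
    also have "\<dots> = K * (f t)^2" by (simp add: power2_eq_square)
    finally have "2 * (f t * f' t - K * (f t)^2) \<le> 0" by simp
    from mult_nonpos_nonneg[OF this, of "exp (- 2 * K * t)"]
    have "2 * (f t * f' t - K * (f t)^2) * exp (- 2 * K * t) \<le> 0" by simp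
    then show "(2 * f t * f' t) * exp (- 2 * K * t) + (f t)^2 * (- 2 * K * exp (- 2 * K * t)) \<le> 0"
      by (simp add: algebra_simps)
  qed
  then have "u 1 \<le> u 0"
    using DERIV_nonpos_imp_nonincreasing[of 0 1 u] by simp
  then have "(f 1)^2 * exp (- 2 * K) \<le> 0" using assms(3) by (simp add: u_def)
  then show ?thesis by (simp add: mult_le_0_iff)
qed

text \<open>From here on only the geometry of n matters, not c. Up to sign, \<kappa> is the common
  value of the two principal curvatures of the surfaces orthogonal to n.\<close>

locale umbilic_field =
  fixes U :: "(real^3) set" and n :: "real^3 \<Rightarrow> real^3" and \<kappa> :: "real^3 \<Rightarrow> real"
  assumes open_U: "open U" and connected_U: "connected U"
    and smooth_n: "smooth_on U n" and smooth_k: "smooth_on U \<kappa>"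
    and unit: "P \<in> U \<Longrightarrow> n P \<bullet> n P = 1"
    and derivative_n: "P \<in> U \<Longrightarrow> (n has_derivative (\<lambda>v. \<kappa> P *\<^sub>R (v - (v \<bullet> n P) *\<^sub>R n P))) (at P)"
begin

abbreviation tang :: "real^3 \<Rightarrow> real^3 \<Rightarrow> real^3" where
  "tang P v \<equiv> v - (v \<bullet> n P) *\<^sub>R n P"

text \<open>Differentiate the formula for Dn once more and use it again for the Dn that appears: the
  two sides are the second derivative of n in the two orders. It is tested against a fixed vector z,
  since symmetry is available for scalar functions.\<close>

lemma second_derivative_symmetric:
  assumes P: "P \<in> U"
  defines "dk \<equiv> frechet_derivative \<kappa> (at P)"
  shows "dk w *\<^sub>R tang P v - (\<kappa> P)^2 *\<^sub>R ((v \<bullet> tang P w) *\<^sub>R n P + (v \<bullet> n P) *\<^sub>R tang P w)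
    = dk v *\<^sub>R tang P w - ((\<kappa> P)^2) *\<^sub>R ((w \<bullet> tang P v) *\<^sub>R n P + (w \<bullet> n P) *\<^sub>R tang P v)"
proof -
  define T where "T v w = dk w *\<^sub>R tang P v - (\<kappa> P)^2 *\<^sub>R ((v \<bullet> tang P w) *\<^sub>R n P +
      (v \<bullet> n P) *\<^sub>R tang P w)" for v w
  have "T v w \<bullet> z = T w v \<bullet> z" for z
  proof -
    have sz: "smooth_on U (\<lambda>y. n y \<bullet> z)"
      by (rule smooth_on_bounded_linear_comp[OF open_U bounded_linear_inner_left smooth_n])
    have D1: "frechet_derivative (\<lambda>y. n y \<bullet> z) (at y) v = (\<kappa> y *\<^sub>R tang y v) \<bullet> z" if "y \<in> U" for y v
      using fun_cong[OF frechet_derivative_at[OF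
          has_derivative_inner_left[OF derivative_n[OF that], of z]], of v]
      by simp
    have D2: "frechet_derivative (\<lambda>y. frechet_derivative (\<lambda>y. n y \<bullet> z) (at y) v) (at P) w
        = T v w \<bullet> z" for v w
    proof -
      have dk: "(\<kappa> has_derivative dk) (at P)"
        unfolding dk_def by (rule smooth_on_has_derivative[OF smooth_k P])
      note dn = derivative_n[OF P]
      let ?N = "\<lambda>w. \<kappa> P *\<^sub>R tang P w"
      have "((\<lambda>y. (\<kappa> y *\<^sub>R tang y v) \<bullet> z) has_derivative
         (\<lambda>w. (\<kappa> P *\<^sub>R (0 - ((v \<bullet> n P) *\<^sub>R ?N w + (v \<bullet> ?N w) *\<^sub>R n P)) + dk w *\<^sub>R tang P v) \<bullet> z))
             (at P)"
        by (intro has_derivative_inner_left has_derivative_scaleR has_derivative_diff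
            has_derivative_const
            has_derivative_inner_right dk dn)
      then have "((\<lambda>y. frechet_derivative (\<lambda>y. n y \<bullet> z) (at y) v) has_derivative
         (\<lambda>w. (\<kappa> P *\<^sub>R (0 - ((v \<bullet> n P) *\<^sub>R ?N w + (v \<bullet> ?N w) *\<^sub>R n P)) + dk w *\<^sub>R tang P v) \<bullet> z))
             (at P)"
        by (rule has_derivative_transform_within_open[OF _ open_U P]) (simp add: D1)
      from frechet_derivative_at[OF this, symmetric]
      show ?thesis by (simp add: T_def algebra_simps power2_eq_square)
    qed
    show ?thesis
      using symmetric_second_derivative_real[OF open_U sz P, of v w] by (simp only: D2)
  qed
  then have "T v w = T w v" by (metis vector_eq_rdot)
  then show ?thesis by (simp add: T_def)
qed

text \<open>The Codazzi equation: a consequence of the symmetry of the second derivatives of \<open>n\<close>.\<close>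

lemma derivative_k:
  assumes P: "P \<in> U"
  shows "(\<kappa> has_derivative (\<lambda>v. - ((\<kappa> P)^2) * (v \<bullet> n P))) (at P)"
proof -
  define dk where "dk = frechet_derivative \<kappa> (at P)"
  have dk: "(\<kappa> has_derivative dk) (at P)"
    unfolding dk_def by (rule smooth_on_has_derivative[OF smooth_k P])
  note L = has_derivative_linear[OF dk]
  note sym = second_derivative_symmetric[OF P, folded dk_def]
  note u = unit[OF P]
  have tangent: "dk v = 0" if v: "v \<bullet> n P = 0" for v
  proof (cases "v = 0")
    case False
    \<comment> \<open>A second tangent vector orthogonal to v. Symmetry for the pair reduces to
      d\<kappa>(w) v = d\<kappa>(v) w, and pairing this with w leaves d\<kappa>(v) = 0.\<close>
    define w where "w = cross3 v (n P)"
    have w: "w \<bullet> n P = 0" "w \<bullet> v = 0"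
      by (simp_all add: w_def dot_cross_self)
    have "w \<noteq> 0"
      using False v u norm_and_cross_eq_0[of v "n P"] by (auto simp: w_def)
    have "dk w *\<^sub>R v = dk v *\<^sub>R w"
      using sym[of w v] v w by (simp add: inner_commute)
    then have "dk w * (v \<bullet> w) = dk v * (w \<bullet> w)"
      by (metis inner_scaleR_left)
    then show ?thesis using \<open>w \<noteq> 0\<close> w by (simp add: inner_commute)
  qed (simp add: linear_0[OF L])
  obtain v where v: "v \<bullet> n P = 0" "v \<noteq> 0"
  proof -
    have "2 \<le> DIM(real^3)" by simp
    then obtain v where "v \<noteq> 0" "orthogonal (n P) v"
      using orthogonal_to_vector_exists[of "n P"] by blast
    then show ?thesis using that by (auto simp: orthogonal_def inner_commute)
  qed
  \<comment> \<open>Symmetry for the pair n and tangent v; as D n(n) = 0, only the derivative of the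
    projection contributes on the other side.\<close>
  have "dk (n P) *\<^sub>R v = - ((\<kappa> P)^2) *\<^sub>R v"
    using sym[of "n P" v] v u by (simp add: inner_commute)
  then have normal: "dk (n P) = - ((\<kappa> P)^2)" using v(2) by (metis scaleR_cancel_right)
  have "dk v = - ((\<kappa> P)^2) * (v \<bullet> n P)" for v
  proof -
    have "dk v = dk (tang P v + (v \<bullet> n P) *\<^sub>R n P)" by simp
    also have "\<dots> = dk (tang P v) + (v \<bullet> n P) * dk (n P)"
      by (simp only: linear_add[OF L] linear_scale[OF L] real_scaleR_def)
    also have "dk (tang P v) = 0"
      by (rule tangent) (simp add: inner_diff_left u)
    finally show ?thesis using normal by simp
  qed
  then have "dk = (\<lambda>v. - ((\<kappa> P)^2) * (v \<bullet> n P))" by (rule ext)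
  then show ?thesis using dk by simp
qed

text \<open>Along a segment from p, f = \<kappa> solves f' = - f^2 (v . n). On a compact segment f
  is bounded by some \<open>B\<close>, so |f'| \<le> B |v| |f| and the Gronwall argument
  applies.\<close>

lemma k_zero_near:
  assumes "\<kappa> p = 0" "ball p r \<subseteq> U" "x \<in> ball p r"
  shows "\<kappa> x = 0"
proof -
  define v where "v = x - p"
  define f where "f t = \<kappa> (p + t *\<^sub>R v)" for t
  have inb: "p + t *\<^sub>R v \<in> ball p r" if "0 \<le> t" "t \<le> 1" for t
  proof -
    have "norm (t *\<^sub>R v) \<le> norm v" using that by (simp add: mult_left_le_one_le)
    then show ?thesis using assms(3) by (simp add: v_def dist_norm norm_minus_commute)
  qed
  then have inU: "p + t *\<^sub>R v \<in> U" if "0 \<le> t" "t \<le> 1" for t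
    using assms(2) that by blast
  have f: "(f has_real_derivative - ((f t)^2) * (v \<bullet> n (p + t *\<^sub>R v))) (at t)" if "0 \<le> t" "t \<le> 1"
      for t
    unfolding f_def has_real_derivative_iff_has_vector_derivative
    by (rule has_derivative_along_line[OF derivative_k[OF inU[OF that]]])
  have "continuous_on {0..1} f"
    by (intro continuous_at_imp_continuous_on ballI DERIV_isCont[OF f]) auto
  then have "bounded (f ` {0..1})"
    by (intro compact_imp_bounded compact_continuous_image) auto
  then obtain B where B: "\<And>t. 0 \<le> t \<Longrightarrow> t \<le> 1 \<Longrightarrow> \<bar>f t\<bar> \<le> B"
    unfolding bounded_iff by force
  have "f 1 = 0"
  proof (rule gronwall_zero[OF f])
    fix t :: real assume t: "0 \<le> t" "t \<le> 1"
    have "norm (n (p + t *\<^sub>R v)) = 1" using unit[OF inU[OF t]] by (simp add: norm_eq_sqrt_inner)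
    then have "\<bar>v \<bullet> n (p + t *\<^sub>R v)\<bar> \<le> norm v"
      using Cauchy_Schwarz_ineq2[of v "n (p + t *\<^sub>R v)"] by simp
    then have "\<bar>f t\<bar> * (\<bar>f t\<bar> * \<bar>v \<bullet> n (p + t *\<^sub>R v)\<bar>) \<le> \<bar>f t\<bar> * (B * norm v)"
      using B[OF t] by (intro mult_left_mono mult_mono) auto
    then show "\<bar>- ((f t)^2) * (v \<bullet> n (p + t *\<^sub>R v))\<bar> \<le> (B * norm v) * \<bar>f t\<bar>"
      by (simp add: abs_mult power2_eq_square mult_ac)
  qed (simp_all add: f_def assms(1))
  then show ?thesis by (simp add: f_def v_def)
qed

text \<open>The zero set of \<kappa> is open by \<open>k_zero_near\<close> and relatively closed, so
  connectedness leaves two cases: Dn = 0 throughout, or \<kappa> never vanishes and the centre of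
  curvature can be formed.\<close>

lemma flat_or_radial:
  obtains (flat) e where "\<And>P. P \<in> U \<Longrightarrow> n P = e"
  | (radial) q where "\<And>P. P \<in> U \<Longrightarrow> \<kappa> P \<noteq> 0" "\<And>P. P \<in> U \<Longrightarrow> n P = \<kappa> P *\<^sub>R (P - q)"
proof -
  define Z where "Z = {P \<in> U. \<kappa> P = 0}"
  have "open Z"
    unfolding open_contains_ball
  proof
    fix p assume p: "p \<in> Z"
    then obtain r where r: "0 < r" "ball p r \<subseteq> U"
      using open_U unfolding open_contains_ball Z_def by blast
    then show "\<exists>r>0. ball p r \<subseteq> Z"
      using k_zero_near[of p r] p unfolding Z_def by (intro exI[of _ r]) auto
  qed
  moreover have "open (U \<inter> \<kappa> -` (- {0}))"
    by (rule continuous_open_preimage[OF smooth_on_imp_continuous_on[OF smooth_k] open_U]) auto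
  ultimately have "Z \<inter> U = {} \<or> (U \<inter> \<kappa> -` (- {0})) \<inter> U = {}"
    by (intro connectedD[OF connected_U]) (auto simp: Z_def)
  then consider "\<forall>P\<in>U. \<kappa> P = 0" | "\<forall>P\<in>U. \<kappa> P \<noteq> 0" by (auto simp: Z_def)
  then show ?thesis
  proof cases
    case 1
    have "n P = n Q" if "P \<in> U" "Q \<in> U" for P Q
    proof (rule has_derivative_zero_unique_connected[OF open_U connected_U _ that])
      show "(n has_derivative (\<lambda>x. 0)) (at x)" if "x \<in> U" for x
        using derivative_n[OF that] 1 that by simp
    qed
    then show ?thesis using flat by metis
  next
    case 2
    \<comment> \<open>The centre of curvature. By the Codazzi equation the derivative of 1/\<kappa>
      in direction v is v . n, which cancels the normal part of v; the tangential part is cancelled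
      by Dn / \<kappa>.\<close>
    define Q where "Q P = P - inverse (\<kappa> P) *\<^sub>R n P" for P
    have "Q P = Q P'" if "P \<in> U" "P' \<in> U" for P P'
    proof (rule has_derivative_zero_unique_connected[OF open_U connected_U _ that])
      fix x assume x: "x \<in> U"
      have k: "\<kappa> x \<noteq> 0" using 2 x by blast
      have "(Q has_derivative (\<lambda>v. v - (inverse (\<kappa> x) *\<^sub>R (\<kappa> x *\<^sub>R tang x v)
          + - (inverse (\<kappa> x) * (- ((\<kappa> x)^2) * (v \<bullet> n x)) * inverse (\<kappa> x)) *\<^sub>R n x))) (at x)"
        unfolding Q_def
        by (intro has_derivative_diff has_derivative_ident has_derivative_scaleR
            Deriv.has_derivative_inverse derivative_k derivative_n x k)
      moreover have "v - (inverse (\<kappa> x) *\<^sub>R (\<kappa> x *\<^sub>R tang x v)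
          + - (inverse (\<kappa> x) * (- ((\<kappa> x)^2) * (v \<bullet> n x)) * inverse (\<kappa> x)) *\<^sub>R n x) = 0" for v
      proof -
        have "- (inverse (\<kappa> x) * (- ((\<kappa> x)^2) * (v \<bullet> n x)) * inverse (\<kappa> x)) = v \<bullet> n x"
          using k by (simp add: power2_eq_square)
        then show ?thesis using k by simp
      qed
      ultimately show "(Q has_derivative (\<lambda>x. 0)) (at x)" by simp
    qed
    then obtain q where q: "\<And>P. P \<in> U \<Longrightarrow> Q P = q" by metis
    have "n P = \<kappa> P *\<^sub>R (P - q)" if "P \<in> U" for P
      using q[OF that] 2 that by (auto simp: Q_def)
    then show ?thesis using radial 2 by metis
  qed
qed

end

section \<open>Local factorisation of the potential\<close>

text \<open>Bilinear, without conjugation: with h = grad F P it is the derivative of F in direction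
  v.\<close>

definition cdot :: "complex^3 \<Rightarrow> real^3 \<Rightarrow> complex" where
  "cdot h v = v $ 1 * h $ 1 + v $ 2 * h $ 2 + v $ 3 * h $ 3"

lemma cdot_scaleR: "cdot h (a *\<^sub>R v) = of_real a * cdot h v"
  and cdot_add: "cdot h (v + w) = cdot h v + cdot h w"
  and cdot_axis: "cdot h (axis k 1) = h $ k"
proof -
  show "cdot h (a *\<^sub>R v) = of_real a * cdot h v" by (simp add: cdot_def algebra_simps)
  show "cdot h (v + w) = cdot h v + cdot h w" by (simp add: cdot_def algebra_simps)
  have "\<forall>k. cdot h (axis k 1) = h $ k" unfolding forall_3 by (simp add: cdot_def axis_def)
  then show "cdot h (axis k 1) = h $ k" by blast
qed

lemma has_derivative_grad:
  "f differentiable (at P) \<Longrightarrow> (f has_derivative cdot (grad f P)) (at P)"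
  using has_derivative_partial[of f P] by (simp add: cdot_def[abs_def] grad_def)

lemma grad_eqI: "(f has_derivative f') (at P) \<Longrightarrow> grad f P = (\<chi> k. f' (axis k 1))"
  by (simp add: grad_def partial_deriv_eqI)

lemma right_handed_axesD:
  assumes "right_handed_axes e1 e2 e3"
  shows "e1 \<bullet> e1 = 1" "e2 \<bullet> e2 = 1" "e3 \<bullet> e3 = 1" "e1 \<bullet> e2 = 0" "e2 \<bullet> e3 = 0" "e1 \<bullet> e3 = 0"
    "e2 \<bullet> e1 = 0" "e3 \<bullet> e2 = 0" "e3 \<bullet> e1 = 0" "cross3 e1 e2 = e3"
  using assms by (auto simp: right_handed_axes_def norm_eq_1 inner_commute)

lemma frame_expansion:
  assumes "right_handed_axes e1 e2 e3"
  shows "v = (v \<bullet> e1) *\<^sub>R e1 + (v \<bullet> e2) *\<^sub>R e2 + (v \<bullet> e3) *\<^sub>R e3"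
  using orthogonal_expansion[of e1 e3 e2 v] right_handed_axesD[OF assms] by simp

lemma exists_right_handed_axes:
  fixes e3 :: "real^3"
  assumes "e3 \<bullet> e3 = 1"
  obtains e1 e2 where "right_handed_axes e1 e2 e3"
proof -
  have "2 \<le> DIM(real^3)" by simp
  then obtain v where v: "v \<noteq> 0" "orthogonal e3 v"
    using orthogonal_to_vector_exists[of e3] by blast
  define e1 where "e1 = (1 / norm v) *\<^sub>R v"
  define e2 where "e2 = cross3 e3 e1"
  have 1: "e1 \<bullet> e1 = 1" "e1 \<bullet> e3 = 0"
    using v by (simp_all add: e1_def orthogonal_def inner_commute dot_square_norm power2_eq_square)
  have 2: "e2 \<bullet> e2 = (e3 \<bullet> e3) * (e1 \<bullet> e1) - (e3 \<bullet> e1)^2"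
    unfolding e2_def by (simp add: cross3_simps power2_eq_square)
  have 3: "cross3 e1 e2 = e3"
    unfolding e2_def using 1 assms by (simp add: Lagrange inner_commute)
  have "right_handed_axes e1 e2 e3"
    unfolding right_handed_axes_def norm_eq_1 3
    using 1 2 assms dot_cross_self[of e3 e1] by (simp add: inner_commute flip: e2_def)
  then show ?thesis using that by blast
qed

text \<open>From h = i n x h, by moving the cross product to the other factor: (n x h) . v = - h .
  (n x v).\<close>

lemma cdot_isotropic:
  assumes "isotropic_for n h"
  shows "cdot h v = - \<i> * cdot h (cross3 n v)"
proof -
  note z = isotropic_forD[OF assms]
  have "cdot h v = v $ 1 * (\<i> * (n $ 2 * h $ 3 - n $ 3 * h $ 2)) + v $ 2 * (\<i> * (n $ 3 * h $ 1
      - n $ 1 * h $ 3))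
     + v $ 3 * (\<i> * (n $ 1 * h $ 2 - n $ 2 * h $ 1))"
    unfolding cdot_def
    by (simp only: arg_cong[OF z(1), of "\<lambda>x. v $ 1 * x"] arg_cong[OF z(2), of "\<lambda>x. v $ 2 * x"]
        arg_cong[OF z(3), of "\<lambda>x. v $ 3 * x"])
  then show ?thesis by (simp add: cdot_def cross3_def algebra_simps)
qed

lemma isotropic_for_orthogonal: "isotropic_for n h \<Longrightarrow> cdot h n = 0"
  using cdot_isotropic[of n h n] by (simp add: cdot_def)

text \<open>That is, \<open>h\<close> is a multiple of \<open>f1 + i f2\<close>.\<close>

lemma cdot_frame:
  assumes "isotropic_for n h" "right_handed_axes f1 f2 n"
  shows "cdot h f2 = \<i> * cdot h f1"
proof -
  have "cross3 n f2 = - f1"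
    using right_handed_axesD[OF assms(2)] Lagrange[of f2 f1 f2] cross_skew[of n f2]
    by (simp add: inner_commute)
  then have "cdot h f2 = - \<i> * cdot h ((-1) *\<^sub>R f1)" using cdot_isotropic[OF assms(1), of f2]
      by simp
  then show "cdot h f2 = \<i> * cdot h f1" unfolding cdot_scaleR by simp
qed

lemma phase_gradient_on_subset:
  "phase_gradient_on V c g F \<Longrightarrow> W \<subseteq> V \<Longrightarrow> phase_gradient_on W c g F"
  using smooth_on_subset[of V g W] smooth_on_subset[of V F W] by (auto simp: phase_gradient_on_def)

lemma rgrad_eqI:
  assumes "(g has_derivative (\<lambda>v. n \<bullet> v)) (at P)"
  shows "rgrad g P = n"
proof -
  have "frechet_derivative g (at P) = (\<lambda>v. n \<bullet> v)"
    using frechet_derivative_at[OF assms] by (rule sym)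
  then show ?thesis by (simp add: rgrad_def vec_eq_iff inner_axis)
qed

text \<open>On a connected set two phases with the same gradient differ by a real constant a, and
  e^(ia) is absorbed into the potential. This replaces an unknown g by z or r.\<close>

lemma phase_gradient_on_change_phase:
  assumes "open V" "connected V" "phase_gradient_on V c g F" "smooth_on V g'"
    and "\<And>P. P \<in> V \<Longrightarrow> rgrad g' P = rgrad g P"
  obtains F' where "phase_gradient_on V c g' F'"
proof (cases "V = {}")
  case True
  then show ?thesis using that[of F] assms(3,4) by (simp add: phase_gradient_on_def)
next
  case False
  then obtain p where p: "p \<in> V" by blast
  have g: "smooth_on V g" and F: "smooth_on V F"
    and c: "\<And>P. P \<in> V \<Longrightarrow> c P = exp (\<i> * complex_of_real (g P)) *s grad F P"
    using assms(3) by (auto simp: phase_gradient_on_def)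
  define a where "a = g p - g' p"
  have const: "g P - g' P = a" if "P \<in> V" for P
    unfolding a_def
  proof (rule has_derivative_zero_unique_connected[OF assms(1,2) _ that p])
    fix x assume x: "x \<in> V"
    show "((\<lambda>P. g P - g' P) has_derivative (\<lambda>x. 0)) (at x)"
      using has_derivative_diff[OF has_derivative_rgrad[OF g x] has_derivative_rgrad[OF assms(4) x]]
      by (simp add: assms(5)[OF x])
  qed
  define F' where "F' P = exp (\<i> * complex_of_real a) * F P" for P
  have "grad F' P = exp (\<i> * complex_of_real a) *s grad F P" if "P \<in> V" for P
    unfolding F'_def
    using grad_eqI[OF has_derivative_mult_right[OF
        has_derivative_grad[OF smooth_on_differentiable[OF F that]]]]
    by (simp add: vec_eq_iff cdot_axis)
  moreover have "exp (\<i> * complex_of_real (g P)) = exp (\<i> * complex_of_real (g' P)) * exp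
      (\<i> * complex_of_real a)"
    if "P \<in> V" for P
    using const[OF that] by (simp add: exp_add[symmetric] algebra_simps flip: const[OF that])
  moreover have "smooth_on V F'"
    unfolding F'_def[abs_def] by (rule smooth_on_mult[OF assms(1) smooth_on_const F])
  ultimately have "phase_gradient_on V c g' F'"
    unfolding phase_gradient_on_def
    using assms(4) c by (simp add: vec_eq_iff mult_ac)
  then show ?thesis by (rule that)
qed

section \<open>Restricting the potential to a surface transverse to n\<close>

context phase_field
begin

lemma has_derivative_F: "P \<in> V \<Longrightarrow> (F has_derivative cdot (grad F P)) (at P)"
  by (rule has_derivative_grad[OF smooth_on_differentiable[OF smooth_F]])

lemma grad_normal: "P \<in> V \<Longrightarrow> cdot (grad F P) (rgrad g P) = 0"
  by (rule isotropic_for_orthogonal[OF isotropic_grad])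

lemmas grad_frame = cdot_frame[OF isotropic_grad]

lemma F_constant_on_segment:
  assumes "closed_segment P Q \<subseteq> V" "\<And>R. R \<in> closed_segment P Q \<Longrightarrow> cdot (grad F R) (Q - P) = 0"
  shows "F P = F Q"
proof -
  define f where "f t = F (P + t *\<^sub>R (Q - P))" for t
  have seg: "P + t *\<^sub>R (Q - P) \<in> closed_segment P Q" if "t \<in> {0..1}" for t
    using that by (auto simp: closed_segment_def algebra_simps intro!: exI[of _ t])
  have "f 0 = f 1"
  proof (rule has_derivative_zero_unique[of "{0..1}" f])
    fix t :: real assume t: "t \<in> {0..1}"
    have "(f has_vector_derivative cdot (grad F (P + t *\<^sub>R (Q - P))) (Q - P)) (at t)"
      unfolding f_def by (rule has_derivative_along_line[OF
          has_derivative_F[OF subsetD[OF assms(1) seg[OF t]]]])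
    then show "(f has_derivative (\<lambda>h. 0)) (at t within {0..1})"
      using assms(2)[OF seg[OF t]] by (simp add: has_vector_derivative_def
          has_derivative_at_withinI)
  qed auto
  then show ?thesis by (simp add: f_def)
qed

text \<open>The last hypothesis is the Cauchy-Riemann equation for F composed with \<sigma>: the
  derivative along the imaginary direction is i times the one along the real direction.\<close>

lemma holomorphic_on_section:
  assumes "\<And>\<zeta>. \<zeta> \<in> D \<Longrightarrow> \<sigma> \<zeta> \<in> V" "open D"
    and "\<And>\<zeta>. \<zeta> \<in> D \<Longrightarrow> (\<sigma> has_derivative (\<lambda>w. Re w *\<^sub>R X \<zeta> + Im w *\<^sub>R Y \<zeta>)) (at \<zeta>)"
    and "\<And>\<zeta>. \<zeta> \<in> D \<Longrightarrow> cdot (grad F (\<sigma> \<zeta>)) (Y \<zeta>) = \<i> * cdot (grad F (\<sigma> \<zeta>)) (X \<zeta>)"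
  shows "(\<lambda>\<zeta>. F (\<sigma> \<zeta>)) holomorphic_on D"
proof -
  have "((\<lambda>\<zeta>. F (\<sigma> \<zeta>)) has_field_derivative cdot (grad F (\<sigma> \<zeta>)) (X \<zeta>)) (at \<zeta>)" if z: "\<zeta> \<in> D" for \<zeta>
  proof -
    have "cdot (grad F (\<sigma> \<zeta>)) (Re w *\<^sub>R X \<zeta> + Im w *\<^sub>R Y \<zeta>) = cdot (grad F (\<sigma> \<zeta>)) (X \<zeta>) * w" for w
      unfolding cdot_add cdot_scaleR assms(4)[OF z]
      by (subst (3) complex_eq[of w]) (simp add: algebra_simps)
    then show ?thesis
      unfolding has_field_derivative_def
      using has_derivative_compose[OF assms(3)[OF z] has_derivative_F[OF assms(1)[OF z]]] by simp
  qed
  then show ?thesis using assms(2) by (auto simp: holomorphic_on_open)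
qed

lemma factorised_form:
  assumes "open W" "W \<subseteq> V" "open D" "\<Phi> holomorphic_on D"
    and "\<And>Q. Q \<in> W \<Longrightarrow> w Q \<in> D" "\<And>Q. Q \<in> W \<Longrightarrow> F Q = \<Phi> (w Q)"
    and "P \<in> W" "(w has_derivative w') (at P)"
  shows "c P = exp (\<i> * complex_of_real (g P)) *s grad (\<lambda>Q. \<Phi> (w Q)) P"
    "c P = (exp (\<i> * complex_of_real (g P)) * deriv \<Phi> (w P)) *s (\<chi> k. w' (axis k 1))"
proof -
  have P: "P \<in> V" using assms by blast
  have "partial_deriv k F P = partial_deriv k (\<lambda>Q. \<Phi> (w Q)) P" for k
    by (rule partial_deriv_cong[OF assms(1,7) smooth_on_differentiable[OF smooth_F P] assms(6)])
  then show 1: "c P = exp (\<i> * complex_of_real (g P)) *s grad (\<lambda>Q. \<Phi> (w Q)) P"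
    using c_eq[OF P] by (simp add: vec_eq_iff grad_def)
  have "(\<Phi> has_field_derivative deriv \<Phi> (w P)) (at (w P))"
    using holomorphic_derivI[OF assms(4,3) assms(5)[OF assms(7)]] .
  from grad_eqI[OF has_field_derivative_comp_has_derivative[OF this assms(8)]]
  show "c P = (exp (\<i> * complex_of_real (g P)) * deriv \<Phi> (w P)) *s (\<chi> k. w' (axis k 1))"
    unfolding 1 by (simp add: vec_eq_iff)
qed

end

section \<open>The Cartesian form\<close>

lemma smooth_on_coord: "open S \<Longrightarrow> smooth_on S (coord q e)"
  unfolding coord_def[abs_def]
  by (intro smooth_on_bounded_linear_comp[OF _ bounded_linear_inner_left] smooth_on_diff
      smooth_on_id smooth_on_const)

lemma has_derivative_coord: "(coord q e has_derivative (\<lambda>v. v \<bullet> e)) (at P)"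
  unfolding coord_def[abs_def]
  by (rule has_derivative_eq_rhs[OF has_derivative_inner_left[OF has_derivative_diff[OF
      has_derivative_ident has_derivative_const]]])
    simp

lemma rgrad_coord: "rgrad (coord q e) P = e"
  by (rule rgrad_eqI) (use has_derivative_coord[of q e P] in \<open>simp add: inner_commute\<close>)

lemma has_derivative_Complex:
  assumes "(f has_derivative f') F" "(g has_derivative g') F"
  shows "((\<lambda>x. Complex (f x) (g x)) has_derivative (\<lambda>v. Complex (f' v) (g' v))) F"
  unfolding Complex_eq
  by (intro has_derivative_add has_derivative_mult_right has_derivative_of_real assms)

text \<open>After passing to the phase z, the potential is constant in the direction e3, so it is
  determined by its restriction to a plane, where \<open>cdot_frame\<close> is the Cauchy-Riemann
  equation. Working in a ball keeps the connecting segments inside the domain.\<close>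

lemma (in phase_field) cartesian_form:
  assumes p: "p \<in> V" and n: "\<And>P. P \<in> V \<Longrightarrow> rgrad g P = e3" and fr: "right_handed_axes e1 e2 e3"
  shows "\<exists>W. open W \<and> p \<in> W \<and> W \<subseteq> V \<and> cartesian_form_on W q e1 e2 e3 c"
proof -
  obtain d where d: "0 < d" "ball p d \<subseteq> V" using open_V p open_contains_ball by blast
  have rg: "rgrad (coord q e3) P = rgrad g P" if "P \<in> ball p d" for P
    using n[of P] d(2) that by (auto simp: rgrad_coord)
  obtain F1 where F1: "phase_gradient_on (ball p d) c (coord q e3) F1"
    by (rule phase_gradient_on_change_phase[OF open_ball connected_ball
        phase_gradient_on_subset[OF phase d(2)]
          smooth_on_coord[OF open_ball] rg])
  interpret B: phase_field "ball p d" c "coord q e3" F1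
    by unfold_locales (use F1 curl_eq d in auto)
  note e = right_handed_axesD[OF fr]
  define w where "w P = Complex (coord q e1 P) (coord q e2 P)" for P
  define D where "D = ball (w p) d"
  \<comment> \<open>The plane through p orthogonal to e3, parametrised so that w inverts it. Being
    an isometry, \<sigma> maps the disc \<open>D\<close> into the ball of the same radius.\<close>
  define \<sigma> where "\<sigma> \<zeta> = p + ((Re \<zeta> - coord q e1 p) *\<^sub>R e1 + (Im \<zeta> - coord q e2 p) *\<^sub>R e2)" for \<zeta>
  have \<sigma>p: "norm (\<sigma> \<zeta> - p) = dist \<zeta> (w p)" for \<zeta>
  proof -
    have "(\<sigma> \<zeta> - p) \<bullet> (\<sigma> \<zeta> - p) = (Re \<zeta> - coord q e1 p)^2 + (Im \<zeta> - coord q e2 p)^2"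
      unfolding \<sigma>_def by (simp add: inner_add_left inner_add_right e power2_eq_square)
    then have "norm (\<sigma> \<zeta> - p) = sqrt ((Re \<zeta> - coord q e1 p)^2 + (Im \<zeta> - coord q e2 p)^2)"
      by (simp only: norm_eq_sqrt_inner)
    then show ?thesis by (simp add: dist_norm cmod_def w_def)
  qed
  have \<sigma>V: "\<sigma> \<zeta> \<in> ball p d" if "\<zeta> \<in> D" for \<zeta>
    using that \<sigma>p[of \<zeta>] by (simp add: D_def dist_norm norm_minus_commute)
  have hol: "(\<lambda>\<zeta>. F1 (\<sigma> \<zeta>)) holomorphic_on D"
  proof (rule B.holomorphic_on_section[OF \<sigma>V _ ])
    fix \<zeta> assume z: "\<zeta> \<in> D"
    have "((\<lambda>\<zeta>. \<sigma> \<zeta>) has_derivative (\<lambda>w. 0 + ((Re w - 0) *\<^sub>R e1 + (Im w - 0) *\<^sub>R e2))) (at \<zeta>)"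
      unfolding \<sigma>_def
      by (rule has_derivative_add[OF has_derivative_const has_derivative_add[OF
            has_derivative_scaleR_left[OF has_derivative_diff[OF
                bounded_linear_imp_has_derivative[OF bounded_linear_Re] has_derivative_const]]
            has_derivative_scaleR_left[OF has_derivative_diff[OF
                bounded_linear_imp_has_derivative[OF bounded_linear_Im] has_derivative_const]]]])
    then show "(\<sigma> has_derivative (\<lambda>w. Re w *\<^sub>R e1 + Im w *\<^sub>R e2)) (at \<zeta>)" by simp
    show "cdot (grad F1 (\<sigma> \<zeta>)) e2 = \<i> * cdot (grad F1 (\<sigma> \<zeta>)) e1"
      by (rule B.grad_frame[OF \<sigma>V[OF z]]) (simp add: rgrad_coord fr)
  qed (simp_all add: D_def)
  have wD: "w P \<in> D" if "P \<in> ball p d" for P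
  proof -
    have "(dist (w P) (w p))^2 = ((P - p) \<bullet> e1)^2 + ((P - p) \<bullet> e2)^2"
      by (simp add: dist_norm cmod_def w_def coord_def inner_diff_left)
    also have "\<dots> \<le> ((P - p) \<bullet> e1)^2 + ((P - p) \<bullet> e2)^2 + ((P - p) \<bullet> e3)^2" by simp
    also have "\<dots> = (P - p) \<bullet> (P - p)"
      by (subst (5) frame_expansion[OF fr, of "P - p"]) (simp add: inner_add_right power2_eq_square)
    also have "\<dots> = (dist P p)^2" by (simp add: dist_norm power2_norm_eq_inner)
    finally have "dist (w P) (w p) \<le> dist P p" by (simp add: power2_le_iff_abs_le)
    then show ?thesis using that by (simp add: D_def dist_commute)
  qed
  have F\<sigma>: "F1 P = F1 (\<sigma> (w P))" if P: "P \<in> ball p d" for P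
  proof (rule B.F_constant_on_segment)
    show sub: "closed_segment P (\<sigma> (w P)) \<subseteq> ball p d"
      by (rule closed_segment_subset[OF P \<sigma>V[OF wD[OF P]] convex_ball])
    fix R assume R: "R \<in> closed_segment P (\<sigma> (w P))"
    have "\<sigma> (w P) - P = (- ((P - p) \<bullet> e3)) *\<^sub>R e3"
    proof -
      have "P - p = ((P - p) \<bullet> e1) *\<^sub>R e1 + ((P - p) \<bullet> e2) *\<^sub>R e2 + ((P - p) \<bullet> e3) *\<^sub>R e3"
        by (rule frame_expansion[OF fr])
      moreover have "\<sigma> (w P) = p + (((P - p) \<bullet> e1) *\<^sub>R e1 + ((P - p) \<bullet> e2) *\<^sub>R e2)"
        by (simp add: \<sigma>_def w_def coord_def inner_diff_left)
      moreover have "s - x = - C" if "x - p = A + B + C" "s = p + (A + B)" for x A B C s :: "real^3"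
      proof -
        have "x = p + (A + B + C)" using that(1) by (simp add: diff_eq_eq)
        then show ?thesis using that(2) by simp
      qed
      ultimately show ?thesis by (metis scaleR_minus_left)
    qed
    moreover have "cdot (grad F1 R) e3 = 0"
      using B.grad_normal[of R] R sub by (auto simp: rgrad_coord)
    ultimately show "cdot (grad F1 R) (\<sigma> (w P) - P) = 0" by (simp only: cdot_scaleR mult_zero_right)
  qed
  have dw: "(w has_derivative (\<lambda>v. Complex (v \<bullet> e1) (v \<bullet> e2))) (at P)" for P
    unfolding w_def[abs_def] by (intro has_derivative_Complex has_derivative_coord)
  have vec: "(\<chi> k. Complex (axis k 1 \<bullet> e1) (axis k 1 \<bullet> e2)) = cvec e1 + \<i> *s cvec e2"
    by (simp add: vec_eq_iff cvec_def inner_axis' complex_eq_iff)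
  have "cartesian_form_on (ball p d) q e1 e2 e3 c"
    unfolding cartesian_form_on_def Let_def w_def[symmetric]
  proof (intro exI conjI ballI)
    show "open D" by (simp add: D_def)
    show "(\<lambda>\<zeta>. F1 (\<sigma> \<zeta>)) holomorphic_on D" by (rule hol)
    fix P assume P: "P \<in> ball p d"
    show "w P \<in> D" by (rule wD[OF P])
    note fac = B.factorised_form[OF open_ball order.refl _ hol wD F\<sigma> P dw, unfolded vec]
    show "c P = exp (\<i> * complex_of_real (coord q e3 P)) *s grad (\<lambda>Q. F1 (\<sigma> (w Q))) P"
      by (rule fac(1)) (simp add: D_def)
    show "c P = (exp (\<i> * complex_of_real (coord q e3 P)) * deriv (\<lambda>\<zeta>. F1 (\<sigma> \<zeta>)) (w P)) *s
        (cvec e1 + \<i> *s cvec e2)"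
      by (rule fac(2)) (simp add: D_def)
  qed
  then show ?thesis using d by (intro exI[of _ "ball p d"]) auto
qed

section \<open>Spherical coordinates\<close>

definition r_hat :: "real^3 \<Rightarrow> real^3 \<Rightarrow> real^3 \<Rightarrow> real \<Rightarrow> real \<Rightarrow> real^3" where
  "r_hat e1 e2 e3 t p = (sin t * cos p) *\<^sub>R e1 + (sin t * sin p) *\<^sub>R e2 + cos t *\<^sub>R e3"

lemma cross_right_handed:
  assumes "right_handed_axes e1 e2 e3"
  shows "cross3 e1 e2 = e3" "cross3 e2 e3 = e1" "cross3 e3 e1 = e2"
    "cross3 e2 e1 = - e3" "cross3 e3 e2 = - e1" "cross3 e1 e3 = - e2"
proof -
  note e = right_handed_axesD[OF assms]
  show 1: "cross3 e1 e2 = e3" by (rule e)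
  show 2: "cross3 e2 e3 = e1" using Lagrange[of e2 e1 e2] e by simp
  have "cross3 e1 e3 = - e2" using Lagrange[of e1 e1 e2] e by simp
  then show "cross3 e1 e3 = - e2" "cross3 e3 e1 = e2" using cross_skew[of e3 e1] by simp_all
  show "cross3 e2 e1 = - e3" "cross3 e3 e2 = - e1"
    using cross_skew[of e2 e1] cross_skew[of e3 e2] 1 2 by simp_all
qed

text \<open>The order (\<theta>, \<phi>, r) is the one in which the last axis is n and the field is
  a multiple of f1 + i f2, as in the Cartesian case.\<close>

lemma right_handed_spherical:
  assumes "right_handed_axes e1 e2 e3"
  shows "right_handed_axes (theta_hat e1 e2 e3 t p) (phi_hat e1 e2 p) (r_hat e1 e2 e3 t p)"
proof -
  note e = right_handed_axesD[OF assms]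
  note defs = theta_hat_def phi_hat_def r_hat_def
  have t: "cos t * cos t = 1 - sin t * sin t" "cos p * cos p = 1 - sin p * sin p"
    using sin_cos_squared_add3[of t] sin_cos_squared_add3[of p] by (simp_all add: algebra_simps)
  \<comment> \<open>Here C, S stand for cos t, sin t and k, s for cos p, sin p; orthonormality
    becomes polynomial identities modulo the two Pythagorean relations.\<close>
  have id: "C * k * (C * k) + C * s * (C * s) + S * S = 1" "S * k * (S * k) + S * s * (S * s)
      + C * C = 1"
    "S * k * (C * k) + S * s * (C * s) = S * C"
    if "C * C = 1 - S * S" "k * k = 1 - s * s" for C S k s :: real
    using that by algebra+
  have 1: "theta_hat e1 e2 e3 t p \<bullet> theta_hat e1 e2 e3 t p = 1"
    unfolding defs using id(1)[OF t]
    by (simp add: inner_add_left inner_add_right inner_diff_left inner_diff_right e)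
  have 2: "phi_hat e1 e2 p \<bullet> phi_hat e1 e2 p = 1"
    unfolding defs using t(2)
    by (simp add: inner_add_left inner_add_right inner_diff_left inner_diff_right e)
  have 3: "r_hat e1 e2 e3 t p \<bullet> r_hat e1 e2 e3 t p = 1"
    unfolding defs using id(2)[OF t]
    by (simp add: inner_add_left inner_add_right inner_diff_left inner_diff_right e)
  have 4: "theta_hat e1 e2 e3 t p \<bullet> phi_hat e1 e2 p = 0"
    unfolding defs by (simp add: inner_add_left inner_add_right inner_diff_left inner_diff_right e)
  have 5: "phi_hat e1 e2 p \<bullet> r_hat e1 e2 e3 t p = 0"
    unfolding defs by (simp add: inner_add_left inner_add_right inner_diff_left inner_diff_right e)
  have 6: "theta_hat e1 e2 e3 t p \<bullet> r_hat e1 e2 e3 t p = 0"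
    unfolding defs using id(3)[OF t]
    by (simp add: inner_add_left inner_add_right inner_diff_left inner_diff_right e algebra_simps)
  have 7: "r_hat e1 e2 e3 t p = cross3 (theta_hat e1 e2 e3 t p) (phi_hat e1 e2 p)"
  proof -
    have k: "(cos p * (cos p * cos t)) *\<^sub>R e3 + (cos t * (sin p * sin p)) *\<^sub>R e3 = cos t *\<^sub>R e3"
      unfolding scaleR_add_left[symmetric] mult.assoc[symmetric] t(2) by (simp add: algebra_simps)
    have "cross3 (theta_hat e1 e2 e3 t p) (phi_hat e1 e2 p)
      = (cos t * (cos p * cos p + sin p * sin p)) *\<^sub>R e3 + (sin t * sin p) *\<^sub>R e2 +
          (sin t * cos p) *\<^sub>R e1"
      unfolding defs
      by (simp add: cross_add_left cross_add_right Cross3.left_diff_distrib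
          Cross3.right_diff_distrib cross_mult_left cross_mult_right
          cross_minus_left cross_minus_right cross_right_handed[OF assms] algebra_simps k)
    then show ?thesis unfolding t by (simp add: r_hat_def)
  qed
  show ?thesis
    unfolding right_handed_axes_def norm_eq_1 using 1 2 3 4 5 6 7 by blast
qed

text \<open>Differentiating the three defining equations gives a linear system for dr, d\<theta> and
  d\<phi>; contracting it with the orthonormal frame solves it. Only r \<noteq> 0 and sin \<theta>
  \<noteq> 0 enter, so either sign of r is covered.\<close>

lemma spherical_chart_derivative:
  assumes "open V" "spherical_chart q e1 e2 e3 V r \<theta> \<phi>" "right_handed_axes e1 e2 e3" "P \<in> V"
  shows "(r has_derivative (\<lambda>v. v \<bullet> r_hat e1 e2 e3 (\<theta> P) (\<phi> P))) (at P)"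
    "(\<theta> has_derivative (\<lambda>v. (v \<bullet> theta_hat e1 e2 e3 (\<theta> P) (\<phi> P)) / r P)) (at P)"
    "(\<phi> has_derivative (\<lambda>v. (v \<bullet> phi_hat e1 e2 (\<phi> P)) / (r P * sin (\<theta> P)))) (at P)"
proof -
  define dr dt dp where "dr = frechet_derivative r (at P)" and "dt = frechet_derivative \<theta> (at P)"
    and "dp = frechet_derivative \<phi> (at P)"
  have d: "(r has_derivative dr) (at P)" "(\<theta> has_derivative dt) (at P)" "(\<phi> has_derivative dp)
      (at P)"
    unfolding dr_def dt_def dp_def using assms(2,4)
    by (auto simp: spherical_chart_def intro: smooth_on_has_derivative)
  have nz: "r P \<noteq> 0" "sin (\<theta> P) \<noteq> 0" using assms(2,4) by (auto simp: spherical_chart_def)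
  have ch: "coord q e1 P = r P * sin (\<theta> P) * cos (\<phi> P)" "coord q e2 P = r P * sin (\<theta> P) * sin (\<phi> P)"
    "coord q e3 P = r P * cos (\<theta> P)" if "P \<in> V" for P
    using assms(2) that by (auto simp: spherical_chart_def)
  have eq: "(\<lambda>v. v \<bullet> e) = f'" if "\<And>Q. Q \<in> V \<Longrightarrow> coord q e Q = f Q" "(f has_derivative f') (at P)"
      for e f f'
    by (rule has_derivative_unique[OF has_derivative_coord[of q e P]])
      (rule has_derivative_transform_within_open[OF that(2) assms(1,4)], simp add: that(1))
  have "(\<lambda>v. v \<bullet> e1) = (\<lambda>v. (r P * sin (\<theta> P)) * (dp v * - sin (\<phi> P)) + (r P * (dt v * cos (\<theta> P))
      + dr v * sin (\<theta> P)) * cos (\<phi> P))"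
    by (rule eq[OF ch(1)], assumption) (intro has_derivative_mult has_derivative_sin
        has_derivative_cos d)
  from fun_cong[OF this]
  have 1: "v \<bullet> e1 = (r P * sin (\<theta> P)) * (dp v * - sin (\<phi> P)) + (r P * (dt v * cos (\<theta> P))
      + dr v * sin (\<theta> P)) * cos (\<phi> P)" for v .
  have "(\<lambda>v. v \<bullet> e2) = (\<lambda>v. (r P * sin (\<theta> P)) * (dp v * cos (\<phi> P)) + (r P * (dt v * cos (\<theta> P))
      + dr v * sin (\<theta> P)) * sin (\<phi> P))"
    by (rule eq[OF ch(2)], assumption) (intro has_derivative_mult has_derivative_sin
        has_derivative_cos d)
  from fun_cong[OF this]
  have 2: "v \<bullet> e2 = (r P * sin (\<theta> P)) * (dp v * cos (\<phi> P)) + (r P * (dt v * cos (\<theta> P))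
      + dr v * sin (\<theta> P)) * sin (\<phi> P)" for v .
  have "(\<lambda>v. v \<bullet> e3) = (\<lambda>v. r P * (dt v * - sin (\<theta> P)) + dr v * cos (\<theta> P))"
    by (rule eq[OF ch(3)], assumption) (intro has_derivative_mult has_derivative_sin
        has_derivative_cos d)
  from fun_cong[OF this]
  have 3: "v \<bullet> e3 = r P * (dt v * - sin (\<theta> P)) + dr v * cos (\<theta> P)" for v .
  have t: "cos (\<theta> P) * cos (\<theta> P) = 1 - sin (\<theta> P) * sin (\<theta> P)" "cos (\<phi> P) * cos (\<phi> P) = 1 - sin
      (\<phi> P) * sin (\<phi> P)"
    using sin_cos_squared_add3[of "\<theta> P"] sin_cos_squared_add3[of "\<phi> P"]
        by (simp_all add: algebra_simps)
  have id: "S * k * x1 + S * s * x2 + C * x3 = a" "C * k * x1 + C * s * x2 - S * x3 = R * b"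
      "- s * x1 + k * x2 = d * (R * S)"
    if "C * C = 1 - S * S" "k * k = 1 - s * s" "x1 = (R * S) * (d * - s) + (R * (b * C)
        + a * S) * k"
      "x2 = (R * S) * (d * k) + (R * (b * C) + a * S) * s" "x3 = R * (b * - S) + a * C"
    for C S k s R a b d x1 x2 x3 :: real
    using that(1,2) unfolding that(3-5) by algebra+
  note id = id[OF t 1 2 3]
  have "dr v = v \<bullet> r_hat e1 e2 e3 (\<theta> P) (\<phi> P)" for v
    using id(1)[of v] by (simp add: r_hat_def inner_add_right)
  then have "dr = (\<lambda>v. v \<bullet> r_hat e1 e2 e3 (\<theta> P) (\<phi> P))" by (rule ext)
  then show "(r has_derivative (\<lambda>v. v \<bullet> r_hat e1 e2 e3 (\<theta> P) (\<phi> P))) (at P)"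
    using d(1) by simp
  have "dt v = (v \<bullet> theta_hat e1 e2 e3 (\<theta> P) (\<phi> P)) / r P" for v
    using id(2)[of v] nz by (simp add: theta_hat_def inner_add_right inner_diff_right)
  then have "dt = (\<lambda>v. (v \<bullet> theta_hat e1 e2 e3 (\<theta> P) (\<phi> P)) / r P)" by (rule ext)
  then show "(\<theta> has_derivative (\<lambda>v. (v \<bullet> theta_hat e1 e2 e3 (\<theta> P) (\<phi> P)) / r P)) (at P)"
    using d(2) by simp
  have "dp v = (v \<bullet> phi_hat e1 e2 (\<phi> P)) / (r P * sin (\<theta> P))" for v
    using id(3)[of v] nz by (simp add: phi_hat_def inner_add_right inner_diff_right)
  then have "dp = (\<lambda>v. (v \<bullet> phi_hat e1 e2 (\<phi> P)) / (r P * sin (\<theta> P)))" by (rule ext)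
  then show "(\<phi> has_derivative (\<lambda>v. (v \<bullet> phi_hat e1 e2 (\<phi> P)) / (r P * sin (\<theta> P)))) (at P)"
    using d(3) by simp
qed

text \<open>This is why artanh appears: d(- artanh (cos \<theta>)) = d\<theta> / sin \<theta>, and
  d\<theta> = v . \<theta>hat / r, so both components acquire the common factor 1 / (r sin \<theta>)
  and the map is conformal on spheres.\<close>

lemma has_derivative_spherical_variable:
  assumes "open V" "spherical_chart q e1 e2 e3 V r \<theta> \<phi>" "right_handed_axes e1 e2 e3" "P \<in> V"
  shows "((\<lambda>P. Complex (- artanh (cos (\<theta> P))) (\<phi> P)) has_derivative
    (\<lambda>v. Complex (v \<bullet> theta_hat e1 e2 e3 (\<theta> P) (\<phi> P)) (v \<bullet> phi_hat e1 e2 (\<phi> P)) / complex_of_real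
        (r P * sin (\<theta> P)))) (at P)"
proof -
  have nz: "r P \<noteq> 0" "sin (\<theta> P) \<noteq> 0" using assms(2,4) by (auto simp: spherical_chart_def)
  have sq: "1 - (cos (\<theta> P))^2 = (sin (\<theta> P))^2" by (simp add: sin_squared_eq)
  have "(cos (\<theta> P))^2 < 1" using sq nz(2) by (smt (verit) zero_less_power2)
  then have c: "\<bar>cos (\<theta> P)\<bar> < 1" by (simp add: abs_square_less_1)
  note d = spherical_chart_derivative[OF assms]
  have "((\<lambda>P. - artanh (cos (\<theta> P))) has_derivative
      (\<lambda>v. - (1 / (1 - (cos (\<theta> P))^2) * ((v \<bullet> theta_hat e1 e2 e3 (\<theta> P) (\<phi> P)) / r P * - sin
          (\<theta> P))))) (at P)"
    by (intro has_derivative_minus has_field_derivative_comp_has_derivative[of artanh]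
        has_derivative_cos d(2)
        artanh_real_has_field_derivative c)
  moreover have "- (1 / (1 - (cos (\<theta> P))^2) * ((v \<bullet> theta_hat e1 e2 e3 (\<theta> P) (\<phi> P)) / r P * - sin
      (\<theta> P)))
      = (v \<bullet> theta_hat e1 e2 e3 (\<theta> P) (\<phi> P)) / (r P * sin (\<theta> P))" for v
    unfolding sq using nz by (simp add: power2_eq_square)
  ultimately have "((\<lambda>P. - artanh (cos (\<theta> P))) has_derivative
      (\<lambda>v. (v \<bullet> theta_hat e1 e2 e3 (\<theta> P) (\<phi> P)) / (r P * sin (\<theta> P)))) (at P)"
    by simp
  from has_derivative_Complex[OF this d(3)]
  show ?thesis by (simp add: complex_eq_iff[symmetric] Complex_eq add_divide_distrib)
qed

lemma tanh_artanh:
  assumes "\<bar>x::real\<bar> < 1"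
  shows "tanh (artanh x) = x"
proof -
  have x: "0 < 1 + x" "0 < 1 - x" using assms by auto
  have "- 2 * artanh x = - ln ((1 + x) / (1 - x))" by (simp add: artanh_def)
  then have "exp (- 2 * artanh x) = inverse (exp (ln ((1 + x) / (1 - x))))"
    by (simp only: exp_minus)
  also have "\<dots> = (1 - x) / (1 + x)" using x by simp
  finally have "exp (- 2 * artanh x) = (1 - x) / (1 + x)" .
  then show ?thesis
    unfolding tanh_real_altdef using x by (simp only:) (simp add: field_simps)
qed

lemma sin_arccos_tanh: "sin (arccos (- tanh u)) = inverse (cosh (u::real))"
  and cos_arccos_tanh: "cos (arccos (- tanh u)) = - tanh u"
proof -
  have t: "\<bar>tanh u\<bar> < 1" using tanh_real_bounds[of u] by (simp add: abs_less_iff)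
  then show "cos (arccos (- tanh u)) = - tanh u" by (simp add: cos_arccos_abs)
  have "sin (arccos (- tanh u)) = sqrt (1 - (tanh u)^2)" using t by (simp add: sin_arccos_abs)
  also have "1 - (tanh u)^2 = ((cosh u)^2 - (sinh u)^2) / (cosh u)^2"
    by (simp add: tanh_def power_divide diff_divide_distrib)
  also have "\<dots> = (inverse (cosh u))^2"
    by (simp add: hyperbolic_pythagoras power_divide inverse_eq_divide)
  finally show "sin (arccos (- tanh u)) = inverse (cosh u)" by (simp add: real_sqrt_unique)
qed

section \<open>The spherical form\<close>

text \<open>A local inverse of \<open>P \<mapsto> - artanh (cos \<theta>) + i \<phi>\<close> on the sphere of radius \<open>|r0|\<close> about \<open>q\<close>;
  here \<open>\<theta> = arccos (- tanh u)\<close>, so that \<open>sin \<theta> = 1 / cosh u\<close>.\<close>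

definition sphere_section :: "real^3 \<Rightarrow> real^3 \<Rightarrow> real^3 \<Rightarrow> real^3 \<Rightarrow> real \<Rightarrow> complex \<Rightarrow> real^3" where
  "sphere_section q e1 e2 e3 r0 \<zeta> = q + r0 *\<^sub>R r_hat e1 e2 e3 (arccos (- tanh (Re \<zeta>))) (Im \<zeta>)"

text \<open>A function pulled back along the section is automatically 2 pi i periodic, which gives
  the single-valuedness clause in \<open>admissible_spherical\<close>.\<close>

lemma sphere_section_periodic:
  "sphere_section q e1 e2 e3 r0 (\<zeta> + 2 * of_real pi * \<i>) = sphere_section q e1 e2 e3 r0 \<zeta>"
  by (simp add: sphere_section_def r_hat_def)

text \<open>The derivatives in the two coordinate directions are orthogonal with the same factor r0
  sin \<theta>, so the Cauchy-Riemann equations on the sphere carry over to \<zeta>.\<close>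

lemma has_derivative_sphere_section:
  "(sphere_section q e1 e2 e3 r0 has_derivative
    (\<lambda>w. Re w *\<^sub>R ((r0 * sin (arccos (- tanh (Re \<zeta>)))) *\<^sub>R theta_hat e1 e2 e3 (arccos (- tanh
        (Re \<zeta>))) (Im \<zeta>))
       + Im w *\<^sub>R ((r0 * sin (arccos (- tanh (Re \<zeta>)))) *\<^sub>R phi_hat e1 e2 (Im \<zeta>)))) (at \<zeta>)"
proof -
  let ?u = "Re \<zeta>" and ?p = "Im \<zeta>"
  have Re: "(Re has_derivative Re) (at \<zeta>)" and Im: "(Im has_derivative Im) (at \<zeta>)"
    by (rule bounded_linear_imp_has_derivative bounded_linear_Re bounded_linear_Im)+
  have S: "((\<lambda>\<zeta>. inverse (cosh (Re \<zeta>))) has_derivative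
      (\<lambda>w. - (inverse (cosh ?u) * (sinh ?u * Re w) * inverse (cosh ?u)))) (at \<zeta>)"
  proof (rule Deriv.has_derivative_inverse)
    have "(cosh has_field_derivative sinh ?u) (at ?u)" by (auto intro!: derivative_eq_intros)
    from has_field_derivative_comp_has_derivative[OF this Re]
    show "((\<lambda>\<zeta>. cosh (Re \<zeta>)) has_derivative (\<lambda>w. sinh ?u * Re w)) (at \<zeta>)" .
  qed simp
  have C: "((\<lambda>\<zeta>. - tanh (Re \<zeta>)) has_derivative (\<lambda>w. - ((1 - (tanh ?u)^2) * Re w))) (at \<zeta>)"
  proof (rule has_derivative_minus)
    have "(tanh has_field_derivative 1 - (tanh ?u)^2) (at ?u)"
        by (auto intro!: derivative_eq_intros)
    from has_field_derivative_comp_has_derivative[OF this Re]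
    show "((\<lambda>\<zeta>. tanh (Re \<zeta>)) has_derivative (\<lambda>w. (1 - (tanh ?u)^2) * Re w)) (at \<zeta>)" .
  qed
  have t2: "1 - (tanh ?u)^2 = inverse (cosh ?u) * inverse (cosh ?u)"
    using sin_arccos_tanh[of ?u] cos_arccos_tanh[of ?u] sin_cos_squared_add3[of "arccos
        (- tanh ?u)"]
    by (simp add: power2_eq_square algebra_simps)
  have sh: "sinh ?u * inverse (cosh ?u) = tanh ?u" by (simp add: tanh_def divide_inverse)
  have D: "((\<lambda>\<zeta>. q + r0 *\<^sub>R ((inverse (cosh (Re \<zeta>)) * cos (Im \<zeta>)) *\<^sub>R e1 + (inverse (cosh
      (Re \<zeta>)) * sin (Im \<zeta>)) *\<^sub>R e2
        + (- tanh (Re \<zeta>)) *\<^sub>R e3)) has_derivative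
     (\<lambda>w. 0 + r0 *\<^sub>R ((inverse (cosh ?u) * (Im w * - sin ?p) + - (inverse (cosh ?u) *
         (sinh ?u * Re w) * inverse (cosh ?u)) * cos ?p) *\<^sub>R e1
        + (inverse (cosh ?u) * (Im w * cos ?p) + - (inverse (cosh ?u) * (sinh ?u * Re w) * inverse
            (cosh ?u)) * sin ?p) *\<^sub>R e2
        + (- ((1 - (tanh ?u)^2) * Re w)) *\<^sub>R e3))) (at \<zeta>)"
    by (rule has_derivative_add[OF has_derivative_const] has_derivative_scaleR_right
        has_derivative_add
        has_derivative_scaleR_left has_derivative_mult S C has_derivative_sin
            has_derivative_cos Im)+
  show ?thesis
    unfolding sphere_section_def[abs_def] r_hat_def theta_hat_def phi_hat_def sin_arccos_tanh
        cos_arccos_tanh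
  proof (rule has_derivative_eq_rhs[OF D], rule ext)
    fix w
    define S T where "S = inverse (cosh ?u)" and "T = tanh ?u"
    have e: "inverse (cosh ?u) * (sinh ?u * Re w) * inverse (cosh ?u) = S * T * Re w"
      unfolding S_def T_def sh[symmetric] by (simp only: mult_ac)
    show "0 + r0 *\<^sub>R ((inverse (cosh ?u) * (Im w * - sin ?p) + - (inverse (cosh ?u) *
        (sinh ?u * Re w) * inverse (cosh ?u)) * cos ?p) *\<^sub>R e1
        + (inverse (cosh ?u) * (Im w * cos ?p) + - (inverse (cosh ?u) * (sinh ?u * Re w) * inverse
            (cosh ?u)) * sin ?p) *\<^sub>R e2
        + (- ((1 - (tanh ?u)^2) * Re w)) *\<^sub>R e3)
      = Re w *\<^sub>R ((r0 * inverse (cosh ?u)) *\<^sub>R ((- tanh ?u * cos ?p) *\<^sub>R e1 +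
          (- tanh ?u * sin ?p) *\<^sub>R e2 - inverse (cosh ?u) *\<^sub>R e3))
       + Im w *\<^sub>R ((r0 * inverse (cosh ?u)) *\<^sub>R (- sin ?p *\<^sub>R e1 + cos ?p *\<^sub>R e2))"
      unfolding e t2 unfolding S_def[symmetric] T_def[symmetric] by (simp add: algebra_simps)
  qed
qed

lemma spherical_chart_subset:
  "spherical_chart q e1 e2 e3 V r \<theta> \<phi> \<Longrightarrow> W \<subseteq> V \<Longrightarrow> spherical_chart q e1 e2 e3 W r \<theta> \<phi>"
  using smooth_on_subset[of V r W] smooth_on_subset[of V \<theta> W] smooth_on_subset[of V \<phi> W]
  by (auto simp: spherical_chart_def)

lemma spherical_form_third:
  assumes "(\<And>v. w' v = Complex (v \<bullet> a) (v \<bullet> b) / z)"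
  shows "s *s (\<chi> k. w' (axis k 1)) = (s / z) *s (cvec a + \<i> *s cvec b)"
  by (simp add: vec_eq_iff assms cvec_def inner_axis' Complex_eq algebra_simps add_divide_distrib)

text \<open>Rotating by -\<alpha> brings z into the right half-plane, where the principal logarithm
  is smooth; \<alpha> is added back afterwards.\<close>

lemma exists_azimuth:
  assumes "open V" "smooth_on V z" "\<And>P. P \<in> V \<Longrightarrow> 0 < Re (cnj (cis \<alpha>) * z P)"
  shows "\<exists>\<phi>. smooth_on V \<phi> \<and> (\<forall>P\<in>V. z P = of_real (cmod (z P)) * cis (\<phi> P))"
proof (intro exI conjI ballI)
  define y where "y P = cnj (cis \<alpha>) * z P" for P
  have sy: "smooth_on V y"
    unfolding y_def[abs_def] by (rule smooth_on_mult[OF assms(1) smooth_on_const assms(2)])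
  have pos: "0 < Re (y P)" if "P \<in> V" for P using assms(3)[OF that] by (simp add: y_def)
  show "smooth_on V (\<lambda>P. \<alpha> + Im (Ln (y P)))"
  proof (rule smooth_onI_derivative[OF assms(1)])
    fix P assume P: "P \<in> V"
    have "y P \<notin> \<real>\<^sub>\<le>\<^sub>0" using pos[OF P] by (auto simp: complex_nonpos_Reals_iff)
    from has_field_derivative_comp_has_derivative[OF
        has_field_derivative_Ln[OF this] smooth_on_has_derivative[OF sy P]]
    have "((\<lambda>P. \<alpha> + Im (Ln (y P))) has_derivative (\<lambda>v. 0 + Im (inverse
        (y P) * frechet_derivative y (at P) v))) (at P)"
      by (intro has_derivative_add has_derivative_const bounded_linear.has_derivative[OF
          bounded_linear_Im])
    then show "((\<lambda>P. \<alpha> + Im (Ln (y P))) has_derivative (\<lambda>v. Im (inverse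
        (y P) * frechet_derivative y (at P) v))) (at P)"
      by simp
  next
    fix v
    have "y P \<noteq> 0" if "P \<in> V" for P using pos[OF that] by auto
    then show "smooth_on V (\<lambda>P. Im (inverse (y P) * frechet_derivative y (at P) v))"
      by (intro smooth_on_bounded_linear_comp[OF assms(1) bounded_linear_Im] smooth_on_mult[OF
          assms(1)]
          smooth_on_inverse[OF assms(1) sy] smooth_on_frechet_derivative[OF sy])
  qed
  fix P assume P: "P \<in> V"
  have "y P \<noteq> 0" using pos[OF P] by auto
  then have "cis (Im (Ln (y P))) = sgn (y P)" using cis_Arg Arg_eq_Im_Ln by metis
  moreover have "cmod (y P) = cmod (z P)" by (simp add: y_def norm_mult)
  moreover have "cis \<alpha> * y P = z P"
    unfolding y_def by (simp add: mult.assoc[symmetric] cis_cnj cis_mult)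
  ultimately have "cis (\<alpha> + Im (Ln (y P))) = inverse (of_real (cmod (z P))) * z P"
    by (simp add: cis_mult[symmetric] sgn_div_norm scaleR_conv_of_real divide_inverse
        mult.left_commute)
  moreover have "z P \<noteq> 0" using \<open>y P \<noteq> 0\<close> by (auto simp: y_def)
  ultimately show "z P = of_real (cmod (z P)) * cis (\<alpha> + Im (Ln (y P)))" by simp
qed

text \<open>The angles are those of n, not of P - q. Hence the equations of a chart also hold for
  negative r, where n points towards q.\<close>

lemma exists_spherical_chart:
  assumes "open U" "smooth_on U n" "smooth_on U r" "right_handed_axes e1 e2 e3"
    and unit: "\<And>P. P \<in> U \<Longrightarrow> n P \<bullet> n P = 1"
    and r: "\<And>P. P \<in> U \<Longrightarrow> r P \<noteq> 0" "\<And>P. P \<in> U \<Longrightarrow> P - q = r P *\<^sub>R n P"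
    and p: "p \<in> U" "p \<notin> polar_axis q e1 e2"
  obtains W \<theta> \<phi> where "open W" "p \<in> W" "W \<subseteq> U" "spherical_chart q e1 e2 e3 W r \<theta> \<phi>"
    "\<And>P. P \<in> W \<Longrightarrow> n P = r_hat e1 e2 e3 (\<theta> P) (\<phi> P)" "\<And>P. P \<in> W \<Longrightarrow> 0 < sin (\<theta> P)"
proof -
  note e = right_handed_axesD[OF assms(4)]
  define z where "z P = Complex (n P \<bullet> e1) (n P \<bullet> e2)" for P
  have sn: "smooth_on U (\<lambda>P. n P \<bullet> e)" for e
    by (rule smooth_on_bounded_linear_comp[OF assms(1) bounded_linear_inner_left assms(2)])
  have sz: "smooth_on U z"
    unfolding z_def[abs_def] Complex_eq
    by (intro smooth_on_add assms(1) smooth_on_mult smooth_on_const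
        smooth_on_bounded_linear_comp[OF _ bounded_linear_of_real] sn)
  define \<alpha> where "\<alpha> = Arg (z p)"
  have zp: "z p \<noteq> 0"
  proof
    assume "z p = 0"
    then have "n p \<bullet> e1 = 0" "n p \<bullet> e2 = 0" by (simp_all add: z_def complex_eq_iff)
    then show False using p r(2)[OF p(1)] by (simp add: polar_axis_def coord_def)
  qed
  define W where "W = U \<inter> (\<lambda>P. Re (cnj (cis \<alpha>) * z P)) -` {0<..}"
  have W: "open W" "W \<subseteq> U"
    unfolding W_def using smooth_on_imp_continuous_on[OF sz]
    by (auto intro!: continuous_open_preimage continuous_intros assms(1))
  have "p \<in> W"
  proof -
    have "z p = of_real (cmod (z p)) * cis \<alpha>"
      using zp by (simp add: \<alpha>_def cis_Arg sgn_div_norm scaleR_conv_of_real)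
    then have "cnj (cis \<alpha>) * z p = of_real (cmod (z p))"
      by (metis (no_types, lifting) cis_cnj cis_mult mult.left_commute mult.right_neutral
          add.left_inverse cis_zero)
    then have "0 < Re (cnj (cis \<alpha>) * z p)"
      using zp by (simp only: Re_complex_of_real zero_less_norm_iff not_False_eq_True)
    then show ?thesis
      unfolding W_def by (intro IntI vimageI2 p(1)) (simp only: greaterThan_iff)
  qed
  obtain \<phi> where \<phi>: "smooth_on W \<phi>" "\<And>P. P \<in> W \<Longrightarrow> z P = of_real (cmod (z P)) * cis (\<phi> P)"
    using exists_azimuth[OF W(1) smooth_on_subset[OF sz W(2)], of \<alpha>] by (auto simp: W_def)
  define \<rho> where "\<rho> P = sqrt ((n P \<bullet> e1)^2 + (n P \<bullet> e2)^2)" for P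
  have \<rho>z: "cmod (z P) = \<rho> P" for P by (simp add: \<rho>_def z_def cmod_def)
  have pos: "0 < (n P \<bullet> e1)^2 + (n P \<bullet> e2)^2" if "P \<in> W" for P
  proof -
    have "z P \<noteq> 0" using that by (auto simp: W_def)
    then show ?thesis by (auto simp: z_def complex_eq_iff sum_power2_gt_zero_iff)
  qed
  then have \<rho>0: "0 < \<rho> P" if "P \<in> W" for P using that by (simp add: \<rho>_def)
  have n123: "(n P \<bullet> e1)^2 + (n P \<bullet> e2)^2 + (n P \<bullet> e3)^2 = 1" if "P \<in> U" for P
  proof -
    have "n P \<bullet> n P = n P \<bullet> ((n P \<bullet> e1) *\<^sub>R e1 + (n P \<bullet> e2) *\<^sub>R e2 + (n P \<bullet> e3) *\<^sub>R e3)"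
      using frame_expansion[OF assms(4), of "n P"] by simp
    then show ?thesis using unit[OF that] by (simp only: inner_add_right inner_scaleR_right
        power2_eq_square)
  qed
  have n3: "\<bar>n P \<bullet> e3\<bar> < 1" "sqrt (1 - (n P \<bullet> e3)^2) = \<rho> P" if "P \<in> W" for P
  proof -
    have "(n P \<bullet> e3)^2 < 1" using n123[of P] pos[OF that] that W(2) by (smt (verit) subsetD)
    then show "\<bar>n P \<bullet> e3\<bar> < 1" by (simp add: abs_square_less_1)
    have "1 - (n P \<bullet> e3)^2 = (n P \<bullet> e1)^2 + (n P \<bullet> e2)^2" using n123[of P] that W(2) by (smt
        (verit) subsetD)
    then show "sqrt (1 - (n P \<bullet> e3)^2) = \<rho> P" by (simp add: \<rho>_def)
  qed
  define \<theta> where "\<theta> P = arccos (n P \<bullet> e3)" for P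
  have cs: "cos (\<theta> P) = n P \<bullet> e3" "sin (\<theta> P) = \<rho> P" if "P \<in> W" for P
    using n3[OF that] by (simp_all add: \<theta>_def cos_arccos_abs sin_arccos_abs)
  have s\<rho>: "smooth_on W \<rho>"
    unfolding \<rho>_def[abs_def]
    by (intro smooth_on_sqrt W(1) smooth_on_add smooth_on_power smooth_on_subset[OF sn W(2)] pos)
  have s\<theta>: "smooth_on W \<theta>"
  proof (rule smooth_onI_derivative[OF W(1)])
    fix P assume P: "P \<in> W"
    have "(arccos has_field_derivative inverse (- \<rho> P)) (at (n P \<bullet> e3))"
      using DERIV_arccos[of "n P \<bullet> e3"] n3[OF P] by (simp add: abs_less_iff)
    then show "(\<theta> has_derivative (\<lambda>v. inverse (- \<rho> P) * frechet_derivative (\<lambda>P. n P \<bullet> e3)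
        (at P) v)) (at P)"
      unfolding \<theta>_def[abs_def]
      by (rule has_field_derivative_comp_has_derivative[OF _ smooth_on_has_derivative[OF
          smooth_on_subset[OF sn W(2)] P]])
  next
    fix v
    have "- \<rho> P \<noteq> 0" if "P \<in> W" for P using \<rho>0[OF that] by simp
    then show "smooth_on W (\<lambda>P. inverse (- \<rho> P) * frechet_derivative (\<lambda>P. n P \<bullet> e3) (at P) v)"
      by (intro smooth_on_mult W(1) smooth_on_inverse smooth_on_minus s\<rho>
          smooth_on_frechet_derivative
          smooth_on_subset[OF sn W(2)])
  qed
  have n12: "n P \<bullet> e1 = \<rho> P * cos (\<phi> P)" "n P \<bullet> e2 = \<rho> P * sin (\<phi> P)" if "P \<in> W" for P
    using arg_cong[OF \<phi>(2)[OF that], of Re] arg_cong[OF \<phi>(2)[OF that], of Im] unfolding \<rho>z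
    by (simp_all add: z_def)
  show ?thesis
  proof (rule that[OF W(1) \<open>p \<in> W\<close> W(2)])
    show "spherical_chart q e1 e2 e3 W r \<theta> \<phi>"
      unfolding spherical_chart_def
    proof (intro conjI ballI)
      show "smooth_on W r" by (rule smooth_on_subset[OF assms(3) W(2)])
      show "smooth_on W \<theta>" "smooth_on W \<phi>" by (rule s\<theta> \<phi>(1))+
      fix P assume P: "P \<in> W"
      then have PU: "P \<in> U" using W(2) by blast
      show "r P \<noteq> 0" by (rule r(1)[OF PU])
      show "sin (\<theta> P) \<noteq> 0" using \<rho>0[OF P] cs[OF P] by simp
      have "coord q e P = r P * (n P \<bullet> e)" for e by (simp add: coord_def r(2)[OF PU])
      then show "coord q e1 P = r P * sin (\<theta> P) * cos (\<phi> P)" "coord q e2 P = r P * sin (\<theta> P) * sin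
          (\<phi> P)"
        "coord q e3 P = r P * cos (\<theta> P)"
        using n12[OF P] cs[OF P] by (simp_all add: mult.assoc)
    qed
    fix P assume P: "P \<in> W"
    show "0 < sin (\<theta> P)" using \<rho>0[OF P] cs[OF P] by simp
    show "n P = r_hat e1 e2 e3 (\<theta> P) (\<phi> P)"
      using frame_expansion[OF assms(4), of "n P"] n12[OF P] cs[OF P] by (simp add: r_hat_def)
  qed
qed

text \<open>The signed distance r = 1/\<kappa> has gradient n and can serve as phase. The potential
  is then constant along rays and so determined by its restriction to the sphere through p, where
  \<open>sphere_section\<close> makes it holomorphic.\<close>

lemma (in phase_field) spherical_form:
  assumes p: "p \<in> V" and fr: "right_handed_axes e1 e2 e3"
    and n: "\<And>P. P \<in> V \<Longrightarrow> rgrad g P = n P" and sn: "smooth_on V n"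
    and unit: "\<And>P. P \<in> V \<Longrightarrow> n P \<bullet> n P = 1"
    and sk: "smooth_on V \<kappa>" and k: "\<And>P. P \<in> V \<Longrightarrow> \<kappa> P \<noteq> 0"
    and dk: "\<And>P. P \<in> V \<Longrightarrow> (\<kappa> has_derivative (\<lambda>v. - ((\<kappa> P)^2) * (v \<bullet> n P))) (at P)"
    and nk: "\<And>P. P \<in> V \<Longrightarrow> n P = \<kappa> P *\<^sub>R (P - q)"
    and axis: "p \<notin> polar_axis q e1 e2"
  shows "\<exists>W. open W \<and> p \<in> W \<and> W \<subseteq> V \<and> spherical_form_on W q e1 e2 e3 c"
proof -
  define r where "r P = inverse (\<kappa> P)" for P
  have sr: "smooth_on V r"
    unfolding r_def[abs_def] by (rule smooth_on_inverse[OF open_V sk k])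
  have r0: "r P \<noteq> 0" and rn: "P - q = r P *\<^sub>R n P" if "P \<in> V" for P
    using k[OF that] nk[OF that] by (simp_all add: r_def)
  have rr: "rgrad r P = n P" if P: "P \<in> V" for P
  proof (rule rgrad_eqI)
    have "(r has_derivative (\<lambda>v. - (inverse (\<kappa> P) * (- ((\<kappa> P)^2) * (v \<bullet> n P)) * inverse (\<kappa> P))))
        (at P)"
      unfolding r_def[abs_def] by (rule Deriv.has_derivative_inverse[OF k[OF P] dk[OF P]])
    moreover have "- (inverse (\<kappa> P) * (- ((\<kappa> P)^2) * (v \<bullet> n P)) * inverse (\<kappa> P)) = n P \<bullet> v" for v
      using k[OF P] by (simp add: power2_eq_square inner_commute)
    ultimately show "(r has_derivative (\<lambda>v. n P \<bullet> v)) (at P)" by simp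
  qed
  \<comment> \<open>Here \<kappa> keeps the sign it has at p. Otherwise a point of the section could
    have normal -m instead of m.\<close>
  define V1 where "V1 = V \<inter> (\<lambda>P. \<kappa> P * \<kappa> p) -` {0<..}"
  have "open V1"
    unfolding V1_def
    by (intro continuous_open_preimage open_V continuous_intros smooth_on_imp_continuous_on[OF sk])
  moreover have "p \<in> V1" using p k[OF p] by (simp add: V1_def zero_less_mult_iff
      linorder_neq_iff[symmetric])
  ultimately obtain d where d: "0 < d" "ball p d \<subseteq> V1" using open_contains_ball by blast
  have dV: "ball p d \<subseteq> V" using d(2) by (auto simp: V1_def)
  have rg: "rgrad r P = rgrad g P" if "P \<in> ball p d" for P
    using n rr dV that by auto
  obtain F1 where F1: "phase_gradient_on (ball p d) c r F1"
    by (rule phase_gradient_on_change_phase[OF open_ball connected_ball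
        phase_gradient_on_subset[OF phase dV]
          smooth_on_subset[OF sr dV] rg])
  interpret B: phase_field "ball p d" c r F1
    by unfold_locales (use F1 curl_eq dV in auto)
  obtain W0 \<theta> \<phi> where W0: "open W0" "p \<in> W0" "W0 \<subseteq> V" "spherical_chart q e1 e2 e3 W0 r \<theta> \<phi>"
    "\<And>P. P \<in> W0 \<Longrightarrow> n P = r_hat e1 e2 e3 (\<theta> P) (\<phi> P)" "\<And>P. P \<in> W0 \<Longrightarrow> 0 < sin (\<theta> P)"
    by (rule exists_spherical_chart[OF open_V sn sr fr unit r0 rn p axis]; (rule that)?; assumption)
  define \<sigma> where "\<sigma> = sphere_section q e1 e2 e3 (r p)"
  define m where "m \<zeta> = r_hat e1 e2 e3 (arccos (- tanh (Re \<zeta>))) (Im \<zeta>)" for \<zeta>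
  have \<sigma>m: "\<sigma> \<zeta> = q + r p *\<^sub>R m \<zeta>" for \<zeta> by (simp add: \<sigma>_def sphere_section_def m_def)
  \<comment> \<open>The full preimage, rather than a disc, so that \<open>D\<close> is invariant
    under translation by 2 pi i.\<close>
  define D where "D = \<sigma> -` ball p d"
  have d\<sigma>: "(\<sigma> has_derivative
    (\<lambda>w. Re w *\<^sub>R ((r p * sin (arccos (- tanh (Re \<zeta>)))) *\<^sub>R theta_hat e1 e2 e3 (arccos (- tanh
        (Re \<zeta>))) (Im \<zeta>))
       + Im w *\<^sub>R ((r p * sin (arccos (- tanh (Re \<zeta>)))) *\<^sub>R phi_hat e1 e2 (Im \<zeta>)))) (at \<zeta>)" for \<zeta>
    unfolding \<sigma>_def by (rule has_derivative_sphere_section)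
  have "continuous_on UNIV \<sigma>"
    by (rule has_derivative_continuous_on[OF has_derivative_at_withinI[OF d\<sigma>]])
  then have oD: "open D" unfolding D_def by (intro open_vimage open_ball)
  have n\<sigma>: "n (\<sigma> \<zeta>) = m \<zeta>" if z: "\<zeta> \<in> D" for \<zeta>
  proof -
    \<comment> \<open>Both n and m are unit vectors, so this factor between them is 1 or -1; the
      definition of \<open>V1\<close> makes it positive.\<close>
    let ?a = "\<kappa> (\<sigma> \<zeta>) * r p"
    have mm: "m \<zeta> \<bullet> m \<zeta> = 1"
      unfolding m_def by (rule right_handed_axesD(3)[OF right_handed_spherical[OF fr]])
    have V1: "\<sigma> \<zeta> \<in> V1" and V: "\<sigma> \<zeta> \<in> V" using z d(2) dV by (auto simp: D_def)
    have nm: "n (\<sigma> \<zeta>) = ?a *\<^sub>R m \<zeta>" using nk[OF V] by (simp add: \<sigma>m)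
    then have "?a * ?a = 1" using unit[OF V] mm by simp
    moreover have "0 < ?a"
    proof -
      have "0 < \<kappa> (\<sigma> \<zeta>) * \<kappa> p" using V1 by (simp add: V1_def)
      then show ?thesis by (auto simp: r_def zero_less_mult_iff)
    qed
    ultimately have "?a = 1" by (smt (verit) mult_less_cancel_left2 mult_less_cancel_right1)
    then show ?thesis using nm by simp
  qed
  have hol: "(\<lambda>\<zeta>. F1 (\<sigma> \<zeta>)) holomorphic_on D"
  proof (rule B.holomorphic_on_section[OF _ oD d\<sigma>])
    fix \<zeta> assume z: "\<zeta> \<in> D"
    then show S: "\<sigma> \<zeta> \<in> ball p d" by (simp add: D_def)
    have "rgrad r (\<sigma> \<zeta>) = m \<zeta>" using rr n\<sigma>[OF z] S dV by auto
    then have "cdot (grad F1 (\<sigma> \<zeta>)) (phi_hat e1 e2 (Im \<zeta>))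
      = \<i> * cdot (grad F1 (\<sigma> \<zeta>)) (theta_hat e1 e2 e3 (arccos (- tanh (Re \<zeta>))) (Im \<zeta>))"
      by (intro B.grad_frame[OF S]) (simp add: m_def right_handed_spherical[OF fr])
    then show "cdot (grad F1 (\<sigma> \<zeta>)) ((r p * sin (arccos (- tanh (Re \<zeta>)))) *\<^sub>R phi_hat e1 e2 (Im \<zeta>))
      = \<i> * cdot (grad F1 (\<sigma> \<zeta>)) ((r p * sin (arccos (- tanh (Re \<zeta>)))) *\<^sub>R theta_hat e1 e2 e3
          (arccos (- tanh (Re \<zeta>))) (Im \<zeta>))"
      by (simp add: cdot_scaleR)
  qed
  define w where "w P = Complex (- artanh (cos (\<theta> P))) (\<phi> P)" for P
  have \<sigma>w: "\<sigma> (w P) = q + r p *\<^sub>R n P" if P: "P \<in> W0" for P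
  proof -
    have s: "sin (\<theta> P) > 0" by (rule W0(6)[OF P])
    have "(cos (\<theta> P))^2 < 1" using sin_squared_eq[of "\<theta> P"] s by (smt (verit) zero_less_power2)
    then have c: "\<bar>cos (\<theta> P)\<bar> < 1" by (simp add: abs_square_less_1)
    then have t: "- tanh (Re (w P)) = cos (\<theta> P)" by (simp add: w_def tanh_artanh)
    have "sin (arccos (cos (\<theta> P))) = sqrt ((sin (\<theta> P))^2)" using c
        by (simp add: sin_arccos_abs sin_squared_eq)
    then have "sin (arccos (cos (\<theta> P))) = sin (\<theta> P)" using s by simp
    moreover have "cos (arccos (cos (\<theta> P))) = cos (\<theta> P)" using c by (simp add: cos_arccos_abs)
    ultimately have "m (w P) = n P" unfolding m_def t W0(5)[OF P] r_hat_def by (simp add: w_def)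
    then show ?thesis by (simp add: \<sigma>m)
  qed
  define W1 where "W1 = ball p d \<inter> W0"
  \<comment> \<open>The radial projection of P to the sphere through p must also lie in the ball:
    then w P is in \<open>D\<close>, and by convexity so is the whole radial segment in the
    ball.\<close>
  define W where "W = W1 \<inter> (\<lambda>P. q + r p *\<^sub>R n P) -` ball p d"
  have "open W"
    unfolding W_def W1_def
    by (intro continuous_open_preimage open_Int open_ball W0(1) continuous_intros
        continuous_on_subset[OF smooth_on_imp_continuous_on[OF sn]]) (use W0(3) in auto)
  have "p \<in> W" using W0(2) d(1) rn[OF p] by (simp add: W_def W1_def flip: rn[OF p])
  have W: "W \<subseteq> ball p d" "W \<subseteq> W0" "W \<subseteq> V" using W0(3) by (auto simp: W_def W1_def)
  have wD: "w P \<in> D" if "P \<in> W" for P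
    using that \<sigma>w[of P] by (auto simp: D_def W_def W1_def)
  have F\<sigma>: "F1 P = F1 (\<sigma> (w P))" if P: "P \<in> W" for P
  proof (rule B.F_constant_on_segment)
    have PV: "P \<in> V" "P \<in> W0" "P \<in> ball p d" using P W by auto
    show sub: "closed_segment P (\<sigma> (w P)) \<subseteq> ball p d"
      by (rule closed_segment_subset[OF PV(3) _ convex_ball]) (use wD[OF P] in \<open>simp add: D_def\<close>)
    fix R assume R: "R \<in> closed_segment P (\<sigma> (w P))"
    then have RV: "R \<in> V" "R \<in> ball p d" using sub dV by auto
    obtain u where u: "R = (1 - u) *\<^sub>R P + u *\<^sub>R \<sigma> (w P)" using R by (auto simp: closed_segment_def)
    \<comment> \<open>The segment stays on the line through q in direction n P, so n R is a multiple
      of n P; it is a nonzero one because n R is a unit vector.\<close>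
    define s where "s = (1 - u) * r P + u * r p"
    have "R - q = (1 - u) *\<^sub>R (P - q) + u *\<^sub>R (\<sigma> (w P) - q)" by (simp add: u algebra_simps)
    also have "\<dots> = s *\<^sub>R n P" unfolding rn[OF PV(1)] \<sigma>w[OF PV(2)] by (simp add: s_def algebra_simps)
    finally have "n R = (\<kappa> R * s) *\<^sub>R n P" using nk[OF RV(1)] by simp
    moreover have "n R \<noteq> 0" using unit[OF RV(1)] by auto
    ultimately have nP: "\<kappa> R * s \<noteq> 0" and nR: "cdot (grad F1 R) (n R) = of_real (\<kappa> R * s) * cdot
        (grad F1 R) (n P)"
      by (auto simp: cdot_scaleR)
    have "cdot (grad F1 R) (n R) = 0"
      using B.grad_normal[OF RV(2)] rr[OF RV(1)] by simp
    then have 0: "cdot (grad F1 R) (n P) = 0" using nR nP by simp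
    have "\<sigma> (w P) - P = (r p - r P) *\<^sub>R n P"
      using \<sigma>w[OF PV(2)] rn[OF PV(1)] by (simp add: scaleR_diff_left flip: rn[OF PV(1)])
    then show "cdot (grad F1 R) (\<sigma> (w P) - P) = 0" using 0
        by (simp only: cdot_scaleR mult_zero_right)
  qed
  have chart: "spherical_chart q e1 e2 e3 W r \<theta> \<phi>"
    by (rule spherical_chart_subset[OF W0(4) W(2)])
  have "spherical_form_on W q e1 e2 e3 c"
    unfolding spherical_form_on_def Let_def
  proof (intro exI conjI ballI)
    show "spherical_chart q e1 e2 e3 W r \<theta> \<phi>" by (rule chart)
    show "open D" by (rule oD)
    show "(\<lambda>\<zeta>. F1 (\<sigma> \<zeta>)) holomorphic_on D" by (rule hol)
    show "admissible_spherical D (\<lambda>\<zeta>. F1 (\<sigma> \<zeta>))"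
      by (simp add: admissible_spherical_def D_def \<sigma>_def sphere_section_periodic)
    fix P assume P: "P \<in> W"
    show "Complex (- artanh (cos (\<theta> P))) (\<phi> P) \<in> D" using wD[OF P] by (simp add: w_def)
    note dw = has_derivative_spherical_variable[OF \<open>open W\<close> chart fr P, folded w_def]
    note fac = B.factorised_form[OF \<open>open W\<close> W(1) oD hol wD F\<sigma> P dw]
    show "c P = exp (\<i> * complex_of_real (r P)) *s grad (\<lambda>Q. F1 (\<sigma> (Complex (- artanh (cos (\<theta> Q)))
        (\<phi> Q)))) P"
      using fac(1) unfolding w_def by simp
    show "c P = (exp (\<i> * complex_of_real (r P)) / complex_of_real (r P * sin (\<theta> P)) *
       deriv (\<lambda>\<zeta>. F1 (\<sigma> \<zeta>)) (Complex (- artanh (cos (\<theta> P))) (\<phi> P))) *s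
       (cvec (theta_hat e1 e2 e3 (\<theta> P) (\<phi> P)) + \<i> *s cvec (phi_hat e1 e2 (\<phi> P)))"
      using fac(2) unfolding spherical_form_third[OF refl] by (simp add: w_def)
  qed
  then show ?thesis using \<open>open W\<close> \<open>p \<in> W\<close> W(3) by blast
qed

section \<open>Fields of the two forms are solutions\<close>

text \<open>f3 x f1 = f2 and f3 x f2 = - f1, so f3 x (f1 + i f2) = - i (f1 + i f2).\<close>

lemma isotropic_for_frame:
  assumes "right_handed_axes f1 f2 f3"
  shows "isotropic_for f3 (s *s (cvec f1 + \<i> *s cvec f2))"
proof -
  have 1: "f3 $ 2 * f1 $ 3 - f3 $ 3 * f1 $ 2 = f2 $ 1" "f3 $ 3 * f1 $ 1 - f3 $ 1 * f1 $ 3 = f2 $ 2"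
    "f3 $ 1 * f1 $ 2 - f3 $ 2 * f1 $ 1 = f2 $ 3"
    using cross_right_handed(3)[OF assms] by (auto simp: cross3_def)
  have 2: "f3 $ 2 * f2 $ 3 - f3 $ 3 * f2 $ 2 = - f1 $ 1" "f3 $ 3 * f2 $ 1 - f3 $ 1 * f2 $ 3 =
      - f1 $ 2"
    "f3 $ 1 * f2 $ 2 - f3 $ 2 * f2 $ 1 = - f1 $ 3"
    using arg_cong[OF cross_right_handed(5)[OF assms], of "\<lambda>v. v $ 1"]
      arg_cong[OF cross_right_handed(5)[OF assms], of "\<lambda>v. v $ 2"]
      arg_cong[OF cross_right_handed(5)[OF assms], of "\<lambda>v. v $ 3"] by (simp_all add: cross3_def)
  have id: "s * (of_real u + \<i> * of_real v) = \<i> * (of_real p * (s * (of_real a + \<i> * of_real b))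
      - of_real q * (s * (of_real c + \<i> * of_real d)))"
    if "p * a - q * c = v" "p * b - q * d = - u" for u v p q a b c d :: real
  proof -
    have "\<i> * (of_real p * (s * (of_real a + \<i> * of_real b)) - of_real q * (s * (of_real c
        + \<i> * of_real d)))
      = s * (\<i> * of_real (p * a - q * c) - of_real (p * b - q * d))"
      by (simp add: algebra_simps)
    then show ?thesis unfolding that by (simp add: algebra_simps)
  qed
  show ?thesis
    unfolding isotropic_for_def vector_smult_component vector_add_component cvec_def vec_lambda_beta
    using id[OF 1(1) 2(1)] id[OF 1(2) 2(2)] id[OF 1(3) 2(3)] by blast
qed

text \<open>The right-hand side i n x z is odd in n, so z = - z.\<close>

lemma isotropic_for_opposite:
  assumes "isotropic_for n z" "isotropic_for (- n) z"
  shows "z = 0"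
proof -
  have "z $ 1 = - z $ 1" "z $ 2 = - z $ 2" "z $ 3 = - z $ 3"
    using assms unfolding isotropic_for_def
    by (metis (no_types, lifting) minus_diff_minus mult_minus_left mult_minus_right of_real_minus
        vector_uminus_component)+
  then show ?thesis by (simp add: vec_eq_iff forall_3)
qed

lemma smooth_on_vec_component: "open S \<Longrightarrow> smooth_on S f \<Longrightarrow> smooth_on S (\<lambda>x. f x $ k)"
  by (rule smooth_on_bounded_linear_comp[OF _ bounded_linear_vec_nth])

text \<open>Differentiability of F suffices, since its partial derivatives are the smooth functions
  e^(-ig) c_k.\<close>

lemma phase_gradient_onI:
  assumes V: "open V" and c: "smooth_on V c" and g: "smooth_on V g"
    and F: "\<And>P. P \<in> V \<Longrightarrow> F differentiable (at P)"
    and eq: "\<And>P. P \<in> V \<Longrightarrow> c P = exp (\<i> * complex_of_real (g P)) *s grad F P"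
  shows "phase_gradient_on V c g F"
proof -
  have e: "smooth_on V (\<lambda>P. exp (\<i> * complex_of_real (- g P)) * c P $ k)" for k
    by (rule smooth_on_mult[OF V smooth_on_exp_ii[OF V smooth_on_minus[OF V g]]
        smooth_on_vec_component[OF V c]])
  have "exp (\<i> * complex_of_real (- g P)) * c P $ k = partial_deriv k F P" if "P \<in> V" for P k
    using eq[OF that] by (simp add: vec_eq_iff grad_def mult.assoc[symmetric] exp_add[symmetric])
  then have sp: "smooth_on V (partial_deriv k F)" for k
    by (intro smooth_on_cong[OF V e]) simp
  have "smooth_on V F"
  proof (rule smooth_onI_derivative[OF V has_derivative_partial[OF F]])
    show "smooth_on V (\<lambda>x. complex_of_real (v $ 1) * partial_deriv 1 F x + complex_of_real
        (v $ 2) * partial_deriv 2 F x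
        + complex_of_real (v $ 3) * partial_deriv 3 F x)" for v
      by (intro smooth_on_add[OF V] smooth_on_mult[OF V smooth_on_const] sp)
  qed
  then show ?thesis using g eq by (simp add: phase_gradient_on_def)
qed

lemma cartesian_form_solution:
  assumes V: "open V" and c: "smooth_on V c" and fr: "right_handed_axes e1 e2 e3"
    and form: "cartesian_form_on V q e1 e2 e3 c"
  shows "\<exists>F. phase_gradient_on V c (coord q e3) F" "\<And>P. P \<in> V \<Longrightarrow> curl c P = c P"
proof -
  define w where "w P = Complex (coord q e1 P) (coord q e2 P)" for P
  obtain D \<Phi> where D: "open D" "\<Phi> holomorphic_on D" and all: "\<forall>P\<in>V. w P \<in> D
      \<and> c P = exp (\<i> * complex_of_real (coord q e3 P)) *s grad (\<lambda>Q. \<Phi> (w Q)) P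
      \<and> c P = (exp (\<i> * complex_of_real (coord q e3 P)) * deriv \<Phi> (w P)) *s (cvec e1
          + \<i> *s cvec e2)"
    using form unfolding cartesian_form_on_def Let_def w_def[abs_def] by (elim exE conjE)
  have wD: "w P \<in> D" and c1: "c P = exp (\<i> * complex_of_real (coord q e3 P)) *s grad (\<lambda>Q. \<Phi>
      (w Q)) P"
    and c2: "c P = (exp (\<i> * complex_of_real (coord q e3 P)) * deriv \<Phi> (w P)) *s (cvec e1
        + \<i> *s cvec e2)"
    if "P \<in> V" for P
    using bspec[OF all that] by blast+
  have "(\<lambda>Q. \<Phi> (w Q)) differentiable (at P)" if "P \<in> V" for P
  proof -
    have "(w has_derivative (\<lambda>v. Complex (v \<bullet> e1) (v \<bullet> e2))) (at P)"
      unfolding w_def[abs_def] by (intro has_derivative_Complex has_derivative_coord)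
    from has_field_derivative_comp_has_derivative[OF holomorphic_derivI[OF D(2,1) wD[OF that]] this]
    show ?thesis by (auto simp: differentiable_def)
  qed
  from phase_gradient_onI[OF V c smooth_on_coord[OF V] this c1]
  have ph: "phase_gradient_on V c (coord q e3) (\<lambda>Q. \<Phi> (w Q))" .
  then show "\<exists>F. phase_gradient_on V c (coord q e3) F" by blast
  show "curl c P = c P" if P: "P \<in> V" for P
  proof (rule iffD2[OF curl_eq_iff_isotropic[OF V ph P]])
    show "isotropic_for (rgrad (coord q e3) P) (c P)"
      unfolding rgrad_coord c2[OF P] by (rule isotropic_for_frame[OF fr])
  qed
qed

text \<open>Beyond solving the equation, the conclusions record that r is a signed distance from q
  with unit radial gradient. They no longer mention \<theta> and \<phi>, so different charts can be
  compared near the axis.\<close>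

lemma spherical_form_solution:
  assumes V: "open V" and c: "smooth_on V c" and fr: "right_handed_axes e1 e2 e3"
    and form: "spherical_form_on V q e1 e2 e3 c"
  obtains r F where "phase_gradient_on V c r F" "\<And>P. P \<in> V \<Longrightarrow> curl c P = c P" "smooth_on V r"
    "\<And>P. P \<in> V \<Longrightarrow> r P \<noteq> 0" "\<And>P. P \<in> V \<Longrightarrow> P - q = r P *\<^sub>R rgrad r P"
    "\<And>P. P \<in> V \<Longrightarrow> rgrad r P \<bullet> rgrad r P = 1" "\<And>P. P \<in> V \<Longrightarrow> isotropic_for (rgrad r P) (c P)"
proof -
  obtain r \<theta> \<phi> D \<Phi> where chart: "spherical_chart q e1 e2 e3 V r \<theta> \<phi>" and D: "open D"
      "\<Phi> holomorphic_on D"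
    and all: "\<forall>P\<in>V. Complex (- artanh (cos (\<theta> P))) (\<phi> P) \<in> D \<and>
              c P = exp (\<i> * complex_of_real (r P)) *s grad (\<lambda>Q. \<Phi> (Complex (- artanh (cos (\<theta> Q)))
                  (\<phi> Q))) P \<and>
              c P = (exp (\<i> * complex_of_real (r P)) / complex_of_real (r P * sin (\<theta> P))
                       * deriv \<Phi> (Complex (- artanh (cos (\<theta> P))) (\<phi> P))) *s
                      (cvec (theta_hat e1 e2 e3 (\<theta> P) (\<phi> P)) +
                       \<i> *s cvec (phi_hat e1 e2 (\<phi> P)))"
    using form unfolding spherical_form_on_def Let_def by (elim exE conjE)
  define w where "w P = Complex (- artanh (cos (\<theta> P))) (\<phi> P)" for P
  have wD: "w P \<in> D"
    and c1: "c P = exp (\<i> * complex_of_real (r P)) *s grad (\<lambda>Q. \<Phi> (w Q)) P"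
    and c2: "\<exists>s. c P = s *s (cvec (theta_hat e1 e2 e3 (\<theta> P) (\<phi> P)) + \<i> *s cvec (phi_hat e1 e2
        (\<phi> P)))"
    if "P \<in> V" for P
    using bspec[OF all that] unfolding w_def by blast+
  have sr: "smooth_on V r" using chart by (simp add: spherical_chart_def)
  have "(\<lambda>Q. \<Phi> (w Q)) differentiable (at P)" if "P \<in> V" for P
    using has_field_derivative_comp_has_derivative[OF holomorphic_derivI[OF D(2,1) wD[OF that]]
        has_derivative_spherical_variable[OF V chart fr that, folded w_def]]
    by (auto simp: differentiable_def)
  from phase_gradient_onI[OF V c sr this c1]
  have ph: "phase_gradient_on V c r (\<lambda>Q. \<Phi> (w Q))" .
  have rg: "rgrad r P = r_hat e1 e2 e3 (\<theta> P) (\<phi> P)" if "P \<in> V" for P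
    by (rule rgrad_eqI) (use spherical_chart_derivative(1)[OF V chart fr that] in \<open>simp add:
        inner_commute\<close>)
  note sph = right_handed_spherical[OF fr]
  have iso: "isotropic_for (rgrad r P) (c P)" if "P \<in> V" for P
    using c2[OF that] isotropic_for_frame[OF sph] unfolding rg[OF that] by auto
  show ?thesis
  proof (rule that[OF ph curl_eq_iff_isotropic[OF V ph, THEN iffD2, OF _ iso] sr _ _ _ iso])
    fix P assume P: "P \<in> V"
    show "r P \<noteq> 0" using chart P by (simp add: spherical_chart_def)
    show "rgrad r P \<bullet> rgrad r P = 1" unfolding rg[OF P] by (rule right_handed_axesD(3)[OF sph])
    have "P - q = coord q e1 P *\<^sub>R e1 + coord q e2 P *\<^sub>R e2 + coord q e3 P *\<^sub>R e3"
      unfolding coord_def by (rule frame_expansion[OF fr])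
    then show "P - q = r P *\<^sub>R rgrad r P"
      using chart P unfolding rg[OF P] by (simp add: spherical_chart_def r_hat_def
          scaleR_add_right mult.assoc)
  qed
qed

text \<open>The potential is the integral over t in [0, 1] of (x - p) . h(p + t (x - p)). Closedness
  turns the x_j-derivative of the integrand into d/dt (t h_j(p + t (x - p))), whose integral is
  h_j(x).\<close>

lemma poincare_lemma_ball:
  fixes h :: "3 \<Rightarrow> real^3 \<Rightarrow> complex"
  assumes sm: "\<And>k. smooth_on (ball p d) (h k)"
    and closed: "\<And>x j k. x \<in> ball p d \<Longrightarrow> partial_deriv j (h k) x = partial_deriv k (h j) x"
  obtains F where "\<And>x. x \<in> ball p d \<Longrightarrow> (F has_derivative (\<lambda>v. \<Sum>k\<in>UNIV. v $ k *\<^sub>R h k x)) (at x)"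
proof -
  define y where "y x t = p + t *\<^sub>R (x - p)" for x :: "real^3" and t :: real
  have yB: "y x t \<in> ball p d" if "x \<in> ball p d" "t \<in> cbox 0 1" for x t
  proof -
    have "norm (t *\<^sub>R (x - p)) \<le> norm (x - p)" using that(2) by (simp add: mult_left_le_one_le)
    then show ?thesis using that(1) by (simp add: y_def dist_norm norm_minus_commute)
  qed
  define f where "f x t = (\<Sum>k\<in>UNIV. (x - p) $ k *\<^sub>R h k (y x t))" for x t
  \<comment> \<open>This is d/dt (t h_j(y x t)).\<close>
  define G where "G j x t = h j (y x t) + t *\<^sub>R (\<Sum>k\<in>UNIV. (x - p) $ k *\<^sub>R partial_deriv k (h j)
      (y x t))" for j x t
  \<comment> \<open>The covector g dx_j as a bounded linear function, the form of derivative used in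
    differentiating under the integral.\<close>
  define L where "L j g = blinfun_scaleR_left g o\<^sub>L blinfun_inner_left (axis j 1 :: real^3)"
      for j :: 3 and g :: complex
  have blL: "bounded_linear (L j)" for j
    unfolding L_def
    by (rule bounded_linear_compose[OF bounded_bilinear.bounded_linear_left[OF
        bounded_bilinear_blinfun_compose]
          bounded_linear_blinfun_scaleR_left])
  have Lv: "blinfun_apply (L j g) v = v $ j *\<^sub>R g" for j g v
    by (simp add: L_def inner_axis)
  define fx where "fx x t = (\<Sum>j\<in>UNIV. L j (G j x t))" for x t
  have conty: "continuous_on (ball p d \<times> cbox 0 1) (\<lambda>z. y (fst z) (snd z))"
    unfolding y_def by (intro continuous_intros)
  have ch: "continuous_on (ball p d \<times> cbox 0 1) (\<lambda>z. k (y (fst z) (snd z)))"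
    if "smooth_on (ball p d) k" for k :: "real^3 \<Rightarrow> complex"
    by (rule continuous_on_compose2[OF smooth_on_imp_continuous_on[OF that] conty]) (use yB in auto)
  have "continuous_on (ball p d \<times> cbox 0 1) (\<lambda>z. fx (fst z) (snd z))"
    unfolding fx_def G_def
    by (intro continuous_on_sum bounded_linear.continuous_on[OF blL] continuous_on_add
        continuous_on_scaleR
        ch sm smooth_on_partial_deriv continuous_intros) 
  then have cont_fx: "continuous_on (ball p d \<times> cbox 0 1) (\<lambda>(x, t). fx x t)"
    by (simp add: case_prod_unfold)
  have integ: "f x integrable_on cbox 0 1" if x: "x \<in> ball p d" for x
  proof (rule integrable_continuous)
    have "continuous_on (ball p d \<times> cbox 0 1) (\<lambda>z. f (fst z) (snd z))"
      unfolding f_def by (intro continuous_on_sum continuous_on_scaleR ch sm continuous_intros)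
    then have "continuous_on (cbox 0 1) (\<lambda>t. f (fst (x, t)) (snd (x, t)))"
      by (rule continuous_on_compose2) (use x in \<open>auto intro!: continuous_intros\<close>)
    then show "continuous_on (cbox 0 1) (f x)" by simp
  qed
  have dh: "(h k has_derivative (\<lambda>v. \<Sum>j\<in>UNIV. v $ j *\<^sub>R partial_deriv j (h k) z)) (at z)" if "z
      \<in> ball p d" for k z
    using has_derivative_partial[OF smooth_on_differentiable[OF sm that]]
        by (simp add: sum_3 scaleR_conv_of_real)
  have df: "((\<lambda>x. f x t) has_derivative blinfun_apply (fx x t)) (at x within ball p d)"
    if x: "x \<in> ball p d" and t: "t \<in> cbox 0 1" for x t
  proof (rule has_derivative_at_withinI)
    have dx: "((\<lambda>x. x - p) has_derivative (\<lambda>v. v)) (at x)"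
      using has_derivative_diff[OF has_derivative_ident has_derivative_const] by fastforce
    have dy: "((\<lambda>x. y x t) has_derivative (\<lambda>v. t *\<^sub>R v)) (at x)"
      unfolding y_def using has_derivative_add[OF has_derivative_const
          has_derivative_scaleR_right[OF dx]] by fastforce
    have "((\<lambda>x. f x t) has_derivative (\<lambda>v. \<Sum>k\<in>UNIV. (x - p) $ k *\<^sub>R (\<Sum>j\<in>UNIV.
        (t *\<^sub>R v) $ j *\<^sub>R partial_deriv j (h k) (y x t))
        + v $ k *\<^sub>R h k (y x t))) (at x)"
      unfolding f_def
      by (intro has_derivative_sum has_derivative_scaleR bounded_linear.has_derivative[OF
          bounded_linear_vec_nth dx]
          has_derivative_compose[OF dy dh[OF yB[OF x t]]])
    moreover have "(\<Sum>k\<in>UNIV. (x - p) $ k *\<^sub>R (\<Sum>j\<in>UNIV. (t *\<^sub>R v) $ j *\<^sub>R partial_deriv j (h k)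
        (y x t))
        + v $ k *\<^sub>R h k (y x t)) = blinfun_apply (fx x t) v" for v
      unfolding fx_def blinfun.sum_left Lv G_def
      using closed[OF yB[OF x t], of 1 2] closed[OF yB[OF x t], of 1 3] closed[OF yB[OF x t], of 2
          3]
      by (simp add: sum_3 algebra_simps)
    ultimately show "((\<lambda>x. f x t) has_derivative blinfun_apply (fx x t)) (at x)" by simp
  qed
  show ?thesis
  proof (rule that)
    fix x assume x: "x \<in> ball p d"
    have "(fx x has_integral (\<Sum>j\<in>UNIV. L j (h j x))) (cbox 0 1)"
      unfolding fx_def
    proof (intro has_integral_sum)
      fix j :: 3
      have "((\<lambda>t. t *\<^sub>R h j (y x t)) has_vector_derivative G j x t) (at t within {0..1})" if t: "t
          \<in> {0..1}" for t
      proof -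
        have yt: "y x t \<in> ball p d" using yB[OF x, of t] t by simp
        have "((\<lambda>t. h j (y x t)) has_vector_derivative (\<Sum>k\<in>UNIV. (x - p) $ k *\<^sub>R partial_deriv k
            (h j) (y x t))) (at t within {0..1})"
          using has_vector_derivative_at_within[OF has_derivative_along_line[of "h j" _ p t "x
              - p", OF dh[of "p + t *\<^sub>R (x - p)" j]]] yt
          unfolding y_def by simp
        from has_vector_derivative_scaleR[OF DERIV_ident this]
        show ?thesis by (simp add: G_def add.commute)
      qed
      from fundamental_theorem_of_calculus[OF _ this]
      have "(G j x has_integral h j x) (cbox 0 1)" by (simp add: y_def)
      from has_integral_linear[OF this blL]
      show "((\<lambda>t. L j (G j x t)) has_integral L j (h j x)) (cbox 0 1)" by (simp add: o_def)
    qed simp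
    then have int: "integral (cbox 0 1) (fx x) = (\<Sum>j\<in>UNIV. L j (h j x))" by (rule integral_unique)
    have "((\<lambda>x. integral (cbox 0 1) (f x)) has_derivative blinfun_apply (integral (cbox 0 1)
        (fx x))) (at x within ball p d)"
      by (rule leibniz_rule[OF df integ cont_fx x convex_ball])
    moreover have "blinfun_apply (integral (cbox 0 1) (fx x)) = (\<lambda>v. \<Sum>k\<in>UNIV. v $ k *\<^sub>R h k x)"
      unfolding int by (simp add: fun_eq_iff blinfun.sum_left Lv)
    ultimately show "((\<lambda>x. integral (cbox 0 1) (f x)) has_derivative
        (\<lambda>v. \<Sum>k\<in>UNIV. v $ k *\<^sub>R h k x)) (at x)"
      using at_within_open[OF x open_ball] by simp
  qed
qed

section \<open>Passing through the polar axis\<close>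

lemma closed_polar_axis: "closed (polar_axis q e1 e2)"
  unfolding polar_axis_def coord_def
  by (intro closed_Collect_conj closed_Collect_eq continuous_intros)

lemma coord_add: "coord q e (P + v) = coord q e P + v \<bullet> e"
  by (simp add: coord_def inner_diff_left inner_add_left)

text \<open>A point on the axis leaves it when moved along e1. The pair of coordinates serves as the
  function with dense nonzero set in \<open>continuous_eq_zero_of_dense\<close>.\<close>

lemma exists_off_polar_axis:
  assumes "right_handed_axes e1 e2 e3" "open W" "W \<noteq> {}"
  shows "\<exists>P\<in>W. (coord q e1 P, coord q e2 P) \<noteq> 0"
proof -
  note e = right_handed_axesD[OF assms(1)]
  obtain x d where x: "0 < d" "cball x d \<subseteq> W"
    using assms(2,3) open_contains_cball by blast
  have n1: "norm e1 = 1" using e(1) by (simp add: norm_eq_1)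
  have "x + d *\<^sub>R e1 \<in> W" "x \<in> W" using x n1 by (auto simp: dist_norm)
  moreover have "coord q e1 (x + d *\<^sub>R e1) = coord q e1 x + d" by (simp add: coord_add e)
  ultimately show ?thesis
    using x(1) by (intro bexI[of _ "if coord q e1 x = 0 then x + d *\<^sub>R e1 else x"])
        (auto simp: zero_prod_def)
qed

lemma eq_zero_off_polar_axis:
  assumes "right_handed_axes e1 e2 e3" "open V" "continuous_on V f"
    and "\<And>P. P \<in> V - polar_axis q e1 e2 \<Longrightarrow> f P = (0::'b::real_normed_vector)" and "P \<in> V"
  shows "f P = 0"
proof (rule continuous_eq_zero_of_dense[where c = "\<lambda>P.
    (coord q e1 P, coord q e2 P)", OF assms(2,3) _ _ assms(5)])
  show "\<exists>P\<in>W. (coord q e1 P, coord q e2 P) \<noteq> 0" if "open W" "W \<noteq> {}" for W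
    by (rule exists_off_polar_axis[OF assms(1) that])
  show "f P = 0" if "P \<in> V" "(coord q e1 P, coord q e2 P) \<noteq> 0" for P
    using assms(4)[of P] that by (auto simp: polar_axis_def zero_prod_def)
qed

text \<open>Since the centre lies on the axis, the set is the image of a convex set under
  cylindrical coordinates: a half-disc for height and distance from the axis, times the whole line
  of angles.\<close>

lemma connected_ball_minus_polar_axis:
  assumes fr: "right_handed_axes e1 e2 e3" and p: "p \<in> polar_axis q e1 e2"
  shows "connected (ball p d - polar_axis q e1 e2)"
proof -
  note e = right_handed_axesD[OF fr]
  define f where "f z = p + (fst (fst z) *\<^sub>R e3 + (snd (fst z) * cos (snd z)) *\<^sub>R e1 + (snd
      (fst z) * sin (snd z)) *\<^sub>R e2)"
    for z :: "(real \<times> real) \<times> real"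
  define A where "A = (ball (0 :: real \<times> real) d \<inter> {z. (0, 1) \<bullet> z > 0}) \<times> (UNIV :: real set)"
  have "convex A" unfolding A_def
    by (intro convex_Times convex_Int convex_ball convex_halfspace_gt convex_UNIV)
  then have "connected A" by (rule convex_connected)
  moreover have "continuous_on A f" unfolding f_def by (intro continuous_intros)
  ultimately have "connected (f ` A)" by (rule connected_continuous_image[rotated])
  have nf: "(norm (f ((t, \<rho>), \<phi>) - p))^2 = (norm (t, \<rho>))^2" for t \<rho> \<phi>
  proof -
    have "(f ((t, \<rho>), \<phi>) - p) \<bullet> (f ((t, \<rho>), \<phi>) - p) = t * t + \<rho> * \<rho> * (cos \<phi> * cos \<phi>
        + sin \<phi> * sin \<phi>)"
      by (simp add: f_def inner_add_left inner_add_right e distrib_left mult_ac del: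
          sin_cos_squared_add3)
    then show ?thesis
      by (simp only: power2_norm_eq_inner inner_Pair inner_real_def sin_cos_squared_add3
          mult_1_right)
  qed
  then have nf: "norm (f ((t, \<rho>), \<phi>) - p) = norm (t, \<rho>)" for t \<rho> \<phi>
    by (metis norm_ge_zero power2_eq_imp_eq)
  have cp: "coord q e1 p = 0" "coord q e2 p = 0" using p by (auto simp: polar_axis_def)
  have "f ` A = ball p d - polar_axis q e1 e2"
  proof (intro equalityI subsetI)
    fix P assume "P \<in> f ` A"
    then obtain t \<rho> \<phi> where P: "P = f ((t, \<rho>), \<phi>)" and a: "norm (t, \<rho>) < d" "0 < \<rho>"
      by (auto simp: A_def)
    have "P \<in> ball p d" using a nf[of t \<rho> \<phi>] by (simp add: P dist_norm norm_minus_commute)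
    moreover have "coord q e1 P = \<rho> * cos \<phi>" "coord q e2 P = \<rho> * sin \<phi>"
      by (simp_all add: P f_def coord_add inner_add_left e cp)
    then have "P \<notin> polar_axis q e1 e2"
      using a(2) by (auto simp: polar_axis_def dest: sin_zero_abs_cos_one)
    ultimately show "P \<in> ball p d - polar_axis q e1 e2" by blast
  next
    fix P assume P: "P \<in> ball p d - polar_axis q e1 e2"
    define z where "z = Complex ((P - p) \<bullet> e1) ((P - p) \<bullet> e2)"
    have "coord q e P = coord q e p + (P - p) \<bullet> e" for e using coord_add[of q e p "P - p"] by simp
    then have z0: "z \<noteq> 0" using P cp by (auto simp: polar_axis_def z_def complex_eq_iff)
    have "z = of_real (cmod z) * cis (Arg z)"
      using z0 by (simp add: cis_Arg sgn_div_norm scaleR_conv_of_real)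
    from arg_cong[OF this, of Re] arg_cong[OF this, of Im]
    have zc: "(P - p) \<bullet> e1 = cmod z * cos (Arg z)" "(P - p) \<bullet> e2 = cmod z * sin (Arg z)"
      by (simp_all add: z_def)
    have Pf: "P = f (((P - p) \<bullet> e3, cmod z), Arg z)"
      using frame_expansion[OF fr, of "P - p"] unfolding zc f_def by (simp add: algebra_simps)
    have "norm ((P - p) \<bullet> e3, cmod z) = dist p P"
      using nf[of "(P - p) \<bullet> e3" "cmod z" "Arg z"] unfolding Pf[symmetric]
          by (simp add: dist_norm norm_minus_commute)
    then have "(((P - p) \<bullet> e3, cmod z), Arg z) \<in> A"
      using P z0 by (simp add: A_def)
    then show "P \<in> f ` A" using Pf by blast
  qed
  then show ?thesis using \<open>connected (f ` A)\<close> by simp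
qed

text \<open>curl (e^(-ig) c) = e^(-ig) (curl c - i n x c) = 0, so the Poincare lemma supplies the
  potential.\<close>

lemma phase_potential_on_ball:
  assumes c: "smooth_on (ball p d) c" and g: "smooth_on (ball p d) g"
    and iso: "\<And>P. P \<in> ball p d \<Longrightarrow> isotropic_for (rgrad g P) (c P)"
    and curl: "\<And>P. P \<in> ball p d \<Longrightarrow> curl c P = c P"
  shows "\<exists>F. phase_gradient_on (ball p d) c g F"
proof -
  define h where "h k P = exp (\<i> * complex_of_real (- g P)) * c P $ k" for k P
  have sg: "smooth_on (ball p d) (\<lambda>P. - g P)" by (rule smooth_on_minus[OF open_ball g])
  have sc: "smooth_on (ball p d) (\<lambda>P. c P $ k)" for k
      by (rule smooth_on_vec_component[OF open_ball c])
  have sh: "smooth_on (ball p d) (h k)" for k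
    unfolding h_def[abs_def] by (rule smooth_on_mult[OF open_ball smooth_on_exp_ii[OF open_ball
        sg] sc])
  have "partial_deriv j (h k) P = partial_deriv k (h j) P" if P: "P \<in> ball p d" for P j k
  proof -
    let ?n = "rgrad g P" and ?d = "\<lambda>j k. partial_deriv j (\<lambda>Q. c Q $ k) P"
    have "rgrad (\<lambda>P. - g P) P = - ?n"
      by (rule rgrad_eqI) (use has_derivative_minus[OF has_derivative_rgrad[OF g P]] in simp)
    then have dh: "partial_deriv j (h k) P = exp (\<i> * complex_of_real (- g P)) * (?d j k
        - \<i> * ?n $ j * c P $ k)" for j k
      unfolding h_def[abs_def]
      using partial_deriv_phase[OF sg P smooth_on_differentiable[OF sc P], of j k] by simp
    note z = isotropic_forD[OF iso[OF P]]
    have cc: "?d 2 3 - ?d 3 2 = c P $ 1" "?d 3 1 - ?d 1 3 = c P $ 2" "?d 1 2 - ?d 2 1 = c P $ 3"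
      using arg_cong[OF curl[OF P], of "\<lambda>v. v $ 1"] arg_cong[OF curl[OF P], of "\<lambda>v. v $ 2"]
        arg_cong[OF curl[OF P], of "\<lambda>v. v $ 3"] unfolding curl_def vector_3 .
    note t = trans[OF cc(1) z(1)] trans[OF cc(2) z(2)] trans[OF cc(3) z(3)]
    have 23: "?d 2 3 - \<i> * ?n $ 2 * c P $ 3 = ?d 3 2 - \<i> * ?n $ 3 * c P $ 2"
      using t(1) by (simp add: algebra_simps)
    have 31: "?d 3 1 - \<i> * ?n $ 3 * c P $ 1 = ?d 1 3 - \<i> * ?n $ 1 * c P $ 3"
      using t(2) by (simp add: algebra_simps)
    have 12: "?d 1 2 - \<i> * ?n $ 1 * c P $ 2 = ?d 2 1 - \<i> * ?n $ 2 * c P $ 1"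
      using t(3) by (simp add: algebra_simps)
    have "\<forall>j k. ?d j k - \<i> * ?n $ j * c P $ k = ?d k j - \<i> * ?n $ k * c P $ j"
      unfolding forall_3 using 23 31 12 by simp
    then show ?thesis unfolding dh by simp
  qed
  from poincare_lemma_ball[OF sh this] obtain F where
    F: "\<And>P. P \<in> ball p d \<Longrightarrow> (F has_derivative (\<lambda>v. \<Sum>k\<in>UNIV. v $ k *\<^sub>R h k P)) (at P)"
    by blast
  have "grad F P = (\<chi> k. h k P)" if "P \<in> ball p d" for P
    unfolding grad_eqI[OF F[OF that]] by (simp add: vec_eq_iff forall_3 sum_3 axis_def)
  then have "c P = exp (\<i> * complex_of_real (g P)) *s grad F P" if "P \<in> ball p d" for P
    using that by (simp add: vec_eq_iff h_def mult.assoc[symmetric] exp_add[symmetric])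
  then have "phase_gradient_on (ball p d) c g F"
    using F by (intro phase_gradient_onI[OF open_ball c g]) (auto simp: differentiable_def)
  then show ?thesis by blast
qed

lemma phase_gradient_on_zero:
  assumes "\<And>P. P \<in> V \<Longrightarrow> c P = 0"
  shows "phase_gradient_on V c (\<lambda>_. 0) (\<lambda>_. 0)"
proof -
  have "grad (\<lambda>_. 0) P = 0" for P by (simp add: vec_eq_iff grad_def partial_deriv_def
      frechet_derivative_const)
  then show ?thesis using assms by (simp add: phase_gradient_on_def)
qed

text \<open>If \<open>c\<close> is orthogonal to the rays through \<open>q\<close>, then \<open>y(t) = t c(q + t X)\<close> solves
  \<open>y' = y \<times> X\<close>, so \<open>|y|\<close> is constant.\<close>

lemma beltrami_radial_zero:
  assumes c: "smooth_on (ball q d) c" and curl: "\<And>P. P \<in> ball q d \<Longrightarrow> curl c P = c P"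
    and orth: "\<And>P. P \<in> ball q d \<Longrightarrow> cdot (c P) (P - q) = 0" and x: "x \<in> ball q d"
  shows "c x = 0"
proof -
  define X where "X = x - q"
  define y where "y k t = t *\<^sub>R (c (q + t *\<^sub>R X) $ k)" for k t
  have inB: "q + t *\<^sub>R X \<in> ball q d" if "t \<in> {0..1}" for t
  proof -
    have "norm (t *\<^sub>R X) \<le> norm X" using that by (simp add: mult_left_le_one_le)
    then show ?thesis using x by (simp add: X_def dist_norm norm_minus_commute)
  qed
  have sc: "smooth_on (ball q d) (\<lambda>P. c P $ k)" for k
      by (rule smooth_on_vec_component[OF open_ball c])
  have dy: "(y 1 has_vector_derivative (y 2 t * X $ 3 - y 3 t * X $ 2)) (at t)
      \<and> (y 2 has_vector_derivative (y 3 t * X $ 1 - y 1 t * X $ 3)) (at t)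
      \<and> (y 3 has_vector_derivative (y 1 t * X $ 2 - y 2 t * X $ 1)) (at t)" if t: "t \<in> {0..1}" for t
  proof -
    define P where "P = q + t *\<^sub>R X"
    have P: "P \<in> ball q d" using inB[OF t] by (simp add: P_def)
    have PX: "P - q = t *\<^sub>R X" by (simp add: P_def)
    let ?d = "\<lambda>j k. partial_deriv j (\<lambda>Q. c Q $ k) P"
    let ?D = "\<lambda>k (v :: real^3). complex_of_real (v $ 1) * ?d 1 k + complex_of_real
        (v $ 2) * ?d 2 k + complex_of_real (v $ 3) * ?d 3 k"
    have dc: "((\<lambda>Q. c Q $ k) has_derivative ?D k) (at P)" for k
      by (rule has_derivative_partial[OF smooth_on_differentiable[OF sc P]])
    have dx: "((\<lambda>Q. complex_of_real ((Q - q) $ k)) has_derivative (\<lambda>v. complex_of_real (v $ k)))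
        (at P)" for k
    proof -
      have "((\<lambda>Q. Q - q) has_derivative (\<lambda>v. v)) (at P)"
        using has_derivative_diff[OF has_derivative_ident has_derivative_const] by fastforce
      from has_derivative_of_real[OF bounded_linear.has_derivative[OF bounded_linear_vec_nth this]]
      show ?thesis .
    qed
    \<comment> \<open>Differentiating c . (P - q) = 0 gives c_j = - t (sum over k of X_k d_j c_k).
      Substituting this in y' = c + t (X . grad) c leaves only differences d_j c_k - d_k c_j, that
      is, curl c = c.\<close>
    have "((\<lambda>Q. cdot (c Q) (Q - q)) has_derivative (\<lambda>v.
        ((P - q) $ 1 * ?D 1 v + v $ 1 * c P $ 1) + ((P - q) $ 2 * ?D 2 v + v $ 2 * c P $ 2)
        + ((P - q) $ 3 * ?D 3 v + v $ 3 * c P $ 3))) (at P)"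
      unfolding cdot_def by (intro has_derivative_add has_derivative_mult dx dc)
    moreover have "((\<lambda>Q. cdot (c Q) (Q - q)) has_derivative (\<lambda>v. 0)) (at P)"
      by (rule has_derivative_transform_within_open[OF has_derivative_const[of
          "0::complex"] open_ball P])
        (simp add: orth)
    ultimately have "(\<lambda>v. ((P - q) $ 1 * ?D 1 v + v $ 1 * c P $ 1) + ((P - q) $ 2 * ?D 2 v
        + v $ 2 * c P $ 2)
        + ((P - q) $ 3 * ?D 3 v + v $ 3 * c P $ 3)) = (\<lambda>v. 0)"
      by (rule has_derivative_unique)
    note o = fun_cong[OF this]
    have o1: "c P $ 1 = - (of_real t * (X $ 1 * ?d 1 1 + X $ 2 * ?d 1 2 + X $ 3 * ?d 1 3))"
      using o[of "axis 1 1"] unfolding PX by (simp add: axis_def algebra_simps eq_neg_iff_add_eq_0)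
    have o2: "c P $ 2 = - (of_real t * (X $ 1 * ?d 2 1 + X $ 2 * ?d 2 2 + X $ 3 * ?d 2 3))"
      using o[of "axis 2 1"] unfolding PX by (simp add: axis_def algebra_simps eq_neg_iff_add_eq_0)
    have o3: "c P $ 3 = - (of_real t * (X $ 1 * ?d 3 1 + X $ 2 * ?d 3 2 + X $ 3 * ?d 3 3))"
      using o[of "axis 3 1"] unfolding PX by (simp add: axis_def algebra_simps eq_neg_iff_add_eq_0)
    have cc: "?d 2 3 = c P $ 1 + ?d 3 2" "?d 3 1 = c P $ 2 + ?d 1 3" "?d 1 2 = c P $ 3 + ?d 2 1"
      using arg_cong[OF curl[OF P], of "\<lambda>v. v $ 1"] arg_cong[OF curl[OF P], of "\<lambda>v. v $ 2"]
        arg_cong[OF curl[OF P], of "\<lambda>v. v $ 3"] unfolding curl_def vector_3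
            by (simp_all only: diff_eq_eq)
    have vd: "(y k has_vector_derivative (t *\<^sub>R ?D k X + 1 *\<^sub>R c P $ k)) (at t)" for k
      unfolding y_def[abs_def] P_def
      by (rule has_vector_derivative_scaleR[OF DERIV_ident has_derivative_along_line])
        (use dc[of k] in \<open>simp only: P_def\<close>)
    have yk: "y k t = of_real t * c P $ k" for k by (simp add: y_def P_def scaleR_conv_of_real)
    have "t *\<^sub>R ?D 1 X + 1 *\<^sub>R c P $ 1 = y 2 t * X $ 3 - y 3 t * X $ 2"
      unfolding scaleR_conv_of_real yk by (subst o1) (simp add: cc algebra_simps)
    moreover have "t *\<^sub>R ?D 2 X + 1 *\<^sub>R c P $ 2 = y 3 t * X $ 1 - y 1 t * X $ 3"
      unfolding scaleR_conv_of_real yk by (subst o2) (simp add: cc algebra_simps)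
    moreover have "t *\<^sub>R ?D 3 X + 1 *\<^sub>R c P $ 3 = y 1 t * X $ 2 - y 2 t * X $ 1"
      unfolding scaleR_conv_of_real yk by (subst o3) (simp add: cc algebra_simps)
    ultimately show ?thesis using vd[of 1] vd[of 2] vd[of 3] by simp
  qed
  \<comment> \<open>The squared length of y. It vanishes at t = 0 because of the factor t, and at t
    = 1 it is |c x|^2.\<close>
  define E where "E t = Re (y 1 t) * Re (y 1 t) + Re (y 2 t) * Re (y 2 t) + Re (y 3 t) * Re (y 3 t)
    + (Im (y 1 t) * Im (y 1 t) + Im (y 2 t) * Im (y 2 t) + Im (y 3 t) * Im (y 3 t))" for t
  have "E 0 = E 1"
  proof (rule has_derivative_zero_unique[of "{0..1}" E])
    fix t :: real assume t: "t \<in> {0..1}"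
    note re = bounded_linear.has_vector_derivative[OF bounded_linear_Re, folded
        has_real_derivative_iff_has_vector_derivative]
    note im = bounded_linear.has_vector_derivative[OF bounded_linear_Im, folded
        has_real_derivative_iff_has_vector_derivative]
    note d = dy[OF t, THEN conjunct1] dy[OF t, THEN conjunct2, THEN conjunct1] dy[OF t, THEN
        conjunct2, THEN conjunct2]
    have "(E has_real_derivative 0) (at t)"
      unfolding E_def[abs_def]
      by (rule DERIV_cong[OF DERIV_add[OF DERIV_add[OF DERIV_add[OF DERIV_mult[OF re[OF d(1)]
          re[OF d(1)]] DERIV_mult[OF re[OF d(2)] re[OF d(2)]]]
             DERIV_mult[OF re[OF d(3)] re[OF d(3)]]]
            DERIV_add[OF DERIV_add[OF DERIV_mult[OF im[OF d(1)] im[OF d(1)]] DERIV_mult[OF im[OF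
                d(2)] im[OF d(2)]]]
             DERIV_mult[OF im[OF d(3)] im[OF d(3)]]]]])
        (simp add: algebra_simps)
    then show "(E has_derivative (\<lambda>h. 0)) (at t within {0..1})"
      using has_derivative_at_withinI[of E "\<lambda>h. 0"] by (simp add:
          has_field_derivative_def mult_zero_left[abs_def])
  qed auto
  then have "E 1 = 0" by (simp add: E_def y_def)
  have cx: "y k 1 = c x $ k" for k by (simp add: y_def X_def)
  have "\<forall>k. Re (c x $ k) = 0 \<and> Im (c x $ k) = 0"
    using \<open>E 1 = 0\<close> unfolding forall_3 E_def cx
    by (smt (verit) not_real_square_gt_zero zero_le_square)
  then show ?thesis by (simp add: vec_eq_iff complex_eq_iff)
qed

lemma smooth_on_norm_diff:
  fixes q :: "real^3"
  assumes "open V" "q \<notin> V"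
  shows "smooth_on V (\<lambda>P. norm (P - q))"
  unfolding norm_eq_sqrt_inner
proof (rule smooth_on_sqrt[OF assms(1)])
  show "smooth_on V (\<lambda>P. (P - q) \<bullet> (P - q))"
    by (intro smooth_on_bilinear[OF assms(1) bounded_bilinear_inner] smooth_on_diff[OF assms(1)]
        smooth_on_id[OF assms(1)] smooth_on_const)
  show "0 < (P - q) \<bullet> (P - q)" if "P \<in> V" for P using that assms(2) by auto
qed

lemma rgrad_scaled_norm_diff:
  assumes "P \<noteq> q"
  shows "rgrad (\<lambda>P. s * norm (P - q)) P = s *\<^sub>R sgn (P - q)"
proof (rule rgrad_eqI)
  have "((\<lambda>P. P - q) has_derivative (\<lambda>v. v)) (at P)"
    using has_derivative_diff[OF has_derivative_ident has_derivative_const] by fastforce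
  from has_derivative_mult_right[OF has_derivative_compose[OF this has_derivative_norm]]
  show "((\<lambda>P. s * norm (P - q)) has_derivative (\<lambda>v. (s *\<^sub>R sgn (P - q)) \<bullet> v)) (at P)"
    using assms by (simp add: inner_commute)
qed

lemma smooth_on_curl:
  assumes "open U" "smooth_on U c"
  shows "smooth_on U (\<lambda>P. curl c P $ k)"
proof -
  have "\<forall>k. smooth_on U (\<lambda>P. curl c P $ k)"
    unfolding forall_3 curl_def vector_3
    by (intro conjI smooth_on_diff[OF assms(1)] smooth_on_partial_deriv smooth_on_vec_component[OF
        assms])
  then show ?thesis by blast
qed

text \<open>The local chart may use either sign of r. Near p the sign is fixed, and the normal is
  then s times the outward radial direction, an expression free of the chart.\<close>

lemma spherical_form_radial:
  assumes V: "open V" and c: "smooth_on V c" and fr: "right_handed_axes e1 e2 e3"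
    and form: "spherical_form_on V q e1 e2 e3 c" and p: "p \<in> V"
  obtains N s where "open N" "p \<in> N" "N \<subseteq> V" "s = 1 \<or> s = - 1"
    "\<And>P. P \<in> N \<Longrightarrow> isotropic_for (s *\<^sub>R sgn (P - q)) (c P)"
proof -
  obtain r F where "phase_gradient_on V c r F" and "\<And>P. P \<in> V \<Longrightarrow> curl c P = c P" and sr:
      "smooth_on V r"
    and r0: "\<And>P. P \<in> V \<Longrightarrow> r P \<noteq> 0" and Pq: "\<And>P. P \<in> V \<Longrightarrow> P - q = r P *\<^sub>R rgrad r P"
    and unit: "\<And>P. P \<in> V \<Longrightarrow> rgrad r P \<bullet> rgrad r P = 1"
    and iso: "\<And>P. P \<in> V \<Longrightarrow> isotropic_for (rgrad r P) (c P)"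
    by (rule spherical_form_solution[OF V c fr form]; (rule that)?; assumption)
  define N where "N = V \<inter> (\<lambda>P. r P * r p) -` {0<..}"
  have "open N"
    unfolding N_def
    by (intro continuous_open_preimage V continuous_intros smooth_on_imp_continuous_on[OF sr])
  moreover have "p \<in> N" using p r0[OF p] by (simp add: N_def zero_less_mult_iff
      linorder_neq_iff[symmetric])
  moreover have "sgn (r p) = 1 \<or> sgn (r p) = - 1" using r0[OF p] by (auto simp: sgn_real_def)
  moreover have "isotropic_for (sgn (r p) *\<^sub>R sgn (P - q)) (c P)" if "P \<in> N" for P
  proof -
    have P: "P \<in> V" and pos: "0 < r P * r p" using that by (auto simp: N_def)
    have "norm (rgrad r P) = 1" using unit[OF P] by (simp add: norm_eq_1)
    then have "sgn (P - q) = sgn (r P) *\<^sub>R rgrad r P"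
      unfolding Pq[OF P] sgn_scaleR by (simp add: sgn_div_norm)
    moreover have "sgn (r p) = sgn (r P)" using pos by (auto simp: zero_less_mult_iff)
    moreover have "sgn (r P) * sgn (r P) = 1" using r0[OF P]
        by (simp add: sgn_mult[symmetric] sgn_real_def)
    ultimately have "sgn (r p) *\<^sub>R sgn (P - q) = rgrad r P" by simp
    then show ?thesis using iso[OF P] by simp
  qed
  ultimately show ?thesis using that[of N "sgn (r p)"] by (auto simp: N_def)
qed

lemma continuous_on_isotropic_defect:
  assumes "continuous_on B n" "continuous_on B c"
  shows "continuous_on B (\<lambda>P. c P $ i - \<i> * (complex_of_real (n P $ j) * c P $ k - complex_of_real
      (n P $ l) * c P $ m))"
  by (intro continuous_intros assms)

text \<open>Each component of c - i n x c is continuous and vanishes off the axis, whose complement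
  is dense.\<close>

lemma isotropic_for_off_axis_limit:
  assumes fr: "right_handed_axes e1 e2 e3" and "open B" "continuous_on B n" "continuous_on B c"
    and "\<And>P. P \<in> B - polar_axis q e1 e2 \<Longrightarrow> isotropic_for (n P) (c P)" and "P \<in> B"
  shows "isotropic_for (n P) (c P)"
proof -
  have lim: "c P $ i = \<i> * (complex_of_real (n P $ j) * c P $ k - complex_of_real
      (n P $ k) * c P $ j)"
    if eq: "\<And>P. P \<in> B - polar_axis q e1 e2 \<Longrightarrow> c P $ i = \<i> * (complex_of_real (n P $ j) * c P $ k
        - complex_of_real (n P $ k) * c P $ j)"
    for i j k
  proof (rule iffD1[OF right_minus_eq])
    show "c P $ i - \<i> * (complex_of_real (n P $ j) * c P $ k - complex_of_real
        (n P $ k) * c P $ j) = 0"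
      by (rule eq_zero_off_polar_axis[OF fr assms(2) continuous_on_isotropic_defect[OF assms(3,4)]
          _ assms(6)])
        (rule iffD2[OF right_minus_eq eq])
  qed
  show ?thesis
    unfolding isotropic_for_def
    using lim[of 1 2 3] lim[of 2 3 1] lim[of 3 1 2] assms(5)[unfolded isotropic_for_def] by blast
qed

lemma spherical_forms_solution:
  assumes U: "open U" and c: "smooth_on U c" and fr: "right_handed_axes e1 e2 e3"
    and loc: "locally_at U (U - polar_axis q e1 e2) (\<lambda>V. spherical_form_on V q e1 e2 e3 c)"
  shows "P \<in> U \<Longrightarrow> curl c P = c P"
    and "p \<in> U \<Longrightarrow> \<exists>V. open V \<and> p \<in> V \<and> V \<subseteq> U \<and> (\<exists>g F. phase_gradient_on V c g F)"
proof -
  let ?A = "polar_axis q e1 e2"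
  have ex: "\<exists>V. open V \<and> P \<in> V \<and> V \<subseteq> U \<and> spherical_form_on V q e1 e2 e3 c" if "P \<in> U - ?A" for P
    using loc that unfolding locally_at_def by blast
  have off: "curl c P = c P \<and> (\<exists>V. open V \<and> P \<in> V \<and> V \<subseteq> U \<and> (\<exists>g F. phase_gradient_on V c g F))"
    and radial: "\<exists>N s. open N \<and> P \<in> N \<and> N \<subseteq> U \<and> (s = 1 \<or> s = - 1) \<and> (\<forall>Q\<in>N. isotropic_for
        (s *\<^sub>R sgn (Q - q)) (c Q))"
    if P: "P \<in> U - ?A" for P
  proof -
    obtain V where V: "open V" "P \<in> V" "V \<subseteq> U" "spherical_form_on V q e1 e2 e3 c" using ex[OF P]
        by (elim exE conjE)
    note cV = smooth_on_subset[OF c V(3)]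
    obtain r F where rF: "phase_gradient_on V c r F" "\<And>P. P \<in> V \<Longrightarrow> curl c P = c P"
      by (rule spherical_form_solution[OF V(1) cV fr V(4)]; (rule that)?; assumption)
    show "curl c P = c P \<and> (\<exists>V. open V \<and> P \<in> V \<and> V \<subseteq> U \<and> (\<exists>g F. phase_gradient_on V c g F))"
      using V rF by blast
    obtain N s where N: "open N" "P \<in> N" "N \<subseteq> V" "s = 1 \<or> s = - 1"
      and iso: "\<And>Q. Q \<in> N \<Longrightarrow> isotropic_for (s *\<^sub>R sgn (Q - q)) (c Q)"
      by (rule spherical_form_radial[OF V(1) cV fr V(4,2)]; (rule that)?; assumption)
    show "\<exists>N s. open N \<and> P \<in> N \<and> N \<subseteq> U \<and> (s = 1 \<or> s = - 1) \<and> (\<forall>Q\<in>N. isotropic_for (s *\<^sub>R sgn (Q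
        - q)) (c Q))"
      by (intro exI[of _ N] exI[of _ s]) (use N V(3) iso in auto)
  qed
  show curl: "curl c P = c P" if "P \<in> U" for P
  proof -
    have "curl c P $ k - c P $ k = 0" for k
    proof (rule eq_zero_off_polar_axis[OF fr U _ _ that])
      show "continuous_on U (\<lambda>P. curl c P $ k - c P $ k)"
        by (intro smooth_on_imp_continuous_on smooth_on_diff[OF U] smooth_on_curl[OF U c]
            smooth_on_vec_component[OF U c])
      show "curl c P $ k - c P $ k = 0" if "P \<in> U - polar_axis q e1 e2" for P
        using off[OF that] by simp
    qed
    then show ?thesis by (simp add: vec_eq_iff)
  qed
  have contc: "continuous_on U c" by (rule smooth_on_imp_continuous_on[OF c])
  show "\<exists>V. open V \<and> p \<in> V \<and> V \<subseteq> U \<and> (\<exists>g F. phase_gradient_on V c g F)" if p: "p \<in> U"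
  proof -
    consider "p \<notin> ?A" | "p = q" | "p \<in> ?A" "p \<noteq> q" by blast
    then show ?thesis
    proof cases
      case 1
      then show ?thesis using off p by blast
    next
      case 2
      obtain d where d: "0 < d" "ball q d \<subseteq> U" using U p 2 open_contains_ball by blast
      \<comment> \<open>Orthogonality to the rays, unlike the normal itself, does not depend on s
        and extends continuously to q.\<close>
      have orth: "cdot (c P) (P - q) = 0" if "P \<in> U" for P
      proof (rule eq_zero_off_polar_axis[OF fr U _ _ that, of "\<lambda>P. cdot (c P) (P - q)"])
        show "continuous_on U (\<lambda>P. cdot (c P) (P - q))"
          unfolding cdot_def by (intro continuous_intros contc)
        fix P assume "P \<in> U - ?A"
        from radial[OF this] obtain s where s: "s = 1 \<or> s = - 1" "isotropic_for (s *\<^sub>R sgn (P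
            - q)) (c P)"
          by blast
        have "P - q = (norm (P - q) * s) *\<^sub>R (s *\<^sub>R sgn (P - q))"
          using s(1) by (cases "P = q") (auto simp: sgn_div_norm)
        then show "cdot (c P) (P - q) = 0"
          using isotropic_for_orthogonal[OF s(2)] by (metis cdot_scaleR mult_zero_right)
      qed
      have "c P = 0" if "P \<in> ball q d" for P
        by (rule beltrami_radial_zero[OF smooth_on_subset[OF c d(2)] _ _ that])
            (use curl orth d(2) in auto)
      from phase_gradient_on_zero[OF this]
      have "\<exists>g F. phase_gradient_on (ball q d) c g F" by (intro exI)
      then show ?thesis using d 2 by (intro exI[of _ "ball q d"]) simp
    next
      case 3
      obtain d0 where d0: "0 < d0" "ball p d0 \<subseteq> U" using U p open_contains_ball by blast
      \<comment> \<open>The open ball then omits q, so that the distance from q is smooth on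
        it.\<close>
      define d where "d = min d0 (dist p q)"
      define B where "B = ball p d"
      have d: "0 < d" using d0 3 by (simp add: d_def)
      have B: "open B" "p \<in> B" "B \<subseteq> U" "q \<notin> B" using d d0 by (auto simp: B_def d_def)
      define S where "S = B - ?A"
      have S: "open S" "connected S" "S \<subseteq> U - ?A"
        using B connected_ball_minus_polar_axis[OF fr 3(1)] closed_polar_axis[of q e1 e2]
        by (auto simp: S_def B_def open_Diff)
      note cB = smooth_on_subset[OF c B(3)]
      \<comment> \<open>The largest open part of \<open>S\<close> on which c is isotropic for the
        radial direction with sign s; the parts for 1 and -1 cover \<open>S\<close>.\<close>
      define A where "A s = \<Union>{N. open N \<and> N \<subseteq> S \<and> (\<forall>Q\<in>N. isotropic_for (s *\<^sub>R sgn (Q - q))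
          (c Q))}" for s :: real
      have oA: "open (A s)" for s unfolding A_def by (intro open_Union) auto
      have AS: "A s \<subseteq> S" for s unfolding A_def by blast
      have isoA: "isotropic_for (s *\<^sub>R sgn (Q - q)) (c Q)" if "Q \<in> A s" for Q s
        using that unfolding A_def by blast
      have cover: "S \<subseteq> A 1 \<union> A (- 1)"
      proof
        fix P assume P: "P \<in> S"
        then obtain N s where N: "open N" "P \<in> N" "s = 1 \<or> s = - 1" "\<forall>Q\<in>N. isotropic_for
            (s *\<^sub>R sgn (Q - q)) (c Q)"
          using radial[of P] S(3) by blast
        have "P \<in> A s" unfolding A_def using N P S(1) by (intro UnionI[of "N \<inter> S"]) auto
        then show "P \<in> A 1 \<union> A (- 1)" using N(3) by blast
      qed
      have "\<exists>g F. phase_gradient_on B c g F"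
      proof (cases "A 1 \<inter> A (- 1) = {}")
        case False
        \<comment> \<open>On the overlap both signs hold, which forces c = 0 there; unique
          continuation spreads this over the connected \<open>S\<close>.\<close>
        have zero: "c P = 0" if "P \<in> S" for P
        proof (rule phase_field_unique_continuation[OF S(1,2) _ _ _ False _ _ that])
          show "curl c P = c P" if "P \<in> S" for P using curl S(3) that by blast
          show "open (A 1 \<inter> A (- 1))" "A 1 \<inter> A (- 1) \<subseteq> S" using oA AS by auto
          show "c P = 0" if "P \<in> A 1 \<inter> A (- 1)" for P
            using isotropic_for_opposite[of "sgn (P - q)" "c P"] isoA[of P 1] isoA[of P
                "- 1"] that by simp
          fix P assume P: "P \<in> S"
          then have "P \<in> U - ?A" using S(3) by blast
          from conjunct2[OF off[OF this]] obtain V g F where V: "open V" "P \<in> V"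
              "phase_gradient_on V c g F"
            by (elim exE conjE)
          then have "open (V \<inter> S) \<and> P \<in> V \<inter> S \<and> V \<inter> S \<subseteq> S \<and> phase_gradient_on (V \<inter> S) c g F"
            using P S(1) phase_gradient_on_subset[OF V(3)] by auto
          then show "\<exists>V g F. open V \<and> P \<in> V \<and> V \<subseteq> S \<and> phase_gradient_on V c g F" by blast
        qed
        have "c P = 0" if "P \<in> B" for P
          by (rule eq_zero_off_polar_axis[where q
              = q, OF fr B(1) continuous_on_subset[OF contc B(3)] _ that])
            (simp add: zero S_def)
        from phase_gradient_on_zero[OF this] show ?thesis by (intro exI)
      next
        case True
        \<comment> \<open>Without overlap, connectedness of \<open>S\<close> around the axis selects
          one sign, and s |P - q| is a phase on the whole ball.\<close>
        have "A 1 \<inter> S = {} \<or> A (- 1) \<inter> S = {}"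
          using connectedD[OF S(2) oA oA _ cover] True by blast
        then obtain s :: real where s: "S \<subseteq> A s" using cover by blast
        have sg: "smooth_on B (\<lambda>P. s * norm (P - q))"
          by (rule smooth_on_mult[OF B(1) smooth_on_const smooth_on_norm_diff[OF B(1,4)]])
        have "isotropic_for (s *\<^sub>R sgn (P - q)) (c P)" if "P \<in> B" for P
        proof (rule isotropic_for_off_axis_limit[where q
            = q, OF fr B(1) _ continuous_on_subset[OF contc B(3)] _ that])
          show "continuous_on B (\<lambda>P. s *\<^sub>R sgn (P - q))"
            unfolding sgn_div_norm using B(4) by (intro continuous_intros) auto
          show "isotropic_for (s *\<^sub>R sgn (P - q)) (c P)" if "P \<in> B - ?A" for P
            using isoA[of P s] s that by (auto simp: S_def)
        qed
        moreover have "rgrad (\<lambda>P. s * norm (P - q)) P = s *\<^sub>R sgn (P - q)" if "P \<in> B" for P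
          by (rule rgrad_scaled_norm_diff) (use that B(4) in auto)
        ultimately have "\<exists>F. phase_gradient_on B c (\<lambda>P. s * norm (P - q)) F"
          unfolding B_def
          by (intro phase_potential_on_ball) (use cB sg curl B(3) in \<open>auto simp: B_def\<close>)
        then show ?thesis by (rule exI[where P = "\<lambda>g. \<exists>F. phase_gradient_on B c g F"])
      qed
      then show ?thesis using B(1-3) by (intro exI[of _ B] conjI)
    qed
  qed
qed

section \<open>Classification\<close>

lemma classification_forward:
  assumes U: "open U" "connected U" and curl: "\<And>P. P \<in> U \<Longrightarrow> curl c P = c P"
    and loc: "\<And>p. p \<in> U \<Longrightarrow> \<exists>V g F. open V \<and> p \<in> V \<and> V \<subseteq> U \<and> phase_gradient_on V c g F"
  shows "\<exists>q e1 e2 e3. right_handed_axes e1 e2 e3 \<and>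
    (locally_at U U (\<lambda>V. cartesian_form_on V q e1 e2 e3 c) \<or>
     locally_at U (U - polar_axis q e1 e2) (\<lambda>V. spherical_form_on V q e1 e2 e3 c))"
proof (cases "\<forall>P\<in>U. c P = 0")
  case True
  \<comment> \<open>The zero field determines no normal; it is assigned to the Cartesian class with
    arbitrary axes and F = 0.\<close>
  have "axis 3 1 \<bullet> axis 3 (1::real) = (1::real)" by (simp add: inner_axis_axis)
  then obtain e1 e2 :: "real^3" where fr: "right_handed_axes e1 e2 (axis 3 1)"
      by (rule exists_right_handed_axes)
  have g0: "grad (\<lambda>_. 0) P = 0" for P by (simp add: vec_eq_iff grad_def partial_deriv_def
      frechet_derivative_const)
  have "cartesian_form_on U 0 e1 e2 (axis 3 1) c"
    unfolding cartesian_form_on_def Let_def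
    by (intro exI[of _ UNIV] exI[of _ "\<lambda>_. 0"]) (use True in \<open>simp add: g0\<close>)
  then have "locally_at U U (\<lambda>V. cartesian_form_on V 0 e1 e2 (axis 3 1) c)"
    unfolding locally_at_def using U(1) by blast
  then show ?thesis using fr by blast
next
  case False
  then obtain P0 where P0: "P0 \<in> U" "c P0 \<noteq> 0" by blast
  obtain n \<kappa> where sn: "smooth_on U n" and sk: "smooth_on U \<kappa>" and unit: "\<And>P. P \<in> U \<Longrightarrow> n P \<bullet> n P = 1"
    and dn: "\<And>P. P \<in> U \<Longrightarrow> (n has_derivative (\<lambda>v. \<kappa> P *\<^sub>R (v - (v \<bullet> n P) *\<^sub>R n P))) (at P)"
    and locn: "\<And>p. p \<in> U \<Longrightarrow> \<exists>V g F. open V \<and> p \<in> V \<and> V \<subseteq> U \<and> phase_gradient_on V c g F \<and>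
        (\<forall>P\<in>V. rgrad g P = n P)"
    by (rule global_normal_field[OF U curl loc P0]; (rule that)?; assumption)
  interpret umbilic_field U n \<kappa>
    by unfold_locales (use U sn sk unit dn in auto)
  show ?thesis
  proof (rule flat_or_radial)
    fix e assume e: "\<And>P. P \<in> U \<Longrightarrow> n P = e"
    have "e \<bullet> e = 1" using unit[OF P0(1)] e[OF P0(1)] by simp
    then obtain e1 e2 where fr: "right_handed_axes e1 e2 e" by (rule exists_right_handed_axes)
    \<comment> \<open>Any origin would do: moving it shifts z and x + i y by constants, which are
      absorbed into F.\<close>
    have "locally_at U U (\<lambda>V. cartesian_form_on V 0 e1 e2 e c)"
      unfolding locally_at_def
    proof
      fix p assume p: "p \<in> U"
      obtain V g F where V: "open V" "p \<in> V" "V \<subseteq> U" "phase_gradient_on V c g F" "\<forall>P\<in>V. rgrad g P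
          = n P"
        using locn[OF p] by (elim exE conjE)
      interpret phase_field V c g F
        by unfold_locales (use V curl in auto)
      have "rgrad g P = e" if "P \<in> V" for P using V e that by auto
      from cartesian_form[OF V(2) this fr, of 0]
      show "\<exists>V. open V \<and> p \<in> V \<and> V \<subseteq> U \<and> cartesian_form_on V 0 e1 e2 e c"
        using V(3) by blast
    qed
    then show ?thesis using fr by blast
  next
    fix q assume k: "\<And>P. P \<in> U \<Longrightarrow> \<kappa> P \<noteq> 0" and nq: "\<And>P. P \<in> U \<Longrightarrow> n P = \<kappa> P *\<^sub>R (P - q)"
    \<comment> \<open>Only the centre q is determined by the field; the direction of the polar axis
      is arbitrary.\<close>
    have "axis 3 1 \<bullet> axis 3 (1::real) = (1::real)" by (simp add: inner_axis_axis)
    then obtain e1 e2 :: "real^3" where fr: "right_handed_axes e1 e2 (axis 3 1)"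
        by (rule exists_right_handed_axes)
    have "locally_at U (U - polar_axis q e1 e2) (\<lambda>V. spherical_form_on V q e1 e2 (axis 3 1) c)"
      unfolding locally_at_def
    proof
      fix p assume p: "p \<in> U - polar_axis q e1 e2"
      then have pU: "p \<in> U" and pax: "p \<notin> polar_axis q e1 e2" by auto
      obtain V g F where V: "open V" "p \<in> V" "V \<subseteq> U" "phase_gradient_on V c g F" "\<forall>P\<in>V. rgrad g P
          = n P"
        using locn[OF pU] by (elim exE conjE)
      interpret phase_field V c g F
        by unfold_locales (use V curl in auto)
      have "\<exists>W. open W \<and> p \<in> W \<and> W \<subseteq> V \<and> spherical_form_on W q e1 e2 (axis 3 1) c"
        by (rule spherical_form[OF V(2) fr bspec[OF V(5)] smooth_on_subset[OF sn V(3)]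
              unit[OF subsetD[OF V(3)]] smooth_on_subset[OF sk V(3)] k[OF subsetD[OF V(3)]]
              derivative_k[OF subsetD[OF V(3)]] nq[OF subsetD[OF V(3)]] pax])
      then show "\<exists>V. open V \<and> p \<in> V \<and> V \<subseteq> U \<and> spherical_form_on V q e1 e2 (axis 3 1) c"
        using V(3) by blast
    qed
    then show ?thesis using fr by blast
  qed
qed

theorem mainTheorem1:
  fixes U :: "(real^3) set" and c :: "real^3 \<Rightarrow> complex^3"
  assumes "open U" and "connected U" and "smooth_on U c"
  shows "((\<forall>P\<in>U. curl c P = c P) \<and>
          locally_at U U (\<lambda>V. \<exists>g F. phase_gradient_on V c g F))
         \<longleftrightarrow>
         (\<exists>q e1 e2 e3. right_handed_axes e1 e2 e3 \<and>
            (locally_at U U (\<lambda>V. cartesian_form_on V q e1 e2 e3 c) \<or>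
             locally_at U (U - polar_axis q e1 e2) (\<lambda>V. spherical_form_on V q e1 e2 e3 c)))"
proof
  assume l: "(\<forall>P\<in>U. curl c P = c P) \<and> locally_at U U (\<lambda>V. \<exists>g F. phase_gradient_on V c g F)"
  show "\<exists>q e1 e2 e3. right_handed_axes e1 e2 e3 \<and>
    (locally_at U U (\<lambda>V. cartesian_form_on V q e1 e2 e3 c) \<or>
     locally_at U (U - polar_axis q e1 e2) (\<lambda>V. spherical_form_on V q e1 e2 e3 c))"
  proof (rule classification_forward[OF assms(1,2)])
    show "curl c P = c P" if "P \<in> U" for P using l that by blast
    show "\<exists>V g F. open V \<and> p \<in> V \<and> V \<subseteq> U \<and> phase_gradient_on V c g F" if "p \<in> U" for p
      using conjunct2[OF l] that unfolding locally_at_def by blast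
  qed
next
  assume "\<exists>q e1 e2 e3. right_handed_axes e1 e2 e3 \<and>
    (locally_at U U (\<lambda>V. cartesian_form_on V q e1 e2 e3 c) \<or>
     locally_at U (U - polar_axis q e1 e2) (\<lambda>V. spherical_form_on V q e1 e2 e3 c))"
  then obtain q e1 e2 e3 where fr: "right_handed_axes e1 e2 e3"
    and "locally_at U U (\<lambda>V. cartesian_form_on V q e1 e2 e3 c) \<or>
     locally_at U (U - polar_axis q e1 e2) (\<lambda>V. spherical_form_on V q e1 e2 e3 c)"
    by (elim exE conjE)
  then consider "locally_at U U (\<lambda>V. cartesian_form_on V q e1 e2 e3 c)"
    | "locally_at U (U - polar_axis q e1 e2) (\<lambda>V. spherical_form_on V q e1 e2 e3 c)"
    by blast
  then show "(\<forall>P\<in>U. curl c P = c P) \<and> locally_at U U (\<lambda>V. \<exists>g F. phase_gradient_on V c g F)"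
  proof cases
    case 1
    have "curl c p = c p \<and> (\<exists>V. open V \<and> p \<in> V \<and> V \<subseteq> U \<and> (\<exists>g F. phase_gradient_on V c g F))"
      if p: "p \<in> U" for p
    proof -
      obtain V where V: "open V" "p \<in> V" "V \<subseteq> U" "cartesian_form_on V q e1 e2 e3 c"
        using 1 p unfolding locally_at_def by blast
      note sol = cartesian_form_solution[OF V(1) smooth_on_subset[OF assms(3) V(3)] fr V(4)]
      show ?thesis using sol(1) sol(2)[OF V(2)] V(1-3) by blast
    qed
    then show ?thesis unfolding locally_at_def by blast
  next
    case 2
    note sol = spherical_forms_solution[OF assms(1,3) fr 2]
    show ?thesis
      unfolding locally_at_def using sol by (intro conjI ballI)
  qed
qed

end
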